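(* The class of $(\overline{2P_1+P_2},\,P_2+P_3)$-free graphs is well-quasi-ordered by the labelled induced subgraph relation.
   Context: Graphs are finite, undirected and simple. $P_r$ is the path on $r$ vertices, $G+H$ is the disjoint union of vertex-disjoint graphs $G,H$, $rG$ is the disjoint union of $r$ copies of $G$, and $\overline{G}$ is the complement of $G$. A graph is $(H_1,\ldots,H_p)$-free if it has no induced subgraph isomorphic to any of $H_1,\ldots,H_p$. A quasi-order is a reflexive, transitive relation. A quasi-order $\leq$ on a set $W$ is a well-quasi-order if every infinite sequence $x_1,x_2,\ldots$ in $W$ contains a pair with $x_i\leq x_j$, $i<j$ (equivalently: no infinite strictly decreasing sequence and no infinite antichain, an antichain being a set of pairwise incomparable elements). Given a quasi-order $(W,\leq)$, a labelled graph is a graph $G$ in which each vertex $v$ is assigned a label $l_G(v)\in W$. For labelled graphs $G,H$, $G$ is a labelled induced subgraph of $H$ if there is an isomorphism from $G$ to an induced subgraph of $H$ mapping each vertex $v$ of $G$ to a vertex $w$ of $H$ with $l_G(v)\leq l_H(w)$. A class $X$ of graphs is well-quasi-ordered by the labelled induced subgraph relation if, for every well-quasi-order $(W,\leq)$, there is no infinite antichain (with respect to the labelled induced subgraph relation) of graphs from $X$ labelled with elements of $W$. *)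

theory Defs
  imports "Graph_Theory.Graph_Theory"
begin

text \<open>Finite simple undirected graphs are modelled by \<^locale>\<open>pair_graph\<close>: the arc set is a
  finite, symmetric, irreflexive relation on a finite vertex set.\<close>

definition path_graph :: "nat \<Rightarrow> nat pair_pre_digraph" where
  "path_graph r =
    \<lparr> pverts = {..<r}, parcs = {(u, v). u < r \<and> v < r \<and> (v = Suc u \<or> u = Suc v)} \<rparr>"

definition disjoint_union ::
    "'a pair_pre_digraph \<Rightarrow> 'b pair_pre_digraph \<Rightarrow> ('a + 'b) pair_pre_digraph" where
  "disjoint_union G H =
    \<lparr> pverts = pverts G <+> pverts H,
      parcs = map_prod Inl Inl ` parcs G \<union> map_prod Inr Inr ` parcs H \<rparr>"

definition copies :: "nat \<Rightarrow> 'a pair_pre_digraph \<Rightarrow> (nat \<times> 'a) pair_pre_digraph" where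
  "copies r G =
    \<lparr> pverts = {..<r} \<times> pverts G,
      parcs = {((i, u), (j, v)). i < r \<and> i = j \<and> (u, v) \<in> parcs G} \<rparr>"

definition complement :: "'a pair_pre_digraph \<Rightarrow> 'a pair_pre_digraph" where
  "complement G =
    \<lparr> pverts = pverts G,
      parcs = {(u, v). u \<in> pverts G \<and> v \<in> pverts G \<and> u \<noteq> v \<and> (u, v) \<notin> parcs G} \<rparr>"

definition free_of :: "'b pair_pre_digraph \<Rightarrow> 'a pair_pre_digraph \<Rightarrow> bool" where
  "free_of H G \<longleftrightarrow>
    \<not> (\<exists>K. induced_subgraph K (with_proj G) \<and> digraph_iso (with_proj H) K)"

definition wqo_on :: "('l \<Rightarrow> 'l \<Rightarrow> bool) \<Rightarrow> 'l set \<Rightarrow> bool" where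
  "wqo_on le W \<longleftrightarrow> reflp_on W le \<and> transp_on W le \<and>
    (\<forall>x :: nat \<Rightarrow> 'l. range x \<subseteq> W \<longrightarrow> (\<exists>i j. i < j \<and> le (x i) (x j)))"

text \<open>The values of a labelling outside the vertex set are irrelevant. They may make two pairs
  distinct that stand for the same labelled graph, but such pairs are comparable in both
  directions under \<open>labelled_induced_subgraph\<close>, so no antichain contains both.\<close>

type_synonym ('v, 'l) labelled_graph = "'v pair_pre_digraph \<times> ('v \<Rightarrow> 'l)"

definition labelled_graphs :: "'v pair_pre_digraph set \<Rightarrow> 'l set \<Rightarrow> ('v, 'l) labelled_graph set" where
  "labelled_graphs X W = {(G, l). G \<in> X \<and> (\<forall>v \<in> pverts G. l v \<in> W)}"

definition labelled_induced_subgraph ::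
    "('l \<Rightarrow> 'l \<Rightarrow> bool) \<Rightarrow> ('u, 'l) labelled_graph \<Rightarrow> ('v, 'l) labelled_graph \<Rightarrow> bool" where
  "labelled_induced_subgraph le = (\<lambda>(G, lG) (H, lH).
    \<exists>f. pre_digraph.digraph_isomorphism (with_proj G) f \<and>
        induced_subgraph (app_iso f (with_proj G)) (with_proj H) \<and>
        (\<forall>v \<in> pverts G. le (lG v) (lH (iso_verts f v))))"

definition antichain :: "('a \<Rightarrow> 'a \<Rightarrow> bool) \<Rightarrow> 'a set \<Rightarrow> bool" where
  "antichain le A \<longleftrightarrow> (\<forall>x \<in> A. \<forall>y \<in> A. x \<noteq> y \<longrightarrow> \<not> le x y \<and> \<not> le y x)"

text \<open>HOL cannot quantify over types inside a formula, so the type that holds the labels is a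
  parameter; a theorem with a free type variable \<open>'l\<close> covers every quasi-order.\<close>

definition wqo_by_labelled_induced_subgraph ::
    "'l itself \<Rightarrow> 'v pair_pre_digraph set \<Rightarrow> bool" where
  "wqo_by_labelled_induced_subgraph _ X \<longleftrightarrow>
    (\<forall>(le :: 'l \<Rightarrow> 'l \<Rightarrow> bool) W. wqo_on le W \<longrightarrow>
      \<not> (\<exists>A. A \<subseteq> labelled_graphs X W \<and> infinite A \<and>
              antichain (labelled_induced_subgraph le) A))"


subsection \<open>Basic facts\<close>

lemma pair_graph_iff:
  "pair_graph G \<longleftrightarrow> finite (pverts G) \<and> parcs G \<subseteq> pverts G \<times> pverts G \<and>
    sym (parcs G) \<and> irrefl (parcs G)"
proof
  assume "pair_graph G"
  then interpret pair_graph G .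
  show "finite (pverts G) \<and> parcs G \<subseteq> pverts G \<times> pverts G \<and> sym (parcs G) \<and> irrefl (parcs G)"
    using pair_finite_verts arc_fst_in_verts arc_snd_in_verts pair_sym_arcs pair_no_loops
    by (force simp: symmetric_def irrefl_def)
next
  assume *: "finite (pverts G) \<and> parcs G \<subseteq> pverts G \<times> pverts G \<and> sym (parcs G) \<and> irrefl (parcs G)"
  then have "finite (parcs G)"
    by (meson finite_SigmaI finite_subset)
  with * show "pair_graph G"
    by unfold_locales (auto simp: symmetric_def irrefl_def)
qed

lemma pair_graph_path_graph: "pair_graph (path_graph r)"
  unfolding pair_graph_iff path_graph_def by (auto simp: sym_def irrefl_def)

lemma pair_graph_disjoint_union:
  "pair_graph G \<Longrightarrow> pair_graph H \<Longrightarrow> pair_graph (disjoint_union G H)"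
  unfolding pair_graph_iff disjoint_union_def by (fastforce simp: sym_def irrefl_def)

lemma pair_graph_copies: "pair_graph G \<Longrightarrow> pair_graph (copies r G)"
  unfolding pair_graph_iff copies_def by (auto simp: sym_def irrefl_def)

lemma pair_graph_complement: "pair_graph G \<Longrightarrow> pair_graph (complement G)"
  unfolding pair_graph_iff complement_def by (auto simp: sym_def irrefl_def)

lemma ex_isomorphism_induced_iff:
  assumes "pair_graph G" "pair_graph H"
  shows "(\<exists>f. pre_digraph.digraph_isomorphism (with_proj G) f \<and>
            induced_subgraph (app_iso f (with_proj G)) (with_proj H) \<and> P (iso_verts f))
    \<longleftrightarrow> (\<exists>g. inj_on g (pverts G) \<and> g ` pverts G \<subseteq> pverts H \<and>
            (\<forall>u \<in> pverts G. \<forall>v \<in> pverts G. (u, v) \<in> parcs G \<longleftrightarrow> (g u, g v) \<in> parcs H) \<and> P g)"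
    (is "?L \<longleftrightarrow> ?R")
proof
  interpret G: pair_graph G by fact
  assume ?L
  then obtain f where iso: "G.digraph_isomorphism f"
    and ind: "induced_subgraph (app_iso f (with_proj G)) (with_proj H)" and P: "P (iso_verts f)"
    by blast
  let ?g = "iso_verts f"
  from ind have "iso_tail f = fst" "iso_head f = snd"
    by (auto simp: induced_subgraph_def subgraph_def compatible_def)
  with iso have arc: "iso_arcs f a = (?g (fst a), ?g (snd a))" if "a \<in> parcs G" for a
    using that by (auto simp: G.digraph_isomorphism_def prod_eq_iff)
  from iso have inj: "inj_on ?g (pverts G)"
    by (auto simp: G.digraph_isomorphism_def)
  from ind have sub: "?g ` pverts G \<subseteq> pverts H"
    by (auto simp: induced_subgraph_def subgraph_def)
  from ind have arcs: "iso_arcs f ` parcs G =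
      {e \<in> parcs H. fst e \<in> ?g ` pverts G \<and> snd e \<in> ?g ` pverts G}"
    by (auto simp: induced_subgraph_def)
  have "(u, v) \<in> parcs G \<longleftrightarrow> (?g u, ?g v) \<in> parcs H" if "u \<in> pverts G" "v \<in> pverts G" for u v
  proof
    assume "(u, v) \<in> parcs G"
    then have "(?g u, ?g v) \<in> iso_arcs f ` parcs G"
      using arc by (metis fst_conv image_eqI snd_conv)
    then show "(?g u, ?g v) \<in> parcs H"
      using arcs by blast
  next
    assume "(?g u, ?g v) \<in> parcs H"
    then have "(?g u, ?g v) \<in> iso_arcs f ` parcs G"
      using arcs that by auto
    then obtain a where a: "a \<in> parcs G" "?g (fst a) = ?g u" "?g (snd a) = ?g v"
      using arc by auto
    then have "fst a = u" "snd a = v"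
      using inj that G.arc_fst_in_verts G.arc_snd_in_verts by (auto dest: inj_onD)
    with a show "(u, v) \<in> parcs G"
      by (cases a) auto
  qed
  with inj sub P show ?R by blast
next
  interpret G: pair_graph G by fact
  interpret H: pair_graph H by fact
  assume ?R
  then obtain g where inj: "inj_on g (pverts G)" and sub: "g ` pverts G \<subseteq> pverts H"
    and arc: "\<And>u v. u \<in> pverts G \<Longrightarrow> v \<in> pverts G \<Longrightarrow> (u, v) \<in> parcs G \<longleftrightarrow> (g u, g v) \<in> parcs H"
    and P: "P g"
    by blast
  let ?f = "\<lparr> iso_verts = g, iso_arcs = map_prod g g, iso_head = snd, iso_tail = fst \<rparr>"
  have "inj_on (map_prod g g) (parcs G)"
    by (rule inj_on_subset[OF map_prod_inj_on[OF inj inj]])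
      (auto dest: G.in_arcsD1 G.in_arcsD2)
  then have iso: "G.digraph_isomorphism ?f"
    using inj by (auto simp: G.digraph_isomorphism_def G.wf_digraph)
  have eq: "map_prod g g ` parcs G = {e \<in> parcs H. fst e \<in> g ` pverts G \<and> snd e \<in> g ` pverts G}"
    using arc by (auto simp: image_iff dest: G.in_arcsD1 G.in_arcsD2) force+
  have "induced_subgraph (app_iso ?f (with_proj G)) (with_proj H)"
    using sub eq G.wf_digraphI_app_iso[OF iso] H.wf_digraph_axioms
    by (auto simp: induced_subgraph_def subgraph_def compatible_def)
  with iso P show ?L by (intro exI[of _ ?f]) auto
qed

lemma labelled_induced_subgraph_iff:
  assumes "pair_graph G" "pair_graph H"
  shows "labelled_induced_subgraph le (G, lG) (H, lH) \<longleftrightarrow>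
    (\<exists>g. inj_on g (pverts G) \<and> g ` pverts G \<subseteq> pverts H \<and>
      (\<forall>u \<in> pverts G. \<forall>v \<in> pverts G. (u, v) \<in> parcs G \<longleftrightarrow> (g u, g v) \<in> parcs H) \<and>
      (\<forall>v \<in> pverts G. le (lG v) (lH (g v))))"
  unfolding labelled_induced_subgraph_def
  using ex_isomorphism_induced_iff[OF assms, of "\<lambda>g. \<forall>v \<in> pverts G. le (lG v) (lH (g v))"]
  by simp

lemma free_of_iff:
  assumes "pair_graph H" "pair_graph G"
  shows "free_of H G \<longleftrightarrow>
    \<not> (\<exists>g. inj_on g (pverts H) \<and> g ` pverts H \<subseteq> pverts G \<and>
        (\<forall>u \<in> pverts H. \<forall>v \<in> pverts H. (u, v) \<in> parcs H \<longleftrightarrow> (g u, g v) \<in> parcs G))"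
proof -
  have "free_of H G \<longleftrightarrow>
    \<not> (\<exists>f. pre_digraph.digraph_isomorphism (with_proj H) f \<and>
        induced_subgraph (app_iso f (with_proj H)) (with_proj G) \<and> True)"
    unfolding free_of_def digraph_iso_def by blast
  then show ?thesis
    unfolding ex_isomorphism_induced_iff[OF assms, of "\<lambda>_. True"] by simp
qed

end

theory Submission
  imports Defs "HOL-Library.Ramsey" "HOL-Library.Sublist" "HOL-Library.Infinite_Set"
begin

text \<open>Cut a graph into linearly ordered pieces such that the adjacency of two vertices in different
  pieces depends only on their colours, from a finite set, and on the order of the pieces. By Higman's
  lemma, such compositions of labelled well-quasi-ordered pieces are well-quasi-ordered. Consequently
  one may delete boundedly many vertices, and one may fold vertices onto representatives that
  determine their adjacencies.

  In a bipartite $(P_2+P_3)$-free graph any two neighbourhoods on one side are comparable or differ by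
  a swap, which makes the graph a composition of very simple pieces. In general let $Q$ be a maximum
  clique. Since the diamond is excluded, every other vertex has at most one neighbour in $Q$. If
  $|Q| \ge 5$, then $G - Q$ is $P_3$-free; if $|Q| = 4$, then $G - Q$ is $P_3$-free or has bounded
  degree, and a bounded-degree $(P_2+P_3)$-free graph with an induced $P_3$ is edgeless up to boundedly
  many vertices. If $|Q| = 3$, sort the other vertices by their neighbour in $Q$; the edges inside the
  parts can be folded away, and then, up to boundedly many vertices, the graph is bipartite or a
  bipartite graph together with small columns. Triangle-free graphs either contain no induced $C_5$
  and are bipartite, or they are sorted by their adjacencies to such a $C_5$.\<close>


section \<open>Higman's lemma and labelled graphs\<close>

text \<open>The labels range over arbitrary almost full relations, and this is what makes the method
  work: a finite colour, or even a whole labelled fibre, can be absorbed into the label of a vertex.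
  It then suffices to place every graph in a finite union of composed classes, and all bounds on
  deleted vertices may be crude as long as they do not depend on the graph. The two forbidden graphs
  act through two observations. Without the diamond, two common neighbours of an edge are adjacent.
  Without P2+P3, no edge can be disjoint from an induced P3 and have no adjacency to it. So an
  induced P3 outside a maximum clique \<open>Q\<close> misses at most one vertex of
  \<open>Q\<close>, but it sees at most three, one for each of its vertices; this is the origin of
  the thresholds 5, 4 and 3 for the size of \<open>Q\<close>. The main obstacle is a triangle
  \<open>Q\<close>: its private neighbours may be three large sets with dense adjacencies between
  any two. What saves the argument is that induced matchings between two of these sets are bounded
  as soon as the third has three vertices.\<close>

text \<open>Only this half of the definition of a well-quasi-order is ever used; where transitivity would
  be needed, Ramsey's theorem supplies a subsequence in which all pairs are related.\<close>

definition af_on :: "('a \<Rightarrow> 'a \<Rightarrow> bool) \<Rightarrow> 'a set \<Rightarrow> bool" where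
  "af_on R A \<longleftrightarrow> (\<forall>f :: nat \<Rightarrow> 'a. (\<forall>i. f i \<in> A) \<longrightarrow> (\<exists>i j. i < j \<and> R (f i) (f j)))"

lemma af_onD:
  assumes "af_on R A" "\<And>i::nat. f i \<in> A"
  obtains i j where "i < j" "R (f i) (f j)"
  using assms unfolding af_on_def by blast

text \<open>The relation \<open>rep\<close> links an object to its codes, for instance a graph to
  the lists of pieces of its decompositions. It may be multivalued; one code is chosen for each
  member of the sequence.\<close>

lemma af_on_transfer:
  assumes "af_on S B" "\<And>x. x \<in> A \<Longrightarrow> \<exists>y \<in> B. rep x y"
    and "\<And>x x' y y'. x \<in> A \<Longrightarrow> x' \<in> A \<Longrightarrow> rep x y \<Longrightarrow> rep x' y' \<Longrightarrow> S y y' \<Longrightarrow> R x x'"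
  shows "af_on R A"
  unfolding af_on_def
proof (intro allI impI)
  fix f :: "nat \<Rightarrow> 'b" assume f: "\<forall>i. f i \<in> A"
  then have "\<forall>i. \<exists>y. y \<in> B \<and> rep (f i) y" using assms(2) by blast
  then obtain g where g: "\<And>i. g i \<in> B" "\<And>i. rep (f i) (g i)" by metis
  from af_onD[of S B g, OF assms(1) g(1)] obtain i j where "i < j" "S (g i) (g j)" by blast
  with assms(3) f g(2) show "\<exists>i j. i < j \<and> R (f i) (f j)" by blast
qed

lemma af_on_subset: "af_on R B \<Longrightarrow> A \<subseteq> B \<Longrightarrow> af_on R A"
  unfolding af_on_def by blast

text \<open>Colour a pair of indices by whether it is good. An infinite homogeneous set cannot have
  the bad colour, since the sequence along it contains a good pair.\<close>

lemma af_on_subsequence: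
  assumes "af_on R A" "\<And>i::nat. f i \<in> A"
  obtains \<phi> :: "nat \<Rightarrow> nat" where "strict_mono \<phi>" "\<And>i j. i < j \<Longrightarrow> R (f (\<phi> i)) (f (\<phi> j))"
proof -
  define c where "c = (\<lambda>X :: nat set. if R (f (Min X)) (f (Max X)) then 0 else 1 :: nat)"
  have "\<exists>Y t. Y \<subseteq> UNIV \<and> infinite Y \<and> t < 2 \<and> (\<forall>X. X \<subseteq> Y \<and> finite X \<and> card X = 2 \<longrightarrow> c X = t)"
    by (rule Ramsey[of UNIV 2 c 2]) (auto simp: c_def)
  then obtain Y t where Y: "infinite Y"
    and "\<forall>X. X \<subseteq> Y \<and> finite X \<and> card X = 2 \<longrightarrow> c X = t" by (elim exE conjE)
  then have t: "\<And>X. X \<subseteq> Y \<Longrightarrow> finite X \<Longrightarrow> card X = 2 \<Longrightarrow> c X = t" by simp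
  define \<phi> where "\<phi> = enumerate Y"
  have sm: "strict_mono \<phi>" unfolding \<phi>_def using Y by (simp add: strict_mono_enumerate)
  have c: "c {\<phi> i, \<phi> j} = (if R (f (\<phi> i)) (f (\<phi> j)) then 0 else 1)" if "i < j" for i j
  proof -
    have "\<phi> i < \<phi> j" using sm that by (simp add: strict_monoD)
    then show ?thesis by (simp add: c_def)
  qed
  have ct: "c {\<phi> i, \<phi> j} = t" if "i < j" for i j
  proof (rule t)
    have "\<phi> i \<noteq> \<phi> j" using sm that by (metis less_irrefl strict_monoD)
    then show "card {\<phi> i, \<phi> j} = 2" by simp
    show "{\<phi> i, \<phi> j} \<subseteq> Y" unfolding \<phi>_def using enumerate_in_set[OF Y] by auto
  qed simp
  obtain i j where ij: "i < j" "R (f (\<phi> i)) (f (\<phi> j))"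
    using af_onD[of R A "\<lambda>i. f (\<phi> i)"] assms by metis
  then have "t = 0" using c ct by metis
  then have "R (f (\<phi> i)) (f (\<phi> j))" if "i < j" for i j
    using c[OF that] ct[OF that] by (auto split: if_splits)
  with sm that show thesis by blast
qed

lemma af_on_Un:
  assumes A: "af_on R A" and B: "af_on R B"
  shows "af_on R (A \<union> B)"
  unfolding af_on_def
proof (intro allI impI)
  fix f :: "nat \<Rightarrow> 'a" assume f: "\<forall>i. f i \<in> A \<union> B"
  have "infinite {i. f i \<in> A} \<or> infinite {i. f i \<in> B}"
  proof -
    have "{i. f i \<in> A} \<union> {i. f i \<in> B} = UNIV" using f by auto
    then show ?thesis by (metis finite_Un infinite_UNIV_nat)
  qed
  then obtain X where X: "X = A \<or> X = B" "infinite {i. f i \<in> X}" by blast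
  define e where "e = enumerate {i. f i \<in> X}"
  have sm: "strict_mono e" unfolding e_def by (rule strict_mono_enumerate) (rule X)
  have "f (e i) \<in> X" for i using enumerate_in_set[OF X(2), of i] by (simp add: e_def)
  moreover have "af_on R X" using X A B by auto
  ultimately obtain i j where "i < j" "R (f (e i)) (f (e j))"
    using af_onD[of R X "\<lambda>i. f (e i)"] by metis
  with sm show "\<exists>i j. i < j \<and> R (f i) (f j)" by (metis strict_monoD)
qed

lemma af_on_Times:
  assumes A: "af_on R A" and B: "af_on S B"
  shows "af_on (\<lambda>(a, b) (c, d). R a c \<and> S b d) (A \<times> B)"
  unfolding af_on_def
proof (intro allI impI)
  fix f :: "nat \<Rightarrow> 'a \<times> 'b" assume f: "\<forall>i. f i \<in> A \<times> B"
  then have fA: "\<And>i. fst (f i) \<in> A" and fB: "\<And>i. snd (f i) \<in> B" by (simp_all add: mem_Times_iff)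
  from af_on_subsequence[of R A "\<lambda>i. fst (f i)", OF A fA]
  obtain \<phi> :: "nat \<Rightarrow> nat" where \<phi>: "strict_mono \<phi>" "\<And>i j. i < j \<Longrightarrow> R (fst (f (\<phi> i))) (fst (f (\<phi> j)))" by blast
  obtain i j where "i < j" "S (snd (f (\<phi> i))) (snd (f (\<phi> j)))"
    using af_onD[of S B "\<lambda>i. snd (f (\<phi> i))", OF B] fB by metis
  then have "\<phi> i < \<phi> j" "R (fst (f (\<phi> i))) (fst (f (\<phi> j))) \<and> S (snd (f (\<phi> i))) (snd (f (\<phi> j)))"
    using \<phi> by (simp_all add: strict_monoD)
  then show "\<exists>i j. i < j \<and> (\<lambda>(a, b) (c, d). R a c \<and> S b d) (f i) (f j)"
    unfolding case_prod_beta by blast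
qed

lemma af_on_finite: "finite C \<Longrightarrow> af_on (=) C"
  unfolding af_on_def
proof (intro allI impI)
  fix f :: "nat \<Rightarrow> 'a" assume C: "finite C" and f: "\<forall>i. f i \<in> C"
  have "\<not> inj f"
  proof
    assume "inj f"
    then have "infinite (range f)" by (rule range_inj_infinite)
    moreover have "range f \<subseteq> C" using f by auto
    ultimately show False using C finite_subset by blast
  qed
  then obtain i j where "i \<noteq> j" "f i = f j" unfolding inj_def by blast
  then show "\<exists>i j. i < j \<and> f i = f j" by (metis linorder_neqE_nat)
qed

text \<open>Minimal bad sequence argument of Nash-Williams: along a subsequence with pairwise
  related heads, replacing the lists by their tails would give a bad sequence that is shorter at its
  first changed position.\<close>

lemma higman:
  assumes R: "af_on R A"
  shows "af_on (list_emb R) (lists A)"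
proof (rule ccontr)
  define bad where "bad f \<longleftrightarrow> (\<forall>i. f i \<in> lists A) \<and> (\<forall>i j. i < j \<longrightarrow> \<not> list_emb R (f i) (f j))"
    for f :: "nat \<Rightarrow> 'a list"
  define mn where "mn f n \<longleftrightarrow> bad f \<and> (\<forall>g. bad g \<and> (\<forall>i < n. g i = f i) \<longrightarrow> length (f n) \<le> length (g n))"
    for f n
  assume "\<not> af_on (list_emb R) (lists A)"
  then have ex: "\<exists>f. bad f" unfolding bad_def af_on_def by blast
  have mn_ex: "\<exists>h. (\<forall>i < n. h i = f i) \<and> mn h n" if "bad f" for f n
  proof -
    let ?P = "\<lambda>h. bad h \<and> (\<forall>i < n. h i = f i)"
    have "?P f" using that by blast
    from ex_has_least_nat[of ?P f "\<lambda>h. length (h n)", OF this]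
    obtain h where h: "?P h" "\<And>g. ?P g \<Longrightarrow> length (h n) \<le> length (g n)" by blast
    then have "mn h n" unfolding mn_def by auto
    with h show ?thesis by blast
  qed
  \<comment> \<open>The entry at position \<open>n\<close> of \<open>F n\<close> is shortest among
    the bad sequences with the same first \<open>n\<close> entries. Each step keeps the positions up
    to \<open>n\<close>, so the diagonal \<open>m\<close> agrees with \<open>F n\<close> there and
    is itself bad and minimal.\<close>
  have "\<exists>F. \<forall>n. mn (F n) n \<and> (\<forall>i \<le> n. F (Suc n) i = F n i)"
  proof (rule dependent_nat_choice)
    show "\<exists>h. mn h 0" using ex mn_ex by blast
    fix h n assume "mn h n"
    then have "bad h" by (simp add: mn_def)
    from mn_ex[OF this, of "Suc n"] show "\<exists>g. mn g (Suc n) \<and> (\<forall>i \<le> n. g i = h i)"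
      by (auto simp: less_Suc_eq_le)
  qed
  then obtain F where F: "\<And>n. mn (F n) n" "\<And>n i. i \<le> n \<Longrightarrow> F (Suc n) i = F n i" by blast
  define m where "m n = F n n" for n
  have Fm: "F n i = m i" if "i \<le> n" for n i
    using that by (induction n rule: dec_induct) (auto simp: m_def F(2))
  have mbad: "bad m"
    unfolding bad_def
  proof (intro conjI allI impI)
    fix i show "m i \<in> lists A" using F(1)[of i] by (auto simp: m_def mn_def bad_def)
  next
    fix i j :: nat assume "i < j"
    moreover have "bad (F j)" using F(1)[of j] by (simp add: mn_def)
    ultimately show "\<not> list_emb R (m i) (m j)"
      using Fm[of i j] Fm[of j j] unfolding bad_def by (metis less_imp_le order_refl)
  qed
  have mmin: "length (m n) \<le> length (g n)" if "bad g" "\<And>i. i < n \<Longrightarrow> g i = m i" for g n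
  proof -
    have "\<forall>i < n. g i = F n i" using that(2) Fm by simp
    with that(1) F(1)[of n] show ?thesis unfolding mn_def m_def by blast
  qed
  have ne: "m i \<noteq> []" for i
  proof
    assume "m i = []"
    then have "list_emb R (m i) (m (Suc i))" by simp
    with mbad show False unfolding bad_def by blast
  qed
  define a where "a i = hd (m i)" for i
  define v where "v i = tl (m i)" for i
  have m: "m i = a i # v i" for i using ne by (simp add: a_def v_def)
  have mA: "m i \<in> lists A" for i using mbad by (simp add: bad_def)
  have aA: "a i \<in> A" and vA: "v i \<in> lists A" for i using mA[of i] by (auto simp: m)
  obtain \<phi> :: "nat \<Rightarrow> nat" where \<phi>: "strict_mono \<phi>" "\<And>i j. i < j \<Longrightarrow> R (a (\<phi> i)) (a (\<phi> j))"
    using af_on_subsequence[OF R, of a] aA by metis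
  define g where "g i = (if i < \<phi> 0 then m i else v (\<phi> (i - \<phi> 0)))" for i
  have "\<not> bad g"
  proof
    assume "bad g"
    then have "length (m (\<phi> 0)) \<le> length (g (\<phi> 0))" by (rule mmin) (simp add: g_def)
    then show False by (simp add: g_def m)
  qed
  moreover have "g i \<in> lists A" for i using mA vA by (simp add: g_def)
  ultimately obtain i j where ij: "i < j" "list_emb R (g i) (g j)" unfolding bad_def by blast
  have nm: "\<not> list_emb R (m i) (m j)" if "i < j" for i j using mbad that by (simp add: bad_def)
  show False
  proof (cases "j < \<phi> 0")
    case True
    with ij nm show False by (simp add: g_def)
  next
    case j: False
    show False
    proof (cases "i < \<phi> 0")
      case True
      with ij j have "list_emb R (m i) (v (\<phi> (j - \<phi> 0)))" by (simp add: g_def)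
      then have "list_emb R (m i) (m (\<phi> (j - \<phi> 0)))" unfolding m[of "\<phi> (j - \<phi> 0)"] by (rule list_emb_Cons)
      moreover have "\<phi> 0 \<le> \<phi> (j - \<phi> 0)" using \<phi>(1) by (simp add: strict_mono_less_eq)
      ultimately show False using nm True by (meson less_le_trans)
    next
      case False
      let ?i = "i - \<phi> 0" and ?j = "j - \<phi> 0"
      have l: "?i < ?j" using ij False by simp
      from False j ij have "list_emb R (v (\<phi> ?i)) (v (\<phi> ?j))" by (simp add: g_def)
      with \<phi>(2)[OF l] have "list_emb R (m (\<phi> ?i)) (m (\<phi> ?j))" by (simp add: m)
      with nm \<phi>(1) l show False by (meson strict_monoD)
    qed
  qed
qed

text \<open>Both index lists are strictly increasing, so an embedding of positions can be read as an
  increasing map of the indices themselves.\<close>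

lemma list_emb_map_strict_mono:
  fixes xs ys :: "nat list"
  assumes "list_emb P (map F xs) (map G ys)" "sorted_wrt (<) xs" "sorted_wrt (<) ys"
  obtains f where "strict_mono_on (set xs) f" "\<And>x. x \<in> set xs \<Longrightarrow> f x \<in> set ys \<and> P (F x) (G (f x))"
proof -
  have "\<exists>f. strict_mono_on (set xs) f \<and> (\<forall>x \<in> set xs. f x \<in> set ys \<and> P (F x) (G (f x)))"
    using assms
  proof (induction ys arbitrary: xs)
    case Nil
    then have "xs = []" by (cases xs) (auto elim: list_emb.cases)
    then show ?case by (auto simp: strict_mono_on_def)
  next
    case (Cons y ys)
    show ?case
    proof (cases xs)
      case Nil
      then show ?thesis by (auto simp: strict_mono_on_def)
    next
      case xs: (Cons x zs)
      from Cons.prems(1) xs have "list_emb P (map F xs) (map G ys)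
          \<or> P (F x) (G y) \<and> list_emb P (map F zs) (map G ys)"
        by (auto elim: list_emb.cases)
      then show ?thesis
      proof
        assume "list_emb P (map F xs) (map G ys)"
        with Cons.IH[of xs] Cons.prems show ?thesis by auto
      next
        assume *: "P (F x) (G y) \<and> list_emb P (map F zs) (map G ys)"
        with Cons.IH[of zs] Cons.prems xs obtain f where
          f: "strict_mono_on (set zs) f" "\<And>x. x \<in> set zs \<Longrightarrow> f x \<in> set ys \<and> P (F x) (G (f x))"
          by auto
        have xz: "\<And>z. z \<in> set zs \<Longrightarrow> x < z" using Cons.prems xs by auto
        have yz: "\<And>z. z \<in> set ys \<Longrightarrow> y < z" using Cons.prems by auto
        have "strict_mono_on (set xs) (f(x := y))"
          unfolding strict_mono_on_def
        proof (intro allI impI, elim conjE)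
          fix r s assume "r \<in> set xs" "s \<in> set xs" "r < s"
          then show "(f(x := y)) r < (f(x := y)) s"
            using xs xz yz f unfolding strict_mono_on_def by fastforce
        qed
        moreover have "\<forall>z \<in> set xs. (f(x := y)) z \<in> set (y # ys) \<and> P (F z) (G ((f(x := y)) z))"
          using * f xs xz by auto
        ultimately show ?thesis by blast
      qed
    qed
  qed
  with that show thesis by blast
qed

text \<open>The adjacency predicate is a relation on the whole type, so that induced subgraphs are obtained
  by shrinking the vertex set alone.\<close>

type_synonym 'v graph = "'v set \<times> ('v \<Rightarrow> 'v \<Rightarrow> bool)"
type_synonym ('v, 'l) lgraph = "'v set \<times> ('v \<Rightarrow> 'v \<Rightarrow> bool) \<times> ('v \<Rightarrow> 'l)"

section \<open>Labelled graphs and label-increasing embeddings\<close>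

definition emb :: "('l \<Rightarrow> 'l \<Rightarrow> bool) \<Rightarrow> ('v, 'l) lgraph \<Rightarrow> ('v, 'l) lgraph \<Rightarrow> bool" where
  "emb le = (\<lambda>(V, E, l) (V', E', l'). \<exists>g. inj_on g V \<and> g ` V \<subseteq> V' \<and>
    (\<forall>u \<in> V. \<forall>v \<in> V. E u v \<longleftrightarrow> E' (g u) (g v)) \<and> (\<forall>v \<in> V. le (l v) (l' (g v))))"

lemma embE:
  assumes "emb le (V, E, l) (V', E', l')"
  obtains g where "inj_on g V" "g ` V \<subseteq> V'" "\<forall>u \<in> V. \<forall>v \<in> V. E u v \<longleftrightarrow> E' (g u) (g v)"
    "\<forall>v \<in> V. le (l v) (l' (g v))"
  using assms unfolding emb_def case_prod_conv by (elim exE conjE)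

definition lab :: "'v graph set \<Rightarrow> 'l set \<Rightarrow> ('v, 'l) lgraph set" where
  "lab X A = {(V, E, l). (V, E) \<in> X \<and> (\<forall>v \<in> V. l v \<in> A)}"

text \<open>The label type is a parameter because the constructions change it: compositions pair
  labels with colours, and folding uses labelled graphs as labels.\<close>

definition lwqo :: "'l itself \<Rightarrow> 'v graph set \<Rightarrow> bool" where
  "lwqo _ X \<longleftrightarrow> (\<forall>(le :: 'l \<Rightarrow> 'l \<Rightarrow> bool) A. af_on le A \<longrightarrow> af_on (emb le) (lab X A))"

definition sgraph :: "'v set \<Rightarrow> ('v \<Rightarrow> 'v \<Rightarrow> bool) \<Rightarrow> bool" where
  "sgraph V E \<longleftrightarrow> finite V \<and> symp E \<and> irreflp E"

lemma sgraph_subset: "sgraph V E \<Longrightarrow> U \<subseteq> V \<Longrightarrow> sgraph U E"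
  by (auto simp: sgraph_def finite_subset)

lemma lwqo_subset: "lwqo TYPE('l) Y \<Longrightarrow> X \<subseteq> Y \<Longrightarrow> lwqo TYPE('l) X"
  unfolding lwqo_def lab_def by (fastforce elim: af_on_subset)

lemma lwqo_Un: "lwqo TYPE('l) X \<Longrightarrow> lwqo TYPE('l) Y \<Longrightarrow> lwqo TYPE('l) (X \<union> Y)"
proof -
  have "lab (X \<union> Y) A = lab X A \<union> lab Y A" for A :: "'l set" by (auto simp: lab_def)
  then show "lwqo TYPE('l) X \<Longrightarrow> lwqo TYPE('l) Y \<Longrightarrow> lwqo TYPE('l) (X \<union> Y)"
    by (simp add: lwqo_def af_on_Un)
qed

section \<open>Gluing embeddings of pieces\<close>

abbreviation col_le :: "('l \<Rightarrow> 'l \<Rightarrow> bool) \<Rightarrow> 'l \<times> 'c \<Rightarrow> 'l \<times> 'c \<Rightarrow> bool" where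
  "col_le le \<equiv> (\<lambda>(a, c) (b, d). le a b \<and> c = d)"

text \<open>The colours are part of the labels of the pieces, so the embeddings of the pieces
  preserve them, and \<open>cross\<close> then forces the adjacencies between different
  pieces.\<close>

lemma emb_glue:
  assumes inj: "inj_on f (p ` V)"
    and pieces: "\<And>k. k \<in> p ` V \<Longrightarrow> emb (col_le le)
      ({v \<in> V. p v = k}, E, \<lambda>v. (l v, col v)) ({v \<in> V'. p' v = f k}, E', \<lambda>v. (l' v, col' v))"
    and cross: "\<And>u v u' v'. u \<in> V \<Longrightarrow> v \<in> V \<Longrightarrow> u' \<in> V' \<Longrightarrow> v' \<in> V' \<Longrightarrow> p u \<noteq> p v \<Longrightarrow>
      p' u' = f (p u) \<Longrightarrow> p' v' = f (p v) \<Longrightarrow> col u = col' u' \<Longrightarrow> col v = col' v' \<Longrightarrow> E u v \<longleftrightarrow> E' u' v'"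
  shows "emb le (V, E, l) (V', E', l')"
proof -
  define Q where "Q k h \<longleftrightarrow> inj_on h {v \<in> V. p v = k} \<and> h ` {v \<in> V. p v = k} \<subseteq> {v \<in> V'. p' v = f k} \<and>
    (\<forall>u \<in> {v \<in> V. p v = k}. \<forall>v \<in> {v \<in> V. p v = k}. E u v \<longleftrightarrow> E' (h u) (h v)) \<and>
    (\<forall>v \<in> {v \<in> V. p v = k}. le (l v) (l' (h v)) \<and> col v = col' (h v))" for k h
  have "\<exists>h. Q k h" if "k \<in> p ` V" for k
    using pieces[OF that] unfolding emb_def Q_def by auto
  then obtain h where h: "\<And>k. k \<in> p ` V \<Longrightarrow> Q k (h k)" by metis
  define g where "g v = h (p v) v" for v
  have g: "g v \<in> V'" "p' (g v) = f (p v)" "le (l v) (l' (g v))" "col v = col' (g v)" if "v \<in> V" for v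
    using h[of "p v"] that by (auto simp: Q_def g_def)
  have same: "E u v \<longleftrightarrow> E' (g u) (g v)" "g u = g v \<Longrightarrow> u = v" if "u \<in> V" "v \<in> V" "p u = p v" for u v
    using h[of "p v"] that by (auto simp: Q_def g_def inj_on_def)
  have "inj_on g V"
  proof (rule inj_onI)
    fix u v assume uv: "u \<in> V" "v \<in> V" "g u = g v"
    then have "f (p u) = f (p v)" using g(2) by metis
    then have "p u = p v" using inj uv by (meson image_eqI inj_onD)
    then show "u = v" using same uv by blast
  qed
  moreover have "E u v \<longleftrightarrow> E' (g u) (g v)" if "u \<in> V" "v \<in> V" for u v
    using same[OF that] cross[OF that g(1)[OF that(1)] g(1)[OF that(2)]] g(2,4) that by (cases "p u = p v") auto
  ultimately show ?thesis unfolding emb_def using g by auto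
qed

text \<open>\<open>K\<close> is read from the earlier to the later piece and need not be symmetric;
  the asymmetry is what encodes nested neighbourhoods in \<open>lwqo_Bip\<close>.\<close>

definition layered :: "('c \<Rightarrow> 'c \<Rightarrow> bool) \<Rightarrow> 'c set \<Rightarrow> 'v graph set \<Rightarrow> 'v graph set" where
  "layered K C Y = {(V, E). sgraph V E \<and> (\<exists>(p :: 'v \<Rightarrow> nat) col. (\<forall>v \<in> V. col v \<in> C) \<and>
    (\<forall>k \<in> p ` V. ({v \<in> V. p v = k}, E) \<in> Y) \<and>
    (\<forall>u \<in> V. \<forall>v \<in> V. p u < p v \<longrightarrow> (E u v \<longleftrightarrow> K (col u) (col v))))}"

lemma layeredI:
  assumes "sgraph V E" "\<And>v. v \<in> V \<Longrightarrow> col v \<in> C"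
    "\<And>w. w \<in> V \<Longrightarrow> ({v \<in> V. p v = (p w :: nat)}, E) \<in> Y"
    "\<And>u v. u \<in> V \<Longrightarrow> v \<in> V \<Longrightarrow> p u < p v \<Longrightarrow> E u v \<longleftrightarrow> K (col u) (col v)"
  shows "(V, E) \<in> layered K C Y"
  unfolding layered_def using assms by blast

lemma layeredE:
  assumes "(V, E) \<in> layered K C Y"
  obtains p :: "'v \<Rightarrow> nat" and col where "sgraph V E" "\<forall>v \<in> V. col v \<in> C"
    "\<forall>k \<in> p ` V. ({v \<in> V. p v = k}, E) \<in> Y"
    "\<forall>u \<in> V. \<forall>v \<in> V. p u < p v \<longrightarrow> (E u v \<longleftrightarrow> K (col u) (col v))"
  using assms unfolding layered_def mem_Collect_eq case_prod_conv by (elim conjE exE)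

text \<open>A graph is coded by the list of its coloured pieces in increasing order. An embedding of
  lists induces an increasing map of piece numbers, so \<open>K\<close> is read in the same
  direction in both graphs.\<close>

lemma lwqo_layered:
  assumes C: "finite C" and Y: "lwqo TYPE('l \<times> 'c) (Y :: 'v graph set)"
  shows "lwqo TYPE('l) (layered (K :: 'c \<Rightarrow> 'c \<Rightarrow> bool) C Y)"
  unfolding lwqo_def
proof (intro allI impI)
  fix le :: "'l \<Rightarrow> 'l \<Rightarrow> bool" and A assume le: "af_on le A"
  let ?pc = "\<lambda>(V :: 'v set) E l p col (k :: nat). ({v \<in> V. p v = k}, E, \<lambda>v. (l v :: 'l, col v :: 'c))"
  have "af_on (col_le le) (A \<times> C)" by (rule af_on_Times[OF le af_on_finite[OF C]])
  then have af: "af_on (list_emb (emb (col_le le))) (lists (lab Y (A \<times> C)))"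
    using Y by (intro higman) (simp add: lwqo_def)
  show "af_on (emb le) (lab (layered K C Y) A)"
  proof (rule af_on_transfer[OF af, where rep = "\<lambda>(V, E, l) ps. \<exists>p col.
      (\<forall>u \<in> V. \<forall>v \<in> V. p u < p v \<longrightarrow> (E u v \<longleftrightarrow> K (col u) (col v))) \<and>
      ps = map (?pc V E l p col) (sorted_list_of_set (p ` V))"], goal_cases)
    case (1 x)
    obtain V E l where x: "x = (V, E, l)" by (cases x)
    with 1 have VE: "(V, E) \<in> layered K C Y" and l: "\<And>v. v \<in> V \<Longrightarrow> l v \<in> A" by (auto simp: lab_def)
    from VE obtain p :: "'v \<Rightarrow> nat" and col where fin: "sgraph V E" and p: "\<forall>v \<in> V. col v \<in> C"
      "\<forall>k \<in> p ` V. ({v \<in> V. p v = k}, E) \<in> Y"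
      "\<forall>u \<in> V. \<forall>v \<in> V. p u < p v \<longrightarrow> (E u v \<longleftrightarrow> K (col u) (col v))"
      by (rule layeredE)
    have "?pc V E l p col k \<in> lab Y (A \<times> C)" if "k \<in> p ` V" for k
      using p(1) bspec[OF p(2) that] l by (simp add: lab_def)
    then have "set (map (?pc V E l p col) (sorted_list_of_set (p ` V))) \<subseteq> lab Y (A \<times> C)"
      using fin by (auto simp: sgraph_def)
    with p(3) x show ?case by blast
  next
    case (2 x x' y y')
    obtain V E l V' E' l' where x: "x = (V, E, l)" "x' = (V', E', l')" by (cases x, cases x')
    from 2(1,2) x have fin: "finite V" "finite V'" and sym: "symp E" "symp E'"
      by (auto simp: lab_def layered_def sgraph_def)
    from 2(3) x obtain p col where p: "\<forall>u \<in> V. \<forall>v \<in> V. p u < p v \<longrightarrow> (E u v \<longleftrightarrow> K (col u) (col v))"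
      and y: "y = map (?pc V E l p col) (sorted_list_of_set (p ` V))" by auto
    from 2(4) x obtain p' col' where p': "\<forall>u \<in> V'. \<forall>v \<in> V'. p' u < p' v \<longrightarrow> (E' u v \<longleftrightarrow> K (col' u) (col' v))"
      and y': "y' = map (?pc V' E' l' p' col') (sorted_list_of_set (p' ` V'))" by auto
    obtain f where f: "strict_mono_on (set (sorted_list_of_set (p ` V))) f"
      "\<And>k. k \<in> set (sorted_list_of_set (p ` V)) \<Longrightarrow> f k \<in> set (sorted_list_of_set (p' ` V')) \<and>
         emb (col_le le) (?pc V E l p col k) (?pc V' E' l' p' col' (f k))"
      by (rule list_emb_map_strict_mono[OF 2(5)[unfolded y y']]) auto
    have f1: "strict_mono_on (p ` V) f" using f(1) fin by simp
    have lt: "f (p u) < f (p v)" if "u \<in> V" "v \<in> V" "p u < p v" for u v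
      using f1 that unfolding strict_mono_on_def by blast
    have "emb le (V, E, l) (V', E', l')"
    proof (rule emb_glue[of f p V])
      show "inj_on f (p ` V)" using f1 by (rule strict_mono_on_imp_inj_on)
    next
      fix k assume "k \<in> p ` V"
      then show "emb (col_le le) (?pc V E l p col k) (?pc V' E' l' p' col' (f k))" using f(2) fin by simp
    next
      fix u v u' v'
      assume a: "u \<in> V" "v \<in> V" "u' \<in> V'" "v' \<in> V'" "p u \<noteq> p v"
        "p' u' = f (p u)" "p' v' = f (p v)" "col u = col' u'" "col v = col' v'"
      have "E u v = E v u" "E' u' v' = E' v' u'" using sym by (auto dest: sympD)
      with a lt[of u v] lt[of v u] p p' show "E u v \<longleftrightarrow> E' u' v'" by (metis linorder_neqE_nat)
    qed
    with x show ?case by simp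
  qed
qed

text \<open>The vertices in the range of \<open>\<rho>\<close> are representatives; the label of a representative is the
  whole labelled graph induced by its fibre.\<close>

definition folded :: "('c \<Rightarrow> 'c \<Rightarrow> bool \<Rightarrow> bool) \<Rightarrow> 'c set \<Rightarrow> 'v graph set \<Rightarrow> 'v graph set \<Rightarrow> 'v graph set" where
  "folded K C Y Z = {(V, E). sgraph V E \<and> (\<exists>\<rho> col. (\<forall>v \<in> V. col v \<in> C) \<and> (\<rho> ` V, E) \<in> Y \<and>
    (\<forall>r \<in> \<rho> ` V. ({v \<in> V. \<rho> v = r}, E) \<in> Z) \<and>
    (\<forall>u \<in> V. \<forall>v \<in> V. \<rho> u \<noteq> \<rho> v \<longrightarrow> (E u v \<longleftrightarrow> K (col u) (col v) (E (\<rho> u) (\<rho> v)))))}"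

lemma foldedE:
  assumes "(V, E) \<in> folded K C Y Z"
  obtains \<rho> col where "sgraph V E" "\<forall>v \<in> V. col v \<in> C" "(\<rho> ` V, E) \<in> Y"
    "\<forall>r \<in> \<rho> ` V. ({v \<in> V. \<rho> v = r}, E) \<in> Z"
    "\<forall>u \<in> V. \<forall>v \<in> V. \<rho> u \<noteq> \<rho> v \<longrightarrow> (E u v \<longleftrightarrow> K (col u) (col v) (E (\<rho> u) (\<rho> v)))"
  using assms unfolding folded_def mem_Collect_eq case_prod_conv by (elim conjE exE)

text \<open>An embedding of the graphs of representatives supplies an injection of the fibres and,
  through the labels, an embedding of each fibre.\<close>

lemma lwqo_folded:
  assumes C: "finite C" and Z: "lwqo TYPE('l \<times> 'c) (Z :: 'v graph set)"
    and Y: "lwqo TYPE(('v, 'l \<times> 'c) lgraph) (Y :: 'v graph set)"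
  shows "lwqo TYPE('l) (folded (K :: 'c \<Rightarrow> 'c \<Rightarrow> bool \<Rightarrow> bool) C Y Z)"
  unfolding lwqo_def
proof (intro allI impI)
  fix le :: "'l \<Rightarrow> 'l \<Rightarrow> bool" and A assume le: "af_on le A"
  let ?fb = "\<lambda>(V :: 'v set) E l \<rho> col (r :: 'v). ({v \<in> V. \<rho> v = r}, E, \<lambda>v. (l v :: 'l, col v :: 'c))"
  have "af_on (col_le le) (A \<times> C)" by (rule af_on_Times[OF le af_on_finite[OF C]])
  then have "af_on (emb (col_le le)) (lab Z (A \<times> C))" using Z by (simp add: lwqo_def)
  then have af: "af_on (emb (emb (col_le le))) (lab Y (lab Z (A \<times> C)))"
    using Y by (simp add: lwqo_def)
  show "af_on (emb le) (lab (folded K C Y Z) A)"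
  proof (rule af_on_transfer[OF af, where rep = "\<lambda>(V, E, l) y. \<exists>\<rho> col.
      (\<forall>u \<in> V. \<forall>v \<in> V. \<rho> u \<noteq> \<rho> v \<longrightarrow> (E u v \<longleftrightarrow> K (col u) (col v) (E (\<rho> u) (\<rho> v)))) \<and>
      y = (\<rho> ` V, E, ?fb V E l \<rho> col)"], goal_cases)
    case (1 x)
    obtain V E l where x: "x = (V, E, l)" by (cases x)
    with 1 have VE: "(V, E) \<in> folded K C Y Z" and l: "\<And>v. v \<in> V \<Longrightarrow> l v \<in> A" by (auto simp: lab_def)
    from VE obtain \<rho> col where \<rho>: "sgraph V E" "\<forall>v \<in> V. col v \<in> C" "(\<rho> ` V, E) \<in> Y"
      "\<forall>r \<in> \<rho> ` V. ({v \<in> V. \<rho> v = r}, E) \<in> Z"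
      "\<forall>u \<in> V. \<forall>v \<in> V. \<rho> u \<noteq> \<rho> v \<longrightarrow> (E u v \<longleftrightarrow> K (col u) (col v) (E (\<rho> u) (\<rho> v)))"
      by (rule foldedE)
    have "?fb V E l \<rho> col r \<in> lab Z (A \<times> C)" if "r \<in> \<rho> ` V" for r
      using \<rho>(2) bspec[OF \<rho>(4) that] l by (simp add: lab_def)
    then have "(\<rho> ` V, E, ?fb V E l \<rho> col) \<in> lab Y (lab Z (A \<times> C))"
      using \<rho>(3) by (simp add: lab_def[of Y])
    with \<rho>(5) x show ?case by blast
  next
    case (2 x x' y y')
    obtain V E l V' E' l' where x: "x = (V, E, l)" "x' = (V', E', l')" by (cases x, cases x')
    from 2(3) x obtain \<rho> col where
      \<rho>: "\<forall>u \<in> V. \<forall>v \<in> V. \<rho> u \<noteq> \<rho> v \<longrightarrow> (E u v \<longleftrightarrow> K (col u) (col v) (E (\<rho> u) (\<rho> v)))"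
      and y: "y = (\<rho> ` V, E, ?fb V E l \<rho> col)" by auto
    from 2(4) x obtain \<rho>' col' where
      \<rho>': "\<forall>u \<in> V'. \<forall>v \<in> V'. \<rho>' u \<noteq> \<rho>' v \<longrightarrow> (E' u v \<longleftrightarrow> K (col' u) (col' v) (E' (\<rho>' u) (\<rho>' v)))"
      and y': "y' = (\<rho>' ` V', E', ?fb V' E' l' \<rho>' col')" by auto
    from 2(5)[unfolded y y'] obtain f where f: "inj_on f (\<rho> ` V)"
      "\<forall>r \<in> \<rho> ` V. \<forall>s \<in> \<rho> ` V. E r s \<longleftrightarrow> E' (f r) (f s)"
      "\<forall>r \<in> \<rho> ` V. emb (col_le le) (?fb V E l \<rho> col r) (?fb V' E' l' \<rho>' col' (f r))"
      by (rule embE)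
    have "emb le (V, E, l) (V', E', l')"
    proof (rule emb_glue[OF f(1) bspec[OF f(3)]])
      fix u v u' v'
      assume a: "u \<in> V" "v \<in> V" "u' \<in> V'" "v' \<in> V'" "\<rho> u \<noteq> \<rho> v"
        "\<rho>' u' = f (\<rho> u)" "\<rho>' v' = f (\<rho> v)" "col u = col' u'" "col v = col' v'"
      have ne: "\<rho>' u' \<noteq> \<rho>' v'" using a f(1) by (auto dest: inj_onD)
      have "E (\<rho> u) (\<rho> v) = E' (\<rho>' u') (\<rho>' v')" using a f(2) by simp
      moreover have "E u v = K (col u) (col v) (E (\<rho> u) (\<rho> v))" using a \<rho> by blast
      moreover have "E' u' v' = K (col' u') (col' v') (E' (\<rho>' u') (\<rho>' v'))" using a ne \<rho>' by blast
      ultimately show "E u v \<longleftrightarrow> E' u' v'" using a by simp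
    qed auto
    with x show ?case by simp
  qed
qed

section \<open>Bipartite graphs without an induced $P_2 + P_3$\<close>

definition edgeless :: "('v \<Rightarrow> 'v \<Rightarrow> bool) \<Rightarrow> 'v set \<Rightarrow> bool" where
  "edgeless E A \<longleftrightarrow> (\<forall>u \<in> A. \<forall>v \<in> A. \<not> E u v)"

lemma edgelessD: "edgeless E A \<Longrightarrow> u \<in> A \<Longrightarrow> v \<in> A \<Longrightarrow> \<not> E u v"
  by (simp add: edgeless_def)

lemma edgeless_subset: "edgeless E A \<Longrightarrow> B \<subseteq> A \<Longrightarrow> edgeless E B"
  by (auto simp: edgeless_def)

text \<open>Only \<open>c \<noteq> e\<close> is demanded: in a simple graph any other coincidence
  among the five vertices gives a loop or one of the listed adjacencies.\<close>

definition p23free :: "'v set \<Rightarrow> ('v \<Rightarrow> 'v \<Rightarrow> bool) \<Rightarrow> bool" where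
  "p23free V E \<longleftrightarrow> (\<forall>a \<in> V. \<forall>b \<in> V. \<forall>c \<in> V. \<forall>d \<in> V. \<forall>e \<in> V.
    E a b \<longrightarrow> E c d \<longrightarrow> E d e \<longrightarrow> c \<noteq> e \<longrightarrow> E c e \<or> E a c \<or> E a d \<or> E a e \<or> E b c \<or> E b d \<or> E b e)"

lemma p23freeD:
  assumes "p23free V E" "{a, b, c, d, e} \<subseteq> V" "E a b" "E c d" "E d e" "c \<noteq> e" "\<not> E c e"
    "\<not> E a c" "\<not> E a d" "\<not> E a e" "\<not> E b c" "\<not> E b d" "\<not> E b e"
  shows False
  using assms unfolding p23free_def by blast

lemma p23free_subset: "p23free V E \<Longrightarrow> U \<subseteq> V \<Longrightarrow> p23free U E"
  unfolding p23free_def by blast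

definition Single :: "'v graph set" where
  "Single = {(V, E). irreflp E \<and> (\<exists>v. V = {v})}"

definition Edgeless :: "'v graph set" where
  "Edgeless = {(V, E). sgraph V E \<and> edgeless E V}"

definition P3_free :: "'v graph set" where
  "P3_free = {(V, E). sgraph V E \<and> (\<forall>u \<in> V. \<forall>v \<in> V. \<forall>w \<in> V. E u v \<longrightarrow> E v w \<longrightarrow> u \<noteq> w \<longrightarrow> E u w)}"

definition del :: "nat \<Rightarrow> 'v graph set \<Rightarrow> 'v graph set" where
  "del k Y = {(V, E). sgraph V E \<and> (\<exists>S. S \<subseteq> V \<and> card S \<le> k \<and> (V - S, E) \<in> Y)}"

definition Bip :: "'v graph set" where
  "Bip = {(V, E). sgraph V E \<and> p23free V E \<and> (\<exists>A. A \<subseteq> V \<and> edgeless E A \<and> edgeless E (V - A))}"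

section \<open>Basic well-quasi-ordered classes\<close>

lemma lwqo_Single: "lwqo TYPE('l) (Single :: 'v graph set)"
  unfolding lwqo_def
proof (intro allI impI)
  fix le :: "'l \<Rightarrow> 'l \<Rightarrow> bool" and A assume le: "af_on le A"
  show "af_on (emb le) (lab (Single :: 'v graph set) A)"
  proof (rule af_on_transfer[OF le, where rep = "\<lambda>(V, E, l) a. irreflp E \<and> (\<exists>v. V = {v} \<and> a = l v)"], goal_cases)
    case (1 x)
    then show ?case by (auto simp: lab_def Single_def)
  next
    case (2 x x' y y')
    obtain V E l V' E' l' where x: "x = (V, E, l)" "x' = (V', E', l')" by (cases x, cases x')
    with 2 obtain v v' where "V = {v}" "V' = {v'}" "le (l v) (l' v')" "irreflp E" "irreflp E'" by auto
    then show ?case unfolding x emb_def by (auto intro!: exI[of _ "\<lambda>_. v'"] dest: irreflpD)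
  qed
qed

lemma ex_enum:
  assumes "finite V"
  obtains e :: "'v \<Rightarrow> nat" where "inj_on e V" "e ` V \<subseteq> {..<card V}"
proof -
  obtain e n where e: "e ` V = {i. i < (n :: nat)}" "inj_on e V"
    using finite_imp_inj_to_nat_seg[OF assms] by blast
  then have "card V = n" using card_image[OF e(2)] by simp
  with e show thesis by (intro that[of e]) auto
qed

text \<open>The deleted vertices become singleton pieces in front of the rest, and the colour of a vertex
  records its position and its neighbours among the deleted ones.\<close>

lemma lwqo_del:
  assumes Y: "lwqo TYPE('l \<times> nat \<times> nat set) (Y :: 'v graph set)"
  shows "lwqo TYPE('l) (del k Y)"
proof (rule lwqo_subset)
  define K :: "nat \<times> nat set \<Rightarrow> nat \<times> nat set \<Rightarrow> bool" where "K = (\<lambda>(i, A) (j, B). i \<in> B)"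
  let ?C = "{..k} \<times> Pow {..<k}"
  show "lwqo TYPE('l) (layered K ?C (Single \<union> Y))"
    by (rule lwqo_layered) (use lwqo_Un[OF lwqo_Single Y] in auto)
  show "del k Y \<subseteq> layered K ?C (Single \<union> Y)"
  proof (rule subrelI)
    fix V and E :: "'v \<Rightarrow> 'v \<Rightarrow> bool" assume "(V, E) \<in> del k Y"
    then obtain S where g: "sgraph V E" and S: "S \<subseteq> V" "card S \<le> k" "(V - S, E) \<in> Y"
      unfolding del_def mem_Collect_eq case_prod_conv by blast
    have "finite S" using g S by (auto simp: sgraph_def finite_subset)
    then obtain e :: "'v \<Rightarrow> nat" where e: "inj_on e S" "e ` S \<subseteq> {..<card S}" by (rule ex_enum)
    then have ek: "\<And>v. v \<in> S \<Longrightarrow> e v < k" using S by fastforce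
    define p where "p v = (if v \<in> S then e v else k)" for v
    show "(V, E) \<in> layered K ?C (Single \<union> Y)"
    proof (rule layeredI[where p = p and col = "\<lambda>v. (p v, {e s | s. s \<in> S \<and> E s v})", OF g])
      fix v assume "v \<in> V"
      show "(p v, {e s | s. s \<in> S \<and> E s v}) \<in> ?C" using ek by (auto simp: p_def less_imp_le)
    next
      fix w assume w: "w \<in> V"
      show "({v \<in> V. p v = p w}, E) \<in> Single \<union> Y"
      proof (cases "w \<in> S")
        case True
        then have "{v \<in> V. p v = p w} = {w}" using w ek[of w] e(1) by (auto simp: p_def inj_on_def)
        then show ?thesis using g by (auto simp: Single_def sgraph_def)
      next
        case False
        then have "{v \<in> V. p v = p w} = V - S" using ek by (auto simp: p_def)
        then show ?thesis using S by simp
      qed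
    next
      fix u v assume uv: "u \<in> V" "v \<in> V" "p u < p v"
      then have u: "u \<in> S" using ek[of v] by (auto simp: p_def split: if_splits)
      then have "e u \<in> {e s | s. s \<in> S \<and> E s v} \<longleftrightarrow> E u v" using e(1) by (auto simp: inj_on_def)
      with u show "E u v \<longleftrightarrow> K (p u, {e s | s. s \<in> S \<and> E s u}) (p v, {e s | s. s \<in> S \<and> E s v})"
        by (simp add: K_def p_def)
    qed
  qed
qed

text \<open>With singleton pieces a composition is just a list of labels, so this is Higman's lemma
  itself.\<close>

lemma lwqo_homogeneous:
  "lwqo TYPE('l) {(V :: 'v set, E). sgraph V E \<and> (\<forall>u \<in> V. \<forall>v \<in> V. u \<noteq> v \<longrightarrow> E u v = b)}"
    (is "lwqo _ ?X")
proof (rule lwqo_subset)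
  show "lwqo TYPE('l) (layered (\<lambda>_ _. b) {()} (Single :: 'v graph set))"
    by (rule lwqo_layered) (simp_all add: lwqo_Single)
  show "?X \<subseteq> layered (\<lambda>_ _. b) {()} (Single :: 'v graph set)"
  proof (rule subrelI)
    fix V and E :: "'v \<Rightarrow> 'v \<Rightarrow> bool" assume "(V, E) \<in> ?X"
    then have g: "sgraph V E" and i: "\<And>u v. u \<in> V \<Longrightarrow> v \<in> V \<Longrightarrow> u \<noteq> v \<Longrightarrow> E u v = b" by auto
    obtain e :: "'v \<Rightarrow> nat" where e: "inj_on e V" using ex_enum g unfolding sgraph_def by metis
    show "(V, E) \<in> layered (\<lambda>_ _. b) {()} Single"
    proof (rule layeredI[where p = e, OF g])
      fix w assume "w \<in> V"
      then have "{v \<in> V. e v = e w} = {w}" using e by (auto simp: inj_on_def)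
      then show "({v \<in> V. e v = e w}, E) \<in> Single" using g by (auto simp: Single_def sgraph_def)
    qed (use i in auto)
  qed
qed

lemma lwqo_Edgeless: "lwqo TYPE('l) (Edgeless :: 'v graph set)"
  by (rule lwqo_subset[OF lwqo_homogeneous[where b = False]]) (auto simp: Edgeless_def edgeless_def)

definition Clique :: "'v graph set" where
  "Clique = {(V, E). sgraph V E \<and> (\<forall>u \<in> V. \<forall>v \<in> V. u \<noteq> v \<longrightarrow> E u v)}"

lemma lwqo_Clique: "lwqo TYPE('l) (Clique :: 'v graph set)"
  by (rule lwqo_subset[OF lwqo_homogeneous[where b = True]]) (auto simp: Clique_def)

text \<open>The components are cliques and serve as pieces without adjacencies between them; a
  component is numbered by its least \<open>e\<close>-value.\<close>

lemma lwqo_P3_free: "lwqo TYPE('l) (P3_free :: 'v graph set)"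
proof (rule lwqo_subset)
  show "lwqo TYPE('l) (layered (\<lambda>_ _. False) {()} (Clique :: 'v graph set))"
    by (rule lwqo_layered) (simp_all add: lwqo_Clique)
  show "P3_free \<subseteq> layered (\<lambda>_ _. False) {()} (Clique :: 'v graph set)"
  proof (rule subrelI)
    fix V and E :: "'v \<Rightarrow> 'v \<Rightarrow> bool" assume "(V, E) \<in> P3_free"
    then have g: "sgraph V E"
      and i: "\<And>u v w. u \<in> V \<Longrightarrow> v \<in> V \<Longrightarrow> w \<in> V \<Longrightarrow> E u v \<Longrightarrow> E v w \<Longrightarrow> u \<noteq> w \<Longrightarrow> E u w"
      unfolding P3_free_def mem_Collect_eq case_prod_conv by blast+
    have sym: "\<And>u v. E u v \<Longrightarrow> E v u" using g by (auto simp: sgraph_def dest: sympD)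
    have fin: "finite V" using g by (simp add: sgraph_def)
    obtain e :: "'v \<Rightarrow> nat" where e: "inj_on e V" using ex_enum[OF fin] by metis
    define c where "c v = {u \<in> V. u = v \<or> E u v}" for v
    define p where "p v = Min (e ` c v)" for v
    have eq: "c u = c v" if "u \<in> V" "v \<in> V" "E u v" for u v
      unfolding c_def using that i sym by blast
    have pc: "\<exists>x \<in> c v. p v = e x" if "v \<in> V" for v
    proof -
      have "p v \<in> e ` c v" unfolding p_def by (rule Min_in) (use fin that in \<open>auto simp: c_def\<close>)
      then show ?thesis by blast
    qed
    show "(V, E) \<in> layered (\<lambda>_ _. False) {()} Clique"
    proof (rule layeredI[where p = p, OF g])
      fix w assume w: "w \<in> V"
      have "E u v" if uv: "u \<in> V" "v \<in> V" "p u = p v" "u \<noteq> v" for u v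
      proof -
        obtain x y where "x \<in> c u" "y \<in> c v" "e x = e y"
          using pc[OF uv(1)] pc[OF uv(2)] uv(3) by metis
        then have "x = y" using e by (auto simp: c_def inj_on_def)
        with \<open>x \<in> c u\<close> \<open>y \<in> c v\<close> uv show ?thesis unfolding c_def using i sym by blast
      qed
      then show "({v \<in> V. p v = p w}, E) \<in> Clique"
        using sgraph_subset[OF g, of "{v \<in> V. p v = p w}"] by (auto simp: Clique_def)
    next
      fix u v assume uv: "u \<in> V" "v \<in> V" "p u < p v"
      then show "E u v \<longleftrightarrow> False" using eq[of u v] by (auto simp: p_def)
    qed simp
  qed
qed

text \<open>\<open>W\<close> is the kernel of a sunflower with one-element petals or, dually, the union of all sets.\<close>

lemma near_constant:
  assumes F: "\<And>X. X \<in> F \<Longrightarrow> finite X" "\<And>X. X \<in> F \<Longrightarrow> card X = r"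
    and d: "\<And>X Y. X \<in> F \<Longrightarrow> Y \<in> F \<Longrightarrow> card (X - Y) \<le> 1"
  obtains W where "finite W" "\<forall>X \<in> F. card ((X - W) \<union> (W - X)) \<le> 1"
proof (cases "\<exists>X \<in> F. \<exists>Y \<in> F. X \<noteq> Y")
  case False
  show thesis
  proof (cases "F = {}")
    case True
    then show thesis by (intro that[of "{}"]) auto
  next
    case ne: False
    then obtain X where "X \<in> F" by blast
    with False F show thesis by (intro that[of X]) auto
  qed
next
  case True
  have single: "X - Y = {x}" if "X \<in> F" "Y \<in> F" "x \<in> X" "x \<notin> Y" for X Y x
  proof -
    have "finite (X - Y)" "card (X - Y) \<le> Suc 0" using that F d[of X Y] by auto
    then have "\<forall>a \<in> X - Y. \<forall>b \<in> X - Y. a = b" by (simp only: card_le_Suc0_iff_eq)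
    then show ?thesis using that by blast
  qed
  from True obtain X Y where XY: "X \<in> F" "Y \<in> F" "X \<noteq> Y" by blast
  have fin: "finite X" "finite Y" and c: "card X = r" "card Y = r" using XY F by auto
  have "\<not> X \<subseteq> Y" "\<not> Y \<subseteq> X" using XY(3) fin c by (metis card_subset_eq)+
  then obtain x y where x: "x \<in> X" "x \<notin> Y" and y: "y \<in> Y" "y \<notin> X" by blast
  have Xx: "X - Y = {x}" and Yy: "Y - X = {y}" using single XY x y by auto
  have I: "X \<inter> Y = X - {x}" and U: "X \<union> Y = insert y X" using Xx Yy by auto
  have cI: "Suc (card (X \<inter> Y)) = r" unfolding I using card_Suc_Diff1[OF fin(1) x(1)] c by simp
  have cU: "card (X \<union> Y) = Suc r" unfolding U using fin y c by simp
  show thesis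
  proof (cases "\<forall>Z \<in> F. X \<inter> Y \<subseteq> Z")
    case True
    show thesis
    proof (rule that[of "X \<inter> Y"], goal_cases)
      case 2
      show ?case
      proof
      fix Z assume "Z \<in> F"
      with True F cI fin have "card (Z - X \<inter> Y) = 1" by (subst card_Diff_subset) auto
      moreover have "X \<inter> Y - Z = {}" using True \<open>Z \<in> F\<close> by blast
      ultimately show "card ((Z - X \<inter> Y) \<union> (X \<inter> Y - Z)) \<le> 1"
        by (simp only: Un_empty_right order_refl)
      qed
    qed (use fin in auto)
  next
    case False
    then obtain Z s where Z: "Z \<in> F" "s \<in> X" "s \<in> Y" "s \<notin> Z" by blast
    have "X - Z = {s}" "Y - Z = {s}" using single XY Z by auto
    then have sub: "X \<union> Y - {s} \<subseteq> Z" by blast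
    have "card (X \<union> Y - {s}) = r" using cU Z fin by simp
    then have Zeq: "Z = X \<union> Y - {s}" using sub F Z by (metis card_subset_eq)
    \<comment> \<open>An element outside \<open>X \<union> Y\<close> would be the only element of
      \<open>T\<close> outside each of \<open>X\<close>, \<open>Y\<close> and \<open>Z\<close>. The
      other \<open>r - 1\<close> elements of \<open>T\<close> would lie in
      \<open>X \<inter> Y - {s}\<close>, which has only \<open>r - 2\<close>.\<close>
    have sub: "T \<subseteq> X \<union> Y" if T: "T \<in> F" for T
    proof (rule ccontr)
      assume "\<not> T \<subseteq> X \<union> Y"
      then obtain t where t: "t \<in> T" "t \<notin> X" "t \<notin> Y" by blast
      then have "t \<notin> Z" using Zeq by blast
      then have "T - X = {t}" "T - Y = {t}" "T - Z = {t}" using single XY Z T t by auto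
      then have "T - {t} \<subseteq> X \<inter> Y - {s}" using Z by blast
      then have "card (T - {t}) \<le> card (X \<inter> Y - {s})" using fin by (intro card_mono) auto
      moreover have "Suc (card (T - {t})) = r" using T F t by (metis card_Suc_Diff1)
      moreover have "Suc (card (X \<inter> Y - {s})) = card (X \<inter> Y)" using fin Z by (intro card_Suc_Diff1) auto
      ultimately show False using cI by simp
    qed
    show thesis
    proof (rule that[of "X \<union> Y"], goal_cases)
      case 2
      show ?case
      proof
      fix T assume T: "T \<in> F"
      then have "card (X \<union> Y - T) = 1" using sub[OF T] F cU by (subst card_Diff_subset) auto
      moreover have "T - (X \<union> Y) = {}" using sub[OF T] by blast
      ultimately show "card ((T - (X \<union> Y)) \<union> (X \<union> Y - T)) \<le> 1"
        by (simp only: Un_empty_left order_refl)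
      qed
    qed (use fin in auto)
  qed
qed

section \<open>Bipartite graphs with nearly equal neighbourhoods\<close>

definition Star :: "'v graph set" where
  "Star = {(V, E). sgraph V E \<and> (\<exists>A W. A \<subseteq> V \<and> edgeless E A \<and> edgeless E (V - A) \<and>
    (\<forall>b \<in> V - A. card {a \<in> A. E a b \<noteq> (a \<in> W)} \<le> 1))}"

text \<open>A vertex of \<open>A\<close> shares its piece with the vertices outside \<open>A\<close>
  whose exception it is; deleting it leaves an edgeless piece. Between pieces only membership in
  \<open>W\<close> matters: colours 0 and 1 split \<open>A\<close> along \<open>W\<close>, and
  colour 2 is the other side.\<close>

lemma lwqo_Star: "lwqo TYPE('l) (Star :: 'v graph set)"
proof (rule lwqo_subset)
  define K :: "nat \<Rightarrow> nat \<Rightarrow> bool" where "K c d \<longleftrightarrow> {c, d} = {0, 2}" for c d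
  show "lwqo TYPE('l) (layered K {..<3} (del 1 Edgeless :: 'v graph set))"
    by (rule lwqo_layered) (simp_all add: lwqo_Edgeless lwqo_del)
  show "Star \<subseteq> layered K {..<3} (del 1 Edgeless :: 'v graph set)"
  proof (rule subrelI)
    fix V and E :: "'v \<Rightarrow> 'v \<Rightarrow> bool" assume "(V, E) \<in> Star"
    then obtain A W where g: "sgraph V E" and A: "A \<subseteq> V" "edgeless E A" "edgeless E (V - A)"
      and W: "\<And>b. b \<in> V - A \<Longrightarrow> card {a \<in> A. E a b \<noteq> (a \<in> W)} \<le> 1" unfolding Star_def mem_Collect_eq case_prod_conv by blast
    have sym: "\<And>u v. E u v \<Longrightarrow> E v u" using g by (auto simp: sgraph_def dest: sympD)
    have fin: "finite V" "finite A" using g A by (auto simp: sgraph_def finite_subset)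
    obtain e :: "'v \<Rightarrow> nat" where e: "inj_on e V" using ex_enum[OF fin(1)] by metis
    define p where "p v = (if v \<in> A then e v else if \<exists>a \<in> A. E a v \<noteq> (a \<in> W)
      then e (SOME a. a \<in> A \<and> E a v \<noteq> (a \<in> W)) else e v)" for v
    have pA: "p a = e a" if "a \<in> A" for a using that by (simp add: p_def)
    have exc: "p b = e a" if "b \<in> V - A" "a \<in> A" "E a b \<noteq> (a \<in> W)" for a b
    proof -
      define X where "X = {a \<in> A. E a b \<noteq> (a \<in> W)}"
      define a' where "a' = (SOME a. a \<in> A \<and> E a b \<noteq> (a \<in> W))"
      have a: "a \<in> X" using that by (simp add: X_def)
      then have "a' \<in> X"
        using someI[of "\<lambda>a. a \<in> A \<and> E a b \<noteq> (a \<in> W)" a] by (simp add: X_def a'_def)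
      moreover have "finite X" by (rule finite_subset[OF _ fin(2)]) (auto simp: X_def)
      moreover have "card X \<le> Suc 0" using W[OF that(1)] unfolding X_def One_nat_def .
      ultimately have *: "a' \<in> X" "finite X" "card X \<le> Suc 0" by blast+
      then have "\<forall>x \<in> X. \<forall>y \<in> X. x = y" by (simp only: card_le_Suc0_iff_eq)
      with * a have "a' = a" by blast
      moreover have "p b = e a'" using that unfolding p_def a'_def by auto
      ultimately show ?thesis by simp
    qed
    show "(V, E) \<in> layered K {..<3} (del 1 Edgeless)"
    proof (rule layeredI[where p = p and col = "\<lambda>v. if v \<in> A then if v \<in> W then 0 else 1 else 2", OF g])
      fix w assume "w \<in> V"
      let ?P = "{v \<in> V. p v = p w}"
      have "x = y" if "x \<in> ?P \<inter> A" "y \<in> ?P \<inter> A" for x y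
      proof -
        from that pA[of x] pA[of y] have "e x = e y" by auto
        with that e show ?thesis by (auto dest: inj_onD)
      qed
      then have "card (?P \<inter> A) \<le> 1"
        unfolding One_nat_def by (subst card_le_Suc0_iff_eq) (use fin in auto)
      moreover have "edgeless E (?P - ?P \<inter> A)" using A(3) by (rule edgeless_subset) auto
      moreover have "sgraph ?P E" "sgraph (?P - ?P \<inter> A) E" using g by (auto elim: sgraph_subset)
      ultimately show "(?P, E) \<in> del 1 Edgeless"
        unfolding del_def Edgeless_def by (auto intro!: exI[of _ "?P \<inter> A"])
    next
      fix u v assume uv: "u \<in> V" "v \<in> V" "p u < p v"
      have 1: "E a b \<longleftrightarrow> a \<in> W" if "a \<in> A" "b \<in> V - A" "p a \<noteq> p b" for a b
      proof (rule ccontr)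
        assume "E a b \<noteq> (a \<in> W)"
        then have "p b = e a" using exc that by blast
        with that show False by (simp add: p_def)
      qed
      have 2: "E u v = E v u" using sym by blast
      show "E u v \<longleftrightarrow> K (if u \<in> A then if u \<in> W then 0 else 1 else 2) (if v \<in> A then if v \<in> W then 0 else 1 else 2)"
      proof (cases "u \<in> A"; cases "v \<in> A")
        assume "u \<in> A" "v \<in> A"
        then show ?thesis using edgelessD[OF A(2)] by (simp add: K_def doubleton_eq_iff)
      next
        assume "u \<notin> A" "v \<notin> A"
        then show ?thesis using edgelessD[OF A(3), of u v] uv by (simp add: K_def)
      next
        assume "u \<in> A" "v \<notin> A"
        then show ?thesis using 1[of u v] uv by (simp add: K_def doubleton_eq_iff)
      next
        assume "u \<notin> A" "v \<in> A"
        then show ?thesis using 1[of v u] uv 2 by (simp add: K_def doubleton_eq_iff)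
      qed
    qed auto
  qed
qed

text \<open>Two neighbourhoods \<open>N b\<close> are comparable or differ by a swap, so those of smaller size are
  contained in those of larger size; the piece of \<open>b\<close> is given by the size of \<open>N b\<close>, and the piece of
  a vertex on the other side by the smallest neighbourhood that contains it.\<close>

lemma lwqo_Bip: "lwqo TYPE('l) (Bip :: 'v graph set)"
proof (rule lwqo_subset)
  let ?K = "\<lambda>x y. x \<and> \<not> y"
  show "lwqo TYPE('l) (layered ?K UNIV (Star :: 'v graph set))"
    by (rule lwqo_layered) (simp_all add: lwqo_Star)
  show "Bip \<subseteq> layered ?K UNIV (Star :: 'v graph set)"
  proof (rule subrelI)
    fix V and E :: "'v \<Rightarrow> 'v \<Rightarrow> bool" assume "(V, E) \<in> Bip"
    then obtain A where g: "sgraph V E" and p23: "p23free V E"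
      and A: "A \<subseteq> V" "edgeless E A" "edgeless E (V - A)"
      unfolding Bip_def mem_Collect_eq case_prod_conv by blast
    have sym: "\<And>u v. E u v \<Longrightarrow> E v u" using g by (auto simp: sgraph_def dest: sympD)
    have fin: "finite V" "finite A" using g A by (auto simp: sgraph_def finite_subset)
    define B where "B = V - A"
    define N where "N b = {a \<in> A. E a b}" for b
    have finN: "finite (N b)" for b using fin by (simp add: N_def)
    \<comment> \<open>Otherwise the edge \<open>x b'\<close> and the path \<open>y b y'\<close>
      would form an induced P2+P3.\<close>
    have swap: "y = y'" if b: "b \<in> B" "b' \<in> B" and x: "x \<in> N b' - N b" and y: "y \<in> N b - N b'" "y' \<in> N b - N b'"
      for b b' x y y'
    proof (rule ccontr)
      assume "y \<noteq> y'"
      show False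
        by (rule p23freeD[OF p23, of x b' y b y'])
          (use b x y \<open>y \<noteq> y'\<close> A sym in \<open>auto simp: B_def N_def edgeless_def\<close>)
    qed
    have sub: "N b \<subseteq> N b'" if b: "b \<in> B" "b' \<in> B" "card (N b) < card (N b')" for b b'
    proof (rule ccontr)
      assume "\<not> N b \<subseteq> N b'"
      then obtain x where x: "x \<in> N b - N b'" by blast
      have "card (N b' - N b) \<le> Suc 0"
        by (subst card_le_Suc0_iff_eq) (use swap[OF b(2,1) x] finN in auto)
      moreover have "0 < card (N b - N b')" using x finN by (auto simp: card_gt_0_iff)
      moreover have "card (N b) = card (N b \<inter> N b') + card (N b - N b')"
        using finN card_Int_Diff by blast
      moreover have "card (N b') = card (N b \<inter> N b') + card (N b' - N b)"
        using finN[of b'] card_Int_Diff[of "N b'" "N b"] by (simp add: Int_commute)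
      ultimately show False using b(3) by linarith
    qed
    have diff: "card (N b - N b') \<le> 1" if b: "b \<in> B" "b' \<in> B" "card (N b) = card (N b')" for b b'
    proof (cases "N b' \<subseteq> N b")
      case True
      then have "N b' = N b" using b finN by (metis card_subset_eq)
      then show ?thesis by simp
    next
      case False
      then obtain x where x: "x \<in> N b' - N b" by blast
      have "card (N b - N b') \<le> Suc 0"
        by (subst card_le_Suc0_iff_eq) (use swap[OF b(1,2) x] finN in auto)
      then show ?thesis by simp
    qed
    \<comment> \<open>All neighbourhoods have size at most \<open>card A\<close>, so the default
      \<open>Suc (card A)\<close> puts the vertices of \<open>A\<close> without neighbours behind
      them all.\<close>
    define p where "p v = (if v \<in> B then card (N v) else if \<exists>b \<in> B. E v b
      then Min ((\<lambda>b. card (N b)) ` {b \<in> B. E v b}) else Suc (card A))" for v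
    have pB: "p b = card (N b)" if "b \<in> B" for b using that by (simp add: p_def)
    have pA1: "p a \<le> card (N b)" if "a \<in> N b" "b \<in> B" for a b
    proof -
      have "a \<notin> B" "E a b" using that by (auto simp: B_def N_def)
      then have "p a = Min ((\<lambda>b. card (N b)) ` {b \<in> B. E a b})" using that by (auto simp: p_def)
      also have "\<dots> \<le> card (N b)" by (rule Min_le) (use fin that \<open>E a b\<close> in \<open>auto simp: B_def\<close>)
      finally show ?thesis .
    qed
    have pA2: "a \<in> N b" if a: "a \<in> A" "b \<in> B" "p a < card (N b)" for a b
    proof -
      have "card (N b) \<le> card A" using fin by (auto simp: N_def intro: card_mono)
      then have ex: "\<exists>b \<in> B. E a b" and "a \<notin> B" using a by (auto simp: p_def B_def split: if_splits)
      then have eq: "p a = Min ((\<lambda>b. card (N b)) ` {b \<in> B. E a b})" by (simp add: p_def)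
      have "p a \<in> (\<lambda>b. card (N b)) ` {b \<in> B. E a b}" unfolding eq
        by (rule Min_in) (use fin ex in \<open>auto simp: B_def\<close>)
      then obtain b0 where "b0 \<in> B" "E a b0" "p a = card (N b0)" by blast
      then show ?thesis using sub[of b0 b] a by (auto simp: N_def)
    qed
    show "(V, E) \<in> layered ?K UNIV Star"
    proof (rule layeredI[where p = p and col = "\<lambda>v. v \<in> A", OF g])
      fix w assume "w \<in> V"
      define k where "k = p w"
      define P where "P = {v \<in> V. p v = k}"
      \<comment> \<open>By \<open>pA2\<close> the set \<open>L\<close> is contained in every
        neighbourhood of the piece. Removing it leaves the parts of the neighbourhoods inside the
        piece: sets of equal size, any two of which differ by at most a swap.\<close>
      define L where "L = {a \<in> A. p a < k}"
      define F where "F = (\<lambda>b. N b - L) ` (B \<inter> P)"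
      have cN: "card (N b) = k" if "b \<in> B \<inter> P" for b using that pB by (auto simp: P_def)
      have LN: "L \<subseteq> N b" if "b \<in> B \<inter> P" for b using pA2 cN[OF that] that by (auto simp: L_def)
      obtain W where W: "finite W" "\<forall>X \<in> F. card ((X - W) \<union> (W - X)) \<le> 1"
      proof (rule near_constant[of F "k - card L"])
        show "finite X" if "X \<in> F" for X using that finN by (auto simp: F_def)
        show "card X = k - card L" if X: "X \<in> F" for X
        proof -
          obtain b where b: "b \<in> B \<inter> P" "X = N b - L" using X by (auto simp: F_def)
          have "finite L" using fin by (simp add: L_def)
          then show ?thesis using cN[OF b(1)] LN[OF b(1)] b(2) by (simp add: card_Diff_subset)
        qed
        show "card (X - Y) \<le> 1" if XY: "X \<in> F" "Y \<in> F" for X Y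
        proof -
          obtain b b' where b: "b \<in> B \<inter> P" "b' \<in> B \<inter> P" "X = N b - L" "Y = N b' - L"
            using XY by (auto simp: F_def)
          then have "card (X - Y) \<le> card (N b - N b')" using finN LN by (intro card_mono) auto
          also have "\<dots> \<le> 1" using diff[of b b'] cN b by auto
          finally show ?thesis .
        qed
      qed
      have "card {a \<in> A \<inter> P. E a b \<noteq> (a \<in> W)} \<le> 1" if b: "b \<in> P - A" for b
      proof -
        have bB: "b \<in> B \<inter> P" using b by (auto simp: B_def P_def)
        have "{a \<in> A \<inter> P. E a b \<noteq> (a \<in> W)} \<subseteq> ((N b - L) - W) \<union> (W - (N b - L))"
          by (auto simp: N_def P_def L_def)
        moreover have "finite (((N b - L) - W) \<union> (W - (N b - L)))" using W finN by blast
        ultimately have "card {a \<in> A \<inter> P. E a b \<noteq> (a \<in> W)} \<le> card (((N b - L) - W) \<union> (W - (N b - L)))"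
          by (rule card_mono[rotated])
        also have "\<dots> \<le> 1" by (rule bspec[OF W(2)]) (use bB in \<open>auto simp: F_def\<close>)
        finally show ?thesis .
      qed
      moreover have "P - A \<inter> P = P - A" by blast
      moreover have "sgraph P E" using g by (rule sgraph_subset) (auto simp: P_def)
      moreover have "edgeless E (A \<inter> P)" using A(2) by (rule edgeless_subset) blast
      moreover have "edgeless E (P - A)" using A(3) by (rule edgeless_subset) (auto simp: P_def)
      ultimately have "sgraph P E \<and> A \<inter> P \<subseteq> P \<and> edgeless E (A \<inter> P) \<and> edgeless E (P - A \<inter> P) \<and>
        (\<forall>b \<in> P - A \<inter> P. card {a \<in> A \<inter> P. E a b \<noteq> (a \<in> W)} \<le> 1)"
        by (simp only: inf_le2 simp_thms) blast
      then have "(P, E) \<in> Star" unfolding Star_def mem_Collect_eq case_prod_conv by blast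
      then show "({v \<in> V. p v = p w}, E) \<in> Star" by (simp add: P_def k_def)
    next
      fix u v assume uv: "u \<in> V" "v \<in> V" "p u < p v"
      have 2: "E u v = E v u" using sym by blast
      show "E u v \<longleftrightarrow> u \<in> A \<and> v \<notin> A"
      proof (cases "u \<in> A"; cases "v \<in> A")
        assume "u \<in> A" "v \<in> A"
        then show ?thesis using edgelessD[OF A(2)] by simp
      next
        assume "u \<notin> A" "v \<notin> A"
        then show ?thesis using edgelessD[OF A(3), of u v] uv by simp
      next
        assume "u \<in> A" "v \<notin> A"
        then show ?thesis using pA2[of u v] uv pB[of v] by (simp add: B_def N_def)
      next
        assume "u \<notin> A" "v \<in> A"
        then show ?thesis using pA1[of v u] uv 2 pB[of u] by (force simp: B_def N_def)
      qed
    qed auto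
  qed
qed

section \<open>Three independent sets around a triangle\<close>

text \<open>The conditions that the vertices of a triangle impose on the sets of their private neighbours.\<close>

definition tri_ax :: "('v \<Rightarrow> 'v \<Rightarrow> bool) \<Rightarrow> 'v set \<Rightarrow> 'v set \<Rightarrow> 'v set \<Rightarrow> bool" where
  "tri_ax E X Y Z \<longleftrightarrow>
    (\<forall>x \<in> X. \<forall>y \<in> Y. \<forall>z \<in> Z. \<forall>z' \<in> Z. E x y \<longrightarrow> z \<noteq> z' \<longrightarrow>
      (E x z \<or> E y z \<or> E x z' \<or> E y z') \<and> \<not> (E x z \<and> E y z \<and> E x z' \<and> E y z')) \<and>
    (\<forall>x \<in> X. \<forall>x' \<in> X. \<forall>y \<in> Y. \<forall>z \<in> Z. x \<noteq> x' \<longrightarrow> E x y \<longrightarrow> E x' y \<longrightarrow> \<not> E y z \<longrightarrow> E x z \<or> E x' z)"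

text \<open>All six orders are listed, so that \<open>tri_perm\<close> allows every later lemma to
  be used with the three sets in any roles.\<close>

definition tri :: "('v \<Rightarrow> 'v \<Rightarrow> bool) \<Rightarrow> 'v set \<Rightarrow> 'v set \<Rightarrow> 'v set \<Rightarrow> bool" where
  "tri E A B C \<longleftrightarrow> symp E \<and> finite A \<and> finite B \<and> finite C \<and> edgeless E A \<and> edgeless E B \<and> edgeless E C \<and>
    tri_ax E A B C \<and> tri_ax E A C B \<and> tri_ax E B A C \<and> tri_ax E B C A \<and> tri_ax E C A B \<and> tri_ax E C B A"

lemma tri_perm:
  assumes "tri E A B C"
  shows "tri E A C B" "tri E B A C" "tri E B C A" "tri E C A B" "tri E C B A"
  using assms by (simp_all add: tri_def)

lemma tri_sym: "tri E A B C \<Longrightarrow> E u v = E v u"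
  unfolding tri_def by (meson sympD)

lemma tri_miss:
  assumes "tri E A B C" "x \<in> A" "y \<in> B" "E x y"
    "z \<in> C" "z' \<in> C" "\<not> E x z" "\<not> E y z" "\<not> E x z'" "\<not> E y z'"
  shows "z = z'"
proof -
  have "tri_ax E A B C" using assms by (simp add: tri_def)
  with assms show ?thesis unfolding tri_ax_def by blast
qed

lemma tri_both:
  assumes "tri E A B C" "x \<in> A" "y \<in> B" "E x y"
    "z \<in> C" "z' \<in> C" "E x z" "E y z" "E x z'" "E y z'"
  shows "z = z'"
proof -
  have "tri_ax E A B C" using assms by (simp add: tri_def)
  with assms show ?thesis unfolding tri_ax_def by blast
qed

lemma tri_cherry:
  assumes "tri E A B C" "x \<in> A" "x' \<in> A" "y \<in> B" "z \<in> C" "E x y" "E x' y" "\<not> E y z" "\<not> E x z" "\<not> E x' z"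
  shows "x = x'"
proof -
  have "tri_ax E A B C" using assms by (simp add: tri_def)
  with assms show ?thesis unfolding tri_ax_def by blast
qed

section \<open>Counting and bounded matchings\<close>

lemma card_le1I: "(\<And>x y. x \<in> S \<Longrightarrow> y \<in> S \<Longrightarrow> x = y) \<Longrightarrow> card S \<le> 1"
proof (cases "finite S")
  case True
  assume "\<And>x y. x \<in> S \<Longrightarrow> y \<in> S \<Longrightarrow> x = y"
  with True show ?thesis unfolding One_nat_def by (subst card_le_Suc0_iff_eq) auto
qed simp

lemma card_le2I:
  assumes "\<And>x y. x \<in> S \<Longrightarrow> y \<in> S \<Longrightarrow> x \<noteq> a \<Longrightarrow> y \<noteq> a \<Longrightarrow> x = y"
  shows "card S \<le> 2"
proof -
  have "card (S - {a}) \<le> 1" by (rule card_le1I) (use assms in auto)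
  then show ?thesis by (metis One_nat_def Suc_1 card_Diff1_le card_Diff_singleton_if diff_le_mono
    le_diff_conv nat_le_linear not_less_eq_eq One_nat_def plus_1_eq_Suc Suc_eq_plus1)
qed

lemma card_Un3_le: "card (P \<union> Q \<union> R) \<le> card P + card Q + card R"
  by (rule order_trans[OF card_Un_le add_right_mono[OF card_Un_le]])

lemma card_two:
  assumes "2 \<le> card S" obtains x y where "x \<in> S" "y \<in> S" "x \<noteq> y"
proof -
  have "\<not> card S \<le> 1" using assms by simp
  then show thesis using card_le1I[of S] that by blast
qed

lemma ex_notin:
  assumes "card S < card T" "finite S" obtains x where "x \<in> T" "x \<notin> S"
  using assms by (metis card_mono not_less subsetI)

text \<open>Suppose there are nine matching edges. A vertex \<open>z\<close> of \<open>C\<close>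
  that sees an end of one of them sees both ends of all but four: if \<open>z\<close> sees
  \<open>x0\<close>, then by \<open>tri_miss\<close> it misses at most one vertex \<open>f x\<close>
  besides \<open>f x0\<close>, and likewise on the other side. At least two vertices of
  \<open>C\<close> see an end of a fixed matching edge, and 4 + 4 < 9 leaves an edge with two common
  neighbours in \<open>C\<close>, against \<open>tri_both\<close>.\<close>

lemma tri_matching:
  assumes t: "tri E A B C" and X: "X \<subseteq> A" and fB: "\<And>x. x \<in> X \<Longrightarrow> f x \<in> B"
    and f: "\<And>x x'. x \<in> X \<Longrightarrow> x' \<in> X \<Longrightarrow> E x (f x') \<longleftrightarrow> x = x'" and C: "3 \<le> card C"
  shows "card X \<le> 8"
proof (rule ccontr)
  assume "\<not> card X \<le> 8"
  then have c9: "9 \<le> card X" by simp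
  have fin: "finite X" using t X by (auto simp: tri_def finite_subset)
  note sym = tri_sym[OF t]
  have XA: "\<And>x. x \<in> X \<Longrightarrow> x \<in> A" using X by blast
  have f1: "card {x \<in> X. \<not> E z (f x)} \<le> 2" if z: "z \<in> C" "x0 \<in> X" "E z x0" for z x0
  proof (rule card_le2I[where a = x0])
    fix x y assume a: "x \<in> {x \<in> X. \<not> E z (f x)}" "y \<in> {x \<in> X. \<not> E z (f x)}" "x \<noteq> x0" "y \<noteq> x0"
    have "f x = f y"
      by (rule tri_miss[OF tri_perm(1)[OF t], of x0 z]) (use a z XA fB f sym in \<open>auto\<close>)
    then show "x = y" using f[of x x] f[of x y] a by simp
  qed
  have f2: "card {x \<in> X. \<not> E z x} \<le> 2" if z: "z \<in> C" "x0 \<in> X" "E z (f x0)" for z x0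
  proof (rule card_le2I[where a = x0])
    fix x y assume a: "x \<in> {x \<in> X. \<not> E z x}" "y \<in> {x \<in> X. \<not> E z x}" "x \<noteq> x0" "y \<noteq> x0"
    then have "\<not> E (f x0) x" "\<not> E (f x0) y" using z f[of x x0] f[of y x0] sym by auto
    then show "x = y"
      using tri_miss[OF tri_perm(5)[OF t], of z "f x0"] a z XA fB by auto
  qed
  have bad: "card {x \<in> X. \<not> E z x \<or> \<not> E z (f x)} \<le> 4"
    if z: "z \<in> C" "x0 \<in> X" "E z x0 \<or> E z (f x0)" for z x0
  proof -
    \<comment> \<open>The bound obtained from one side leaves a matching edge whose end on the other
      side is seen by \<open>z\<close>, so the second bound applies as well.\<close>
    have both: "card {x \<in> X. \<not> E z (f x)} \<le> 2 \<and> card {x \<in> X. \<not> E z x} \<le> 2"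
    proof (cases "E z x0")
      case True
      with z f1 have 1: "card {x \<in> X. \<not> E z (f x)} \<le> 2" by blast
      then obtain x1 where "x1 \<in> X" "E z (f x1)"
        using ex_notin[of "{x \<in> X. \<not> E z (f x)}" X] c9 fin by auto
      with f2 z 1 show ?thesis by blast
    next
      case False
      with z f2 have 1: "card {x \<in> X. \<not> E z x} \<le> 2" by blast
      then obtain x1 where "x1 \<in> X" "E z x1"
        using ex_notin[of "{x \<in> X. \<not> E z x}" X] c9 fin by auto
      with f1 z 1 show ?thesis by blast
    qed
    have "{x \<in> X. \<not> E z x \<or> \<not> E z (f x)} = {x \<in> X. \<not> E z (f x)} \<union> {x \<in> X. \<not> E z x}" by auto
    with both card_Un_le[of "{x \<in> X. \<not> E z (f x)}" "{x \<in> X. \<not> E z x}"] show ?thesis by simp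
  qed
  obtain x0 where x0: "x0 \<in> X" using c9 by fastforce
  let ?M = "{z \<in> C. \<not> E z x0 \<and> \<not> E z (f x0)}"
  have "card ?M \<le> 1"
    by (rule card_le1I, rule tri_miss[OF t, of x0 "f x0"]) (use x0 XA fB f sym in auto)
  then have "2 \<le> card (C - ?M)" using C diff_card_le_card_Diff[of ?M C] t by (auto simp: tri_def)
  then obtain z z' where z: "z \<in> C - ?M" "z' \<in> C - ?M" "z \<noteq> z'" by (rule card_two)
  let ?b = "\<lambda>z. {x \<in> X. \<not> E z x \<or> \<not> E z (f x)}"
  have "card (?b z) \<le> 4" "card (?b z') \<le> 4" using bad[of _ x0] x0 z by auto
  then have lt: "card (?b z \<union> ?b z') < card X" using card_Un_le[of "?b z" "?b z'"] c9 by linarith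
  have "finite (?b z \<union> ?b z')" using fin by simp
  from ex_notin[OF lt this] obtain x where x: "x \<in> X" "x \<notin> ?b z \<union> ?b z'" by blast
  then have "E z x" "E z (f x)" "E z' x" "E z' (f x)" by auto
  then have "E x z" "E (f x) z" "E x z'" "E (f x) z'" using sym by metis+
  moreover have "E x (f x)" using f x by blast
  moreover have "x \<in> A" "f x \<in> B" "z \<in> C" "z' \<in> C" using XA fB x z by auto
  ultimately show False using tri_both[OF t, of x "f x" z z'] z(3) by blast
qed

text \<open>An edge between \<open>B\<close> and \<open>c\<close> has at most one common neighbour
  in \<open>A\<close>, so assigning to each such \<open>x\<close> a common neighbour of
  \<open>x\<close> and \<open>c\<close> in \<open>B\<close> gives an induced matching.\<close>

lemma tri_nbr_matching:
  assumes t: "tri E A B C" and c: "c \<in> C" and C: "3 \<le> card C"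
  shows "card {x \<in> A. E x c \<and> (\<exists>y \<in> B. E y c \<and> E x y)} \<le> 8"
proof -
  let ?X = "{x \<in> A. E x c \<and> (\<exists>y \<in> B. E y c \<and> E x y)}"
  have "\<forall>x \<in> ?X. \<exists>y. y \<in> B \<and> E y c \<and> E x y" by blast
  from bchoice[OF this] obtain f where f: "\<forall>x \<in> ?X. f x \<in> B \<and> E (f x) c \<and> E x (f x)" by blast
  show ?thesis
  proof (rule tri_matching[OF t, where f = f])
    fix x x' assume x: "x \<in> ?X" "x' \<in> ?X"
    have "x = x'" if "E x (f x')"
      by (rule tri_both[OF tri_perm(3)[OF t], of "f x'" c]) (use x that f c tri_sym[OF t] in auto)
    then show "E x (f x') \<longleftrightarrow> x = x'" using f x by blast
  qed (use f C in auto)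
qed

text \<open>An edge \<open>cd\<close> whose ends both have many neighbours in \<open>A\<close> determines a bipartition: the side of
  \<open>d\<close> consists of the neighbours of \<open>c\<close> in \<open>A\<close> and \<open>B\<close> and the non-neighbours of \<open>d\<close> in \<open>C\<close>.\<close>

lemma tri_half:
  assumes t: "tri E A B C" and cd: "c \<in> C" "d \<in> B" "E c d"
    and n: "5 \<le> card {x \<in> A. E x c}" "3 \<le> card B" "3 \<le> card C"
  obtains S where "S \<subseteq> A" "card S \<le> 16"
    "edgeless E (({x \<in> A. E x c \<and> \<not> E x d} - S) \<union> {y \<in> B. E y c} \<union> {z \<in> C. \<not> E z d})"
proof -
  note sym = tri_sym[OF t]
  let ?A1 = "{x \<in> A. E x c \<and> \<not> E x d}"
  let ?M1 = "{x \<in> A. E x c \<and> (\<exists>y \<in> B. E y c \<and> E x y)}"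
  let ?M2 = "{x \<in> ?A1. \<exists>z \<in> C. \<not> E z d \<and> E x z}"
  have fin: "finite A" using t by (simp add: tri_def)
  have "\<forall>x \<in> ?M2. \<exists>z. z \<in> C \<and> \<not> E z d \<and> E x z" by blast
  from bchoice[OF this] obtain f where f: "\<forall>x \<in> ?M2. f x \<in> C \<and> \<not> E (f x) d \<and> E x (f x)" by blast
  have u1: "x = x'" if "x \<in> ?A1" "x' \<in> ?A1" "y \<in> B" "E y c" "E x y" "E x' y" for x x' y
    by (rule tri_both[OF tri_perm(3)[OF t], of y c]) (use that cd sym in auto)
  \<comment> \<open>Two such vertices would form with \<open>z\<close> a path that \<open>d\<close>
    misses, against \<open>tri_cherry\<close>.\<close>
  have u2: "x = x'" if "x \<in> ?A1" "x' \<in> ?A1" "z \<in> C" "\<not> E z d" "E x z" "E x' z" for x x' z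
    by (rule tri_cherry[OF tri_perm(1)[OF t], of x x' z d]) (use that cd sym in auto)
  have "card ?M2 \<le> 8"
  proof (rule tri_matching[OF tri_perm(1)[OF t], where f = f])
    fix x x' assume x: "x \<in> ?M2" "x' \<in> ?M2"
    have "x = x'" if "E x (f x')"
      by (rule u2[of x x' "f x'"]) (use x f that in auto)
    then show "E x (f x') \<longleftrightarrow> x = x'" using f x by blast
  qed (use f n in auto)
  then have cS: "card (?M1 \<union> ?M2) \<le> 16"
    using tri_nbr_matching[OF t cd(1) n(3)] card_Un_le[of ?M1 ?M2] by linarith
  have "card {x \<in> A. E x c \<and> E x d} \<le> 1"
    by (rule card_le1I, rule tri_both[OF tri_perm(3)[OF t], of d c]) (use cd sym in auto)
  moreover have "{x \<in> A. E x c} = ?A1 \<union> {x \<in> A. E x c \<and> E x d}" by blast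
  ultimately have c4: "4 \<le> card ?A1"
    using n(1) card_Un_le[of ?A1 "{x \<in> A. E x c \<and> E x d}"] by simp
  \<comment> \<open>An edge \<open>yz\<close> would allow only three vertices in \<open>?A1\<close>:
    one neighbour of \<open>y\<close>, one neighbour of \<open>z\<close>, and one vertex missed by
    both. But five neighbours of \<open>c\<close>, less at most one shared with \<open>d\<close>,
    are four.\<close>
  have no: "\<not> E y z" if y: "y \<in> B" "E y c" and z: "z \<in> C" "\<not> E z d" for y z
  proof
    assume "E y z"
    have "card {x \<in> ?A1. E x y} \<le> 1" by (rule card_le1I) (use u1 y in blast)
    moreover have "card {x \<in> ?A1. E x z} \<le> 1" by (rule card_le1I) (use u2 z in blast)
    moreover have "card {x \<in> ?A1. \<not> E x y \<and> \<not> E x z} \<le> 1"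
      by (rule card_le1I, rule tri_miss[OF tri_perm(3)[OF t], of y z]) (use y z \<open>E y z\<close> sym in auto)
    moreover have "card ?A1 \<le> card ({x \<in> ?A1. E x y} \<union> {x \<in> ?A1. E x z} \<union> {x \<in> ?A1. \<not> E x y \<and> \<not> E x z})"
      by (rule card_mono) (use fin in auto)
    ultimately have "card ?A1 \<le> 3"
      using card_Un3_le[of "{x \<in> ?A1. E x y}" "{x \<in> ?A1. E x z}" "{x \<in> ?A1. \<not> E x y \<and> \<not> E x z}"] by linarith
    then show False using c4 by linarith
  qed
  show thesis
  proof (rule that[of "?M1 \<union> ?M2"])
    have i: "edgeless E A" "edgeless E B" "edgeless E C" using t by (simp_all add: tri_def)
    have "edgeless E (P \<union> Q \<union> R)"
      if "edgeless E P" "edgeless E Q" "edgeless E R" "\<forall>p \<in> P. \<forall>q \<in> Q. \<not> E p q" "\<forall>p \<in> P. \<forall>q \<in> R. \<not> E p q" "\<forall>p \<in> Q. \<forall>q \<in> R. \<not> E p q"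
      for P Q R using that sym unfolding edgeless_def by blast
    moreover have "edgeless E (?A1 - (?M1 \<union> ?M2))" "edgeless E {y \<in> B. E y c}" "edgeless E {z \<in> C. \<not> E z d}"
      by (rule edgeless_subset[OF i(1)], blast, rule edgeless_subset[OF i(2)], blast, rule edgeless_subset[OF i(3)], blast)
    moreover have "\<forall>p \<in> ?A1 - (?M1 \<union> ?M2). \<forall>q \<in> {y \<in> B. E y c}. \<not> E p q" by blast
    moreover have "\<forall>p \<in> ?A1 - (?M1 \<union> ?M2). \<forall>q \<in> {z \<in> C. \<not> E z d}. \<not> E p q" by blast
    moreover have "\<forall>p \<in> {y \<in> B. E y c}. \<forall>q \<in> {z \<in> C. \<not> E z d}. \<not> E p q" using no by blast
    ultimately show "edgeless E ((?A1 - (?M1 \<union> ?M2)) \<union> {y \<in> B. E y c} \<union> {z \<in> C. \<not> E z d})" by blast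
  qed (use cS in auto)
qed

section \<open>Bipartite up to boundedly many vertices\<close>

definition del_bip :: "('v \<Rightarrow> 'v \<Rightarrow> bool) \<Rightarrow> 'v set \<Rightarrow> nat \<Rightarrow> bool" where
  "del_bip E U k \<longleftrightarrow> (\<exists>S P. S \<subseteq> U \<and> card S \<le> k \<and> P \<subseteq> U - S \<and> edgeless E P \<and> edgeless E (U - S - P))"

lemma del_bipI:
  assumes "S \<subseteq> U" "card S \<le> k" "edgeless E P" "edgeless E Q" "U - S \<subseteq> P \<union> Q"
  shows "del_bip E U k"
proof -
  have "edgeless E (P \<inter> (U - S))" using assms(3) by (rule edgeless_subset) blast
  moreover have "edgeless E (U - S - P \<inter> (U - S))" using assms(4) by (rule edgeless_subset) (use assms in blast)
  ultimately show ?thesis unfolding del_bip_def using assms(1,2)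
    by (intro exI[of _ S] exI[of _ "P \<inter> (U - S)"]) blast
qed

text \<open>The two sets given by \<open>tri_half\<close> for the two ends of \<open>cd\<close> are
  complementary in \<open>B\<close> and \<open>C\<close>. In \<open>A\<close> they leave out at most
  one vertex adjacent to both ends, at most one adjacent to neither, and the two exceptional sets:
  16 + 16 + 1 + 1.\<close>

lemma tri_balanced_edge:
  assumes t: "tri E A B C" and cd: "c \<in> C" "d \<in> B" "E c d"
    and n: "5 \<le> card {x \<in> A. E x c}" "5 \<le> card {x \<in> A. E x d}" "3 \<le> card B" "3 \<le> card C"
  shows "del_bip E (A \<union> B \<union> C) 34"
proof -
  note sym = tri_sym[OF t]
  have dc: "E d c" using cd sym by blast
  obtain S1 where S1: "S1 \<subseteq> A" "card S1 \<le> 16"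
    "edgeless E (({x \<in> A. E x c \<and> \<not> E x d} - S1) \<union> {y \<in> B. E y c} \<union> {z \<in> C. \<not> E z d})" (is "edgeless E ?P")
    by (rule tri_half[OF t cd n(1,3,4)])
  obtain S2 where S2: "S2 \<subseteq> A" "card S2 \<le> 16"
    "edgeless E (({x \<in> A. E x d \<and> \<not> E x c} - S2) \<union> {y \<in> C. E y d} \<union> {z \<in> B. \<not> E z c})" (is "edgeless E ?Q")
    by (rule tri_half[OF tri_perm(1)[OF t] cd(2,1) dc n(2,4,3)])
  have t': "tri E C B A" using tri_perm(5)[OF t] .
  have c1: "card {x \<in> A. E x c \<and> E x d} \<le> 1"
    by (rule card_le1I, rule tri_both[OF t', of c d]) (use cd sym in auto)
  have c2: "card {x \<in> A. \<not> E x c \<and> \<not> E x d} \<le> 1"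
    by (rule card_le1I, rule tri_miss[OF t', of c d]) (use cd sym in auto)
  let ?S = "{x \<in> A. E x c \<and> E x d} \<union> {x \<in> A. \<not> E x c \<and> \<not> E x d} \<union> (S1 \<union> S2)"
  have "card ?S \<le> card {x \<in> A. E x c \<and> E x d} + card {x \<in> A. \<not> E x c \<and> \<not> E x d} + (card S1 + card S2)"
    by (intro order_trans[OF card_Un_le] add_mono card_Un_le)
  then have "card ?S \<le> 34" using c1 c2 S1 S2 by linarith
  moreover have "?S \<subseteq> A \<union> B \<union> C" using S1 S2 by blast
  ultimately show ?thesis using S1(3) S2(3) by (intro del_bipI[of ?S _ _ _ ?P ?Q]) blast+
qed

text \<open>Once the at most 5 + 5 vertices missed by \<open>c\<close> are deleted, \<open>A\<close>
  and \<open>B\<close> lie in the neighbourhood of \<open>c\<close>. There at most eight vertices of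
  \<open>A\<close> have a neighbour in \<open>B\<close>, by \<open>tri_nbr_matching\<close>.\<close>

lemma tri_dominating:
  assumes t: "tri E A B C" and c: "c \<in> C" "card {x \<in> A. \<not> E x c} \<le> 5" "card {y \<in> B. \<not> E y c} \<le> 5"
    and C: "3 \<le> card C"
  shows "del_bip E (A \<union> B \<union> C) 34"
proof -
  note sym = tri_sym[OF t]
  have i: "edgeless E A" "edgeless E B" "edgeless E C" using t by (simp_all add: tri_def)
  let ?M = "{x \<in> A. E x c \<and> (\<exists>y \<in> B. E y c \<and> E x y)}"
  let ?S = "{x \<in> A. \<not> E x c} \<union> {y \<in> B. \<not> E y c} \<union> ?M"
  have "card ?S \<le> card {x \<in> A. \<not> E x c} + card {y \<in> B. \<not> E y c} + card ?M"
    by (intro order_trans[OF card_Un_le] add_mono card_Un_le order_refl)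
  then have "card ?S \<le> 34" using c tri_nbr_matching[OF t c(1) C] by linarith
  moreover have "edgeless E ((A \<union> B) - ?S)" using i sym unfolding edgeless_def by blast
  ultimately show ?thesis using i by (intro del_bipI[of ?S _ _ _ "(A \<union> B) - ?S" C]) blast+
qed

text \<open>A vertex of \<open>C\<close> missed by \<open>x\<close> is either one of the at most
  four neighbours of \<open>y\<close> or missed by both, which \<open>tri_miss\<close> allows
  once.\<close>

lemma tri_near:
  assumes t: "tri E A B C" and e: "x \<in> A" "y \<in> B" "E x y" and n: "card {z \<in> C. E z y} \<le> 4"
  shows "card {z \<in> C. \<not> E z x} \<le> 5"
proof -
  note sym = tri_sym[OF t]
  have "card {z \<in> C. \<not> E z x \<and> \<not> E z y} \<le> 1"
    by (rule card_le1I, rule tri_miss[OF t, of x y]) (use e sym in auto)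
  moreover have "card {z \<in> C. \<not> E z x} \<le> card ({z \<in> C. \<not> E z x \<and> \<not> E z y} \<union> {z \<in> C. E z y})"
    by (rule card_mono) (use t in \<open>auto simp: tri_def\<close>)
  ultimately show ?thesis
    using n card_Un_le[of "{z \<in> C. \<not> E z x \<and> \<not> E z y}" "{z \<in> C. E z y}"] by linarith
qed

lemma ex_nbr:
  assumes "finite C" "card {z \<in> C. \<not> E z x} < card C" obtains z where "z \<in> C" "E z x"
  using ex_notin[OF assms(2)] assms(1) by auto

text \<open>Without such an edge, each edge has an end that misses only boundedly many vertices of the
  third set; following such ends leads to a vertex that nearly dominates both other sets.\<close>

lemma tri_chain:
  assumes t: "tri E A B C" and big: "26 \<le> card A" "26 \<le> card B" "26 \<le> card C"
    and QA: "\<forall>y \<in> B. \<forall>z \<in> C. E y z \<longrightarrow> card {x \<in> A. E x y} \<le> 4 \<or> card {x \<in> A. E x z} \<le> 4"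
    and QB: "\<forall>x \<in> A. \<forall>z \<in> C. E x z \<longrightarrow> card {y \<in> B. E y x} \<le> 4 \<or> card {y \<in> B. E y z} \<le> 4"
    and QC: "\<forall>x \<in> A. \<forall>y \<in> B. E x y \<longrightarrow> card {z \<in> C. E z x} \<le> 4 \<or> card {z \<in> C. E z y} \<le> 4"
    and c: "c \<in> C" "card {x \<in> A. \<not> E x c} \<le> 5"
  shows "del_bip E (A \<union> B \<union> C) 34"
proof -
  note sym = tri_sym[OF t]
  have fin: "finite A" "finite B" "finite C" using t by (simp_all add: tri_def)
  have U: "B \<union> C \<union> A = A \<union> B \<union> C" "A \<union> C \<union> B = A \<union> B \<union> C" by blast+
  show ?thesis
  proof (cases "card {y \<in> B. E y c} \<le> 4")
    case False
    obtain x where x: "x \<in> A" "E x c"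
      by (rule ex_nbr[of A E c]) (use fin c big in auto)
    then have 1: "card {y \<in> B. E y x} \<le> 4" using bspec[OF bspec[OF QB x(1)] c(1)] False by blast
    have "E c x" using x sym by blast
    from tri_near[OF tri_perm(4)[OF t] c(1) x(1) this 1] have "card {y \<in> B. \<not> E y c} \<le> 5" .
    then show ?thesis using tri_dominating[OF t c] big by simp
  next
    \<comment> \<open>Now \<open>c\<close> has few neighbours in \<open>B\<close>, so by
      \<open>tri_near\<close> each neighbour of \<open>c\<close> in \<open>A\<close> nearly
      dominates \<open>B\<close>.\<close>
    case cB: True
    have nx: "card {y \<in> B. \<not> E y x} \<le> 5" if "x \<in> A" "E x c" for x
      by (rule tri_near[OF tri_perm(1)[OF t] that(1) c(1) that(2) cB])
    have "card A \<le> card ({x \<in> A. E x c} \<union> {x \<in> A. \<not> E x c})"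
      by (rule card_mono) (use fin in auto)
    also have "\<dots> \<le> card {x \<in> A. E x c} + card {x \<in> A. \<not> E x c}" by (rule card_Un_le)
    finally have "5 \<le> card {x \<in> A. E x c}" using c big by linarith
    \<comment> \<open>Each of the five vertices misses at most five vertices of \<open>B\<close>, so
      26 vertices in \<open>B\<close> guarantee a vertex adjacent to all five.\<close>
    then obtain X where X: "X \<subseteq> {x \<in> A. E x c}" "card X = 5" "finite X"
      by (rule obtain_subset_with_card_n)
    then obtain x0 where x0: "x0 \<in> X" by fastforce
    then have x0A: "x0 \<in> A" "E x0 c" using X by auto
    show ?thesis
    proof (cases "card {z \<in> C. E z x0} \<le> 4")
      case False
      obtain y where y: "y \<in> B" "E y x0"
        by (rule ex_nbr[of B E x0]) (use nx[OF x0A] fin big in auto)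
      have xy: "E x0 y" using y sym by blast
      then have "card {z \<in> C. E z y} \<le> 4" using bspec[OF bspec[OF QC x0A(1)] y(1)] False by blast
      from tri_near[OF t x0A(1) y(1) xy this] have "card {z \<in> C. \<not> E z x0} \<le> 5" .
      then show ?thesis
        using tri_dominating[OF tri_perm(3)[OF t], of x0] x0A nx[OF x0A] big U by simp
    next
      case xC: True
      have ny: "card {z \<in> C. \<not> E z y} \<le> 5" if "y \<in> B" "E y x0" for y
        by (rule tri_near[OF tri_perm(2)[OF t] that(1) x0A(1) that(2) xC])
      show ?thesis
      proof (cases "\<exists>y \<in> B. E y x0 \<and> 5 \<le> card {x \<in> A. E x y}")
        case True
        then obtain y where y: "y \<in> B" "E y x0" "5 \<le> card {x \<in> A. E x y}" by blast
        obtain z where z: "z \<in> C" "E z y"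
          by (rule ex_nbr[of C E y]) (use ny[OF y(1,2)] fin big in auto)
        have yz: "E y z" using z sym by blast
        then have "card {x \<in> A. E x z} \<le> 4" using bspec[OF bspec[OF QA y(1)] z(1)] y(3) by linarith
        from tri_near[OF tri_perm(3)[OF t] y(1) z(1) yz this] have "card {x \<in> A. \<not> E x y} \<le> 5" .
        then show ?thesis
          using tri_dominating[OF tri_perm(1)[OF t], of y] y ny[OF y(1,2)] big U by simp
      next
        case False
        have "card (\<Union>x \<in> X. {y \<in> B. \<not> E y x}) \<le> (\<Sum>x \<in> X. card {y \<in> B. \<not> E y x})"
          by (rule card_UN_le) (rule X)
        also have "\<dots> \<le> (\<Sum>x \<in> X. 5)" by (rule sum_mono) (use nx X in blast)
        also have "\<dots> < card B" using X big by simp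
        finally have lt: "card (\<Union>x \<in> X. {y \<in> B. \<not> E y x}) < card B" .
        have "finite (\<Union>x \<in> X. {y \<in> B. \<not> E y x})" using fin X by simp
        from ex_notin[OF lt this] obtain y where y: "y \<in> B" "y \<notin> (\<Union>x \<in> X. {y \<in> B. \<not> E y x})" by blast
        then have yX: "\<forall>x \<in> X. E y x" by blast
        then have "X \<subseteq> {x \<in> A. E x y}" using X sym by blast
        then have "5 \<le> card {x \<in> A. E x y}" using X fin card_mono[of "{x \<in> A. E x y}" X] by simp
        with False y yX x0 show ?thesis by blast
      qed
    qed
  qed
qed

text \<open>A set with fewer than 26 vertices may be deleted, and two sets without edges between
  them form one side. Otherwise \<open>tri_balanced_edge\<close> or \<open>tri_chain\<close>
  applies; in the latter case one end of an edge between \<open>B\<close> and \<open>C\<close>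
  nearly dominates \<open>A\<close> and starts the chain.\<close>

lemma tri_del_bip:
  assumes t: "tri E A B C"
  shows "del_bip E (A \<union> B \<union> C) 34"
proof -
  note sym = tri_sym[OF t]
  have fin: "finite A" "finite B" "finite C" and i: "edgeless E A" "edgeless E B" "edgeless E C"
    using t by (simp_all add: tri_def)
  have U: "B \<union> C \<union> A = A \<union> B \<union> C" "A \<union> C \<union> B = A \<union> B \<union> C" "B \<union> A \<union> C = A \<union> B \<union> C"
    "C \<union> B \<union> A = A \<union> B \<union> C" by blast+
  consider "card A < 26" | "card B < 26" | "card C < 26" | "\<forall>y \<in> B. \<forall>z \<in> C. \<not> E y z"
    | (big) c d where "26 \<le> card A" "26 \<le> card B" "26 \<le> card C" "d \<in> B" "c \<in> C" "E d c"
    by (meson not_le)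
  then show ?thesis
  proof cases
    case 1 then show ?thesis using i by (intro del_bipI[of A _ _ _ B C]) auto
  next
    case 2 then show ?thesis using i by (intro del_bipI[of B _ _ _ A C]) auto
  next
    case 3 then show ?thesis using i by (intro del_bipI[of C _ _ _ A B]) auto
  next
    case 4
    then have "edgeless E (B \<union> C)" using i sym unfolding edgeless_def by blast
    then show ?thesis using i by (intro del_bipI[of "{}" _ _ _ A "B \<union> C"]) auto
  next
    case big
    let ?Q = "\<lambda>A B C. \<forall>y \<in> B. \<forall>z \<in> C. E y z \<longrightarrow> card {x \<in> A. E x y} \<le> 4 \<or> card {x \<in> A. E x z} \<le> 4"
    show ?thesis
    proof (cases "?Q A B C \<and> ?Q B A C \<and> ?Q C A B")
      case True
      then have Q: "?Q A B C" "?Q B A C" "?Q C A B" "?Q A C B" "?Q B C A" "?Q C B A" using sym by blast+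
      have "card {x \<in> A. E x d} \<le> 4 \<or> card {x \<in> A. E x c} \<le> 4" using Q(1) big by blast
      then show ?thesis
      proof
        assume "card {x \<in> A. E x d} \<le> 4"
        moreover have "E c d" using big sym by blast
        ultimately have "card {x \<in> A. \<not> E x c} \<le> 5"
          by (intro tri_near[OF tri_perm(5)[OF t] big(5,4)])
        then show ?thesis using tri_chain[OF t big(1-3) Q(1,2,3) big(5)] by blast
      next
        assume "card {x \<in> A. E x c} \<le> 4"
        then have "card {x \<in> A. \<not> E x d} \<le> 5"
          by (intro tri_near[OF tri_perm(3)[OF t] big(4,5,6)])
        then show ?thesis using tri_chain[OF tri_perm(1)[OF t] big(1,3,2) Q(4,3,2) big(4)] U by simp
      qed
    next
      case False
      then consider y z where "y \<in> B" "z \<in> C" "E y z" "5 \<le> card {x \<in> A. E x y}" "5 \<le> card {x \<in> A. E x z}"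
        | y z where "y \<in> A" "z \<in> C" "E y z" "5 \<le> card {x \<in> B. E x y}" "5 \<le> card {x \<in> B. E x z}"
        | y z where "y \<in> A" "z \<in> B" "E y z" "5 \<le> card {x \<in> C. E x y}" "5 \<le> card {x \<in> C. E x z}"
        by (auto simp: not_le Suc_le_eq[symmetric])
      then show ?thesis
      proof cases
        case 1 then show ?thesis using tri_balanced_edge[OF tri_perm(1)[OF t], of y z] big U by simp
      next
        case 2 then show ?thesis using tri_balanced_edge[OF tri_perm(3)[OF t], of y z] big U by simp
      next
        case 3 then show ?thesis using tri_balanced_edge[OF tri_perm(5)[OF t], of y z] big U by simp
      qed
    qed
  qed
qed

section \<open>Maximum cliques with at least four vertices\<close>

lemma delI: "sgraph V E \<Longrightarrow> S \<subseteq> V \<Longrightarrow> card S \<le> k \<Longrightarrow> (V - S, E) \<in> Y \<Longrightarrow> (V, E) \<in> del k Y"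
  unfolding del_def by blast

lemma P3_freeI:
  assumes "sgraph V E" "\<And>u v w. u \<in> V \<Longrightarrow> v \<in> V \<Longrightarrow> w \<in> V \<Longrightarrow> E u v \<Longrightarrow> E v w \<Longrightarrow> u \<noteq> w \<Longrightarrow> E u w"
  shows "(V, E) \<in> P3_free"
  using assms unfolding P3_free_def by blast

text \<open>Colour 0 is the clique, colours 1 and 2 are the two components of the rest that may be large
  and attached to different vertices of the clique, and colour 3 is everything else.\<close>

definition Clique_columns :: "'v graph set" where
  "Clique_columns = layered (\<lambda>c d. c = d \<and> c \<noteq> 3) {..<4 :: nat} (del 1 P3_free)"

section \<open>Graphs without a diamond and P2+P3, and their maximum cliques\<close>

locale dpgraph =
  fixes V :: "'v set" and E :: "'v \<Rightarrow> 'v \<Rightarrow> bool"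
  assumes sgraph: "sgraph V E" and p23free: "p23free V E"
    and diamond_free: "\<And>a b c d. {a, b, c, d} \<subseteq> V \<Longrightarrow> E c d \<Longrightarrow> E a c \<Longrightarrow> E a d \<Longrightarrow> E b c \<Longrightarrow> E b d \<Longrightarrow> a \<noteq> b \<Longrightarrow> E a b"
begin

lemma fin: "finite V" using sgraph by (simp add: sgraph_def)

lemma sym: "E u v \<Longrightarrow> E v u" using sgraph by (auto simp: sgraph_def dest: sympD)

lemma comm: "E u v = E v u" using sym by blast

lemma irrefl: "\<not> E u u" using sgraph by (auto simp: sgraph_def dest: irreflpD)

lemmas p23 = p23freeD[OF p23free]

end

locale dpgraph_clique = dpgraph +
  fixes Q
  assumes QV: "Q \<subseteq> V" and Q: "\<And>u v. u \<in> Q \<Longrightarrow> v \<in> Q \<Longrightarrow> u \<noteq> v \<Longrightarrow> E u v"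
    and Qmax: "\<And>R. R \<subseteq> V \<Longrightarrow> (\<And>u v. u \<in> R \<Longrightarrow> v \<in> R \<Longrightarrow> u \<noteq> v \<Longrightarrow> E u v) \<Longrightarrow> card R \<le> card Q"
begin

lemma finQ: "finite Q" using QV fin by (rule finite_subset)

text \<open>With two neighbours in \<open>Q\<close>, the vertex \<open>v\<close> would by the
  excluded diamond be adjacent to all of \<open>Q\<close>, and \<open>Q\<close> would not be
  maximum.\<close>

lemma one_nbr:
  assumes v: "v \<in> V - Q" and q: "q \<in> Q" "q' \<in> Q" "E v q" "E v q'"
  shows "q = q'"
proof (rule ccontr)
  assume ne: "q \<noteq> q'"
  have vx: "E v x" if "x \<in> Q" for x
  proof (cases "x = q \<or> x = q'")
    case False
    show ?thesis
      by (rule diamond_free[of v x q q']) (use v q QV Q ne that False in auto)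
  qed (use q in auto)
  have "card (insert v Q) \<le> card Q"
    by (rule Qmax) (use v QV Q vx sym in auto)
  then show False using v finQ by simp
qed

text \<open>Two vertices of \<open>Q\<close> missed by the path would form an edge without any
  adjacency to it.\<close>

lemma P3_hits:
  assumes "u \<in> V - Q" "v \<in> V - Q" "w \<in> V - Q" "E u v" "E v w" "u \<noteq> w" "\<not> E u w"
  shows "card Q \<le> Suc (card {q \<in> Q. E u q \<or> E v q \<or> E w q})"
proof (rule ccontr)
  let ?H = "{q \<in> Q. E u q \<or> E v q \<or> E w q}"
  assume "\<not> card Q \<le> Suc (card ?H)"
  moreover have "card (Q - ?H) = card Q - card ?H" by (rule card_Diff_subset) (use finQ in auto)
  ultimately have "\<not> card (Q - ?H) \<le> Suc 0" by linarith
  then obtain q q' where q: "q \<in> Q - ?H" "q' \<in> Q - ?H" "q \<noteq> q'"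
    using card_le_Suc0_iff_eq[of "Q - ?H"] finQ by blast
  show False
    by (rule p23[of q q' u v w]) (use assms q QV Q comm in auto)
qed

lemma card_nbr_Q: "v \<in> V - Q \<Longrightarrow> card {q \<in> Q. E v q} \<le> 1"
  unfolding One_nat_def by (subst card_le_Suc0_iff_eq) (use finQ one_nbr in auto)

lemma card_nbrs_Q2:
  assumes "u \<in> V - Q" "v \<in> V - Q"
  shows "card {q \<in> Q. E u q \<or> E v q} \<le> 2"
proof -
  have "{q \<in> Q. E u q \<or> E v q} = {q \<in> Q. E u q} \<union> {q \<in> Q. E v q}" by blast
  then show ?thesis
    using card_Un_le[of "{q \<in> Q. E u q}" "{q \<in> Q. E v q}"] assms[THEN card_nbr_Q] by simp
qed

lemma card_nbrs_Q3:
  assumes "u \<in> V - Q" "v \<in> V - Q" "w \<in> V - Q"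
  shows "card {q \<in> Q. E u q \<or> E v q \<or> E w q} \<le> 3"
proof -
  have "{q \<in> Q. E u q \<or> E v q \<or> E w q} = {q \<in> Q. E u q} \<union> {q \<in> Q. E v q \<or> E w q}" by blast
  then show ?thesis
    using card_Un_le[of "{q \<in> Q. E u q}" "{q \<in> Q. E v q \<or> E w q}"] card_nbr_Q[OF assms(1)] card_nbrs_Q2[OF assms(2,3)]
    by simp
qed

text \<open>Outside \<open>Q\<close> the components are cliques, and \<open>R r\<close> is the one
  of \<open>r\<close>. If only one vertex of \<open>Q\<close> has neighbours outside
  \<open>Q\<close>, deleting it separates the rest of \<open>Q\<close> from the components. If two
  vertices \<open>q\<close> and \<open>q'\<close> do, then \<open>attach\<close> confines the edges
  outside two components to pairs attached to \<open>q\<close> and \<open>q'\<close>, and deleting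
  these two vertices frees such components from \<open>Q\<close>.\<close>

lemma clique_ge5:
  assumes c5: "5 \<le> card Q"
  shows "(V, E) \<in> del 2 Clique_columns \<union> del 1 P3_free"
proof -
  let ?W = "V - Q"
  have P3: "E u w" if "u \<in> ?W" "v \<in> ?W" "w \<in> ?W" "E u v" "E v w" "u \<noteq> w" for u v w
    using P3_hits[OF that] card_nbrs_Q3[OF that(1-3)] c5 by linarith
  define R where "R r = {s \<in> ?W. s = r \<or> E r s}" for r
  have Radj: "E s t" if "r \<in> ?W" "s \<in> R r" "t \<in> R r" "s \<noteq> t" for r s t
    using that P3[of s r t] sym unfolding R_def by blast
  have Rclosed: "t \<in> R r" if "r \<in> ?W" "s \<in> R r" "t \<in> ?W" "E s t" for r s t
    using that P3[of r s t] unfolding R_def by blast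
  have Req: "R s = R t" if st: "s \<in> ?W" "t \<in> ?W" "E s t" for s t
  proof -
    have "R s \<subseteq> R t" if "s \<in> ?W" "t \<in> ?W" "E s t" for s t
    proof
      fix x assume "x \<in> R s"
      then show "x \<in> R t" using that P3[of t s x] sym unfolding R_def by blast
    qed
    then show ?thesis using st sym by blast
  qed
  \<comment> \<open>If \<open>q\<close> missed the edge \<open>st\<close>, there would be a further
    \<open>q'\<close> in \<open>Q\<close> missing it, as \<open>s\<close> and \<open>t\<close> have
    at most two neighbours in \<open>Q\<close>; then \<open>q' q r\<close> would be a path without
    adjacency to \<open>st\<close>.\<close>
  have attach: "E s q \<or> E t q"
    if a: "q \<in> Q" "r \<in> ?W" "E r q" "s \<in> ?W" "t \<in> ?W" "E s t" "s \<notin> R r" "t \<notin> R r" for q r s t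
  proof (rule ccontr)
    assume no: "\<not> (E s q \<or> E t q)"
    let ?H = "insert q {q \<in> Q. E s q \<or> E t q}"
    have "card ?H < card Q"
      using card_nbrs_Q2[OF a(4,5)] c5 card_insert_le_m1[of 3 "{q \<in> Q. E s q \<or> E t q}" q] by simp
    moreover have "finite ?H" using finQ by simp
    ultimately obtain q' where q': "q' \<in> Q" "q' \<notin> ?H" by (rule ex_notin)
    have "\<not> E q' r"
    proof
      assume "E q' r"
      then have "q = q'" using one_nbr[OF a(2) a(1) q'(1) a(3)] sym by blast
      with q' show False by blast
    qed
    show False
      by (rule p23[of s t q' q r]) (use a q' QV Q no \<open>\<not> E q' r\<close> comm R_def in auto)
  qed
  show ?thesis
  proof (cases "\<exists>q \<in> Q. \<exists>q' \<in> Q. \<exists>r \<in> ?W. \<exists>r' \<in> ?W. q \<noteq> q' \<and> E r q \<and> E r' q'")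
    case False
    obtain q0 where q0: "q0 \<in> Q" "\<And>q r. q \<in> Q \<Longrightarrow> r \<in> ?W \<Longrightarrow> E r q \<Longrightarrow> q = q0"
    proof (cases "\<exists>q \<in> Q. \<exists>r \<in> ?W. E r q")
      case True
      then show thesis using that False by blast
    next
      case no: False
      obtain q0 where "q0 \<in> Q" using c5 by fastforce
      then show thesis using that no by blast
    qed
    have "(V - {q0}, E) \<in> P3_free"
    proof (rule P3_freeI)
      show "sgraph (V - {q0}) E" using sgraph by (rule sgraph_subset) blast
      fix u v w assume uvw: "u \<in> V - {q0}" "v \<in> V - {q0}" "w \<in> V - {q0}" "E u v" "E v w" "u \<noteq> w"
      then have "u \<in> Q \<longleftrightarrow> v \<in> Q" "w \<in> Q \<longleftrightarrow> v \<in> Q" using q0(2) sym by blast+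
      then show "E u w" using uvw P3[of u v w] Q[of u w] by blast
    qed
    then have "(V, E) \<in> del 1 P3_free" using sgraph q0 QV by (intro delI[of _ _ "{q0}"]) auto
    then show ?thesis by blast
  next
    case True
    then obtain q q' r r' where a: "q \<in> Q" "q' \<in> Q" "r \<in> ?W" "r' \<in> ?W" "q \<noteq> q'" "E r q" "E r' q'" by blast
    obtain e :: "'a \<Rightarrow> nat" where e: "inj_on e V" using ex_enum[OF fin] by metis
    define V' where "V' = V - {q, q'}"
    define Q' where "Q' = Q - {q, q'}"
    define col :: "'a \<Rightarrow> nat" where "col v = (if v \<in> Q then 0 else if v \<in> R r then 1 else if v \<in> R r' then 2 else 3)" for v
    \<comment> \<open>A vertex attached to some \<open>x\<close> in \<open>Q'\<close> joins the
      piece of \<open>x\<close>. Of the others, those in the two special components are alone, while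
      those in any other component share a piece.\<close>
    define p where "p v = (if v \<in> Q then e v else if \<exists>x \<in> Q'. E v x then e (THE x. x \<in> Q' \<and> E v x)
      else if v \<in> R r \<union> R r' then e v else Min (e ` R v))" for v
    have g': "sgraph V' E" using sgraph by (rule sgraph_subset) (auto simp: V'_def)
    have att: "p v = e x" if "v \<in> ?W" "x \<in> Q'" "E v x" for v x
    proof -
      have "(THE x. x \<in> Q' \<and> E v x) = x"
        by (rule the_equality) (use that one_nbr[OF that(1)] in \<open>auto simp: Q'_def\<close>)
      then show ?thesis using that by (auto simp: p_def)
    qed
    have Wcol: "E u v \<longleftrightarrow> col u = col v \<and> col u \<noteq> 3" if uv: "u \<in> ?W" "v \<in> ?W" "p u \<noteq> p v" for u v
    proof -
      have ne: "u \<noteq> v" using uv by blast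
      have c1: "u \<in> R r \<longleftrightarrow> v \<in> R r" if "E u v" using Rclosed[OF a(3)] that uv sym by blast
      have c2: "u \<in> R r' \<longleftrightarrow> v \<in> R r'" if "E u v" using Rclosed[OF a(4)] that uv sym by blast
      \<comment> \<open>An edge outside both special components is attached to \<open>q\<close> at
        one end and to \<open>q'\<close> at the other. Neither end then has a neighbour in
        \<open>Q'\<close>, so both lie in the piece of their component.\<close>
      have c3: "\<not> E u v" if "u \<notin> R r" "v \<notin> R r" "u \<notin> R r'" "v \<notin> R r'"
      proof
        assume Euv: "E u v"
        have 1: "E u q \<or> E v q" using attach[OF a(1,3,6) uv(1,2) Euv] that by blast
        have 2: "E u q' \<or> E v q'" using attach[OF a(2,4,7) uv(1,2) Euv] that by blast
        have "E u q \<and> E v q' \<or> E v q \<and> E u q'"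
          using 1 2 one_nbr[OF uv(1) a(1,2)] one_nbr[OF uv(2) a(1,2)] a(5) by blast
        then have "\<not> (\<exists>x \<in> Q'. E u x)" "\<not> (\<exists>x \<in> Q'. E v x)"
          using one_nbr[OF uv(1)] one_nbr[OF uv(2)] a unfolding Q'_def by blast+
        then have "p u = p v" using that uv Req[OF uv(1,2) Euv] by (simp add: p_def)
        then show False using uv by blast
      qed
      show ?thesis
      proof (cases "u \<in> R r \<and> v \<in> R r \<or> u \<in> R r' \<and> v \<in> R r'")
        case True
        then have "E u v" using Radj a ne by blast
        with c1 c2 True uv show ?thesis unfolding col_def by auto
      next
        case F: False
        then have "\<not> E u v" using c1 c2 c3 by blast
        moreover have "\<not> (col u = col v \<and> col u \<noteq> 3)" using F uv by (auto simp: col_def)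
        ultimately show ?thesis by blast
      qed
    qed
    have "(V', E) \<in> Clique_columns"
      unfolding Clique_columns_def
    proof (rule layeredI[where p = p and col = col, OF g'])
      fix w assume w: "w \<in> V'"
      let ?P = "{v \<in> V'. p v = p w}"
      have "card (?P \<inter> Q) \<le> 1"
        unfolding One_nat_def
      proof (subst card_le_Suc0_iff_eq)
        show "\<forall>x \<in> ?P \<inter> Q. \<forall>y \<in> ?P \<inter> Q. x = y"
        proof (intro ballI)
          fix x y assume "x \<in> ?P \<inter> Q" "y \<in> ?P \<inter> Q"
          then have "e x = e y" "x \<in> V" "y \<in> V" unfolding V'_def by (auto simp: p_def)
          then show "x = y" using e by (auto dest: inj_onD)
        qed
      qed (use finQ in auto)
      moreover have "(?P - ?P \<inter> Q, E) \<in> P3_free"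
      proof (rule P3_freeI)
        show "sgraph (?P - ?P \<inter> Q) E" using g' by (rule sgraph_subset) blast
        fix u v w' assume "u \<in> ?P - ?P \<inter> Q" "v \<in> ?P - ?P \<inter> Q" "w' \<in> ?P - ?P \<inter> Q" "E u v" "E v w'" "u \<noteq> w'"
        then show "E u w'" using P3[of u v w'] by (auto simp: V'_def)
      qed
      moreover have "sgraph ?P E" using g' by (rule sgraph_subset) blast
      ultimately show "(?P, E) \<in> del 1 P3_free" by (intro delI[of _ _ "?P \<inter> Q"]) auto
    next
      fix u v assume "u \<in> V'" "v \<in> V'" "p u < p v"
      then have uv: "u \<in> V'" "v \<in> V'" "p u \<noteq> p v" by auto
      have QW: "\<not> E x y" if "x \<in> Q'" "y \<in> ?W" "p x \<noteq> p y" for x y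
        using att[of y x] that sym unfolding p_def Q'_def by auto
      show "E u v \<longleftrightarrow> col u = col v \<and> col u \<noteq> 3"
      proof (cases "u \<in> Q"; cases "v \<in> Q")
        assume "u \<in> Q" "v \<in> Q"
        then show ?thesis using Q[of u v] uv by (auto simp: col_def)
      next
        assume "u \<in> Q" "v \<notin> Q"
        then show ?thesis using QW[of u v] uv by (auto simp: col_def V'_def Q'_def)
      next
        assume "u \<notin> Q" "v \<in> Q"
        then show ?thesis using QW[of v u] uv comm[of u v] by (auto simp: col_def V'_def Q'_def)
      next
        assume "u \<notin> Q" "v \<notin> Q"
        then show ?thesis using Wcol[of u v] uv by (auto simp: V'_def)
      qed
    qed (auto simp: col_def)
    then have "(V, E) \<in> del 2 Clique_columns"
      using sgraph a QV by (intro delI[of _ _ "{q, q'}"]) (auto simp: V'_def card_insert_if)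
    then show ?thesis by blast
  qed
qed

text \<open>Sort the neighbours of \<open>v\<close> outside \<open>Q\<close> by their neighbour in
  \<open>Q\<close>, if any; this gives five classes. Two nonadjacent vertices of one class would
  form with \<open>v\<close> a path that sees at most two of the four vertices of \<open>Q\<close>,
  against \<open>P3_hits\<close>. So each class is a clique of at most four vertices, and degrees
  outside \<open>Q\<close> are at most 20. Deleting \<open>Q\<close>, an induced path and its
  neighbours costs at most 4 + 3 + 60 vertices and leaves no edge, since an edge would miss the
  path.\<close>

lemma clique_4:
  assumes c4: "card Q = 4"
  shows "(V, E) \<in> del 70 P3_free"
proof -
  let ?W = "V - Q"
  define N where "N v = {n \<in> ?W. E v n}" for v
  have finN: "finite (N v)" for v using fin by (simp add: N_def)
  show ?thesis
  proof (cases "\<exists>u \<in> ?W. \<exists>v \<in> ?W. \<exists>w \<in> ?W. E u v \<and> E v w \<and> u \<noteq> w \<and> \<not> E u w")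
    case False
    have "(?W, E) \<in> P3_free"
      by (rule P3_freeI) (use False sgraph_subset[OF sgraph, of ?W] in blast)+
    then show ?thesis using sgraph QV c4 by (intro delI[of _ _ Q]) auto
  next
    case True
    then obtain u v w where P: "u \<in> ?W" "v \<in> ?W" "w \<in> ?W" "E u v" "E v w" "u \<noteq> w" "\<not> E u w" by blast
    have deg: "card (N v) \<le> 20" if v: "v \<in> ?W" for v
    proof -
      define M where "M X = {n \<in> N v. {q \<in> Q. E n q} = X}" for X
      have cl: "card (M X) \<le> 4" if X: "card X \<le> 1" for X
      proof -
        have adj: "E n n'" if n: "n \<in> M X" "n' \<in> M X" "n \<noteq> n'" for n n'
        proof (rule ccontr)
          assume no: "\<not> E n n'"
          have nW: "n \<in> ?W" "E n v" "n' \<in> ?W" "E v n'" using n sym by (auto simp: M_def N_def)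
          have "{q \<in> Q. E n q \<or> E v q \<or> E n' q} = X \<union> {q \<in> Q. E v q}" using n by (auto simp: M_def)
          then have "card {q \<in> Q. E n q \<or> E v q \<or> E n' q} \<le> 2"
            using card_Un_le[of X "{q \<in> Q. E v q}"] X card_nbr_Q[OF v] by simp
          then show False using P3_hits[OF nW(1) v nW(3) nW(2,4) n(3) no] c4 by simp
        qed
        have "M X \<subseteq> V" by (auto simp: M_def N_def)
        then have "card (M X) \<le> card Q" using adj by (rule Qmax)
        then show ?thesis using c4 by simp
      qed
      have "N v \<subseteq> (\<Union>X \<in> insert {} ((\<lambda>q. {q}) ` Q). M X)"
      proof
        fix n assume n: "n \<in> N v"
        then have "n \<in> ?W" by (simp add: N_def)
        have "{q \<in> Q. E n q} = {} \<or> (\<exists>q \<in> Q. {q \<in> Q. E n q} = {q})"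
        proof (cases "\<exists>q \<in> Q. E n q")
          case True
          then obtain q where q: "q \<in> Q" "E n q" by blast
          have "{q \<in> Q. E n q} = {q}" using q one_nbr[OF \<open>n \<in> ?W\<close> _ q(1) _ q(2)] by blast
          with q show ?thesis by blast
        qed blast
        then show "n \<in> (\<Union>X \<in> insert {} ((\<lambda>q. {q}) ` Q). M X)" using n by (auto simp: M_def)
      qed
      then have "card (N v) \<le> card (\<Union>X \<in> insert {} ((\<lambda>q. {q}) ` Q). M X)"
        by (rule card_mono[rotated]) (use finQ finN in \<open>auto simp: M_def\<close>)
      also have "\<dots> \<le> (\<Sum>X \<in> insert {} ((\<lambda>q. {q}) ` Q). card (M X))" by (rule card_UN_le) (use finQ in auto)
      also have "\<dots> \<le> (\<Sum>X \<in> insert {} ((\<lambda>q. {q}) ` Q). 4)" by (rule sum_mono) (use cl in auto)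
      also have "\<dots> = 4 * card (insert {} ((\<lambda>q. {q}) ` Q))" by simp
      also have "card (insert {} ((\<lambda>q. {q}) ` Q)) \<le> Suc (card ((\<lambda>q. {q}) ` Q))" by (rule card_insert_le_m1) auto
      also have "card ((\<lambda>q. {q}) ` Q) = 4" using c4 by (simp add: card_image)
      finally show ?thesis by simp
    qed
    let ?S = "(Q \<union> {u, v, w}) \<union> (N u \<union> N v \<union> N w)"
    have "card ?S \<le> card (Q \<union> {u, v, w}) + card (N u \<union> N v \<union> N w)" by (rule card_Un_le)
    moreover have "card (Q \<union> {u, v, w}) \<le> card Q + card {u, v, w}" by (rule card_Un_le)
    moreover have "card {u, v, w} \<le> 3" by (simp add: card_insert_if)
    moreover have "card (N u \<union> N v \<union> N w) \<le> card (N u) + card (N v) + card (N w)"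
      by (rule order_trans[OF card_Un_le add_right_mono[OF card_Un_le]])
    ultimately have "card ?S \<le> 70" using deg[OF P(1)] deg[OF P(2)] deg[OF P(3)] c4 by linarith
    moreover have "(V - ?S, E) \<in> P3_free"
    proof (rule P3_freeI)
      show "sgraph (V - ?S) E" using sgraph by (rule sgraph_subset) blast
      fix x y z assume x: "x \<in> V - ?S" "y \<in> V - ?S" "E x y"
      then have "\<not> E x u" "\<not> E x v" "\<not> E x w" "\<not> E y u" "\<not> E y v" "\<not> E y w"
        using comm unfolding N_def by auto
      then have False using p23[of x y u v w] P x by auto
      then show "E x z" by blast
    qed
    moreover have "?S \<subseteq> V" using QV P by (auto simp: N_def)
    ultimately show ?thesis using sgraph by (intro delI[of _ _ ?S])
  qed
qed

end

section \<open>Maximum cliques with three vertices\<close>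

text \<open>Two sets that are completely joined except inside columns, and a third set whose edges
  to them stay inside columns. The pattern arises both around a triangle and around an induced
  5-cycle.\<close>

definition Columns :: "'v graph set" where
  "Columns = layered (\<lambda>c d. {c, d} = {1, 2}) {..<3 :: nat} (Bip \<union> del 3 Edgeless)"

lemma ColumnsI:
  assumes g: "sgraph U E" and U: "U \<subseteq> Z \<union> A \<union> B" and i: "edgeless E Z" "edgeless E A" "edgeless E B"
    and AB: "\<And>u v. u \<in> A \<Longrightarrow> v \<in> B \<Longrightarrow> p u \<noteq> p v \<Longrightarrow> E u v"
    and Z: "\<And>z u. z \<in> Z \<Longrightarrow> u \<in> A \<union> B \<Longrightarrow> p z \<noteq> p u \<Longrightarrow> \<not> E z u"
    and pieces: "\<And>w. w \<in> U \<Longrightarrow> ({v \<in> U. p v = (p w :: nat)}, E) \<in> Bip \<union> del 3 Edgeless"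
  shows "(U, E) \<in> Columns"
  unfolding Columns_def
proof (rule layeredI[where p = p and col = "\<lambda>v. if v \<in> Z then 0 else if v \<in> A then 1 else 2", OF g])
  fix u v assume uv: "u \<in> U" "v \<in> U" "p u < p v"
  have comm: "E u v = E v u" using g by (auto simp: sgraph_def dest: sympD)
  show "E u v \<longleftrightarrow> {if u \<in> Z then 0 else if u \<in> A then 1 else 2, if v \<in> Z then 0 else if v \<in> A then 1 else 2} = {1, 2 :: nat}"
  proof (cases "u \<in> Z \<or> v \<in> Z")
    case True
    then have "\<not> E u v" using Z[of u v] Z[of v u] edgelessD[OF i(1), of u v] uv comm U by auto
    with True show ?thesis by (auto simp: doubleton_eq_iff)
  next
    case False
    then have "u \<in> A \<union> B" "v \<in> A \<union> B" using uv U by auto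
    with False uv show ?thesis
      using AB[of u v] AB[of v u] edgelessD[OF i(2), of u v] edgelessD[OF i(3), of u v] comm
      by (auto simp: doubleton_eq_iff)
  qed
qed (use pieces in auto)

lemma BipI:
  assumes "sgraph U E" "p23free U E" "edgeless E A" "edgeless E B" "U \<subseteq> A \<union> B"
  shows "(U, E) \<in> Bip"
proof -
  have "edgeless E (A \<inter> U)" using assms(3) by (rule edgeless_subset) blast
  moreover have "edgeless E (U - A \<inter> U)" using assms(4) by (rule edgeless_subset) (use assms(5) in blast)
  moreover have "A \<inter> U \<subseteq> U" by blast
  ultimately show ?thesis unfolding Bip_def mem_Collect_eq case_prod_conv using assms(1,2) by blast
qed

lemma small_del_Edgeless:
  assumes "sgraph U E" "card U \<le> k" shows "(U, E) \<in> del k Edgeless"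
  using assms sgraph_subset[OF assms(1), of "{}"] by (intro delI[of _ _ U]) (auto simp: Edgeless_def edgeless_def)

lemma del_bip_Bip:
  assumes "sgraph U E" "p23free U E" "del_bip E U k" shows "(U, E) \<in> del k Bip"
proof -
  from assms(3) obtain S P where S: "S \<subseteq> U" "card S \<le> k" "P \<subseteq> U - S" "edgeless E P" "edgeless E (U - S - P)"
    unfolding del_bip_def by blast
  have "sgraph (U - S) E" "p23free (U - S) E"
    using assms(1,2) sgraph_subset p23free_subset by (metis Diff_subset)+
  then have "(U - S, E) \<in> Bip" unfolding Bip_def using S by blast
  with assms(1) S(1,2) show ?thesis by (rule delI)
qed

lemma del_mono: "(U, E) \<in> del k X \<Longrightarrow> k \<le> n \<Longrightarrow> X \<subseteq> Y \<Longrightarrow> (U, E) \<in> del n Y"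
  unfolding del_def mem_Collect_eq case_prod_conv by (meson order_trans subsetD)

section \<open>Private neighbours of the vertices of a triangle\<close>

locale dpgraph_triangle = dpgraph_clique +
  assumes Q3: "card Q = 3"
begin

definition N where "N q = {v \<in> V - Q. E v q}"

definition Z where "Z = {v \<in> V - Q. \<forall>q \<in> Q. \<not> E v q}"

lemma N_V: "v \<in> N q \<Longrightarrow> v \<in> V - Q" "v \<in> N q \<Longrightarrow> E v q" by (auto simp: N_def)

lemma Z_V: "v \<in> Z \<Longrightarrow> v \<in> V - Q" "v \<in> Z \<Longrightarrow> q \<in> Q \<Longrightarrow> \<not> E v q" by (auto simp: Z_def)

lemma N_other: "v \<in> N q \<Longrightarrow> q \<in> Q \<Longrightarrow> q' \<in> Q \<Longrightarrow> q \<noteq> q' \<Longrightarrow> \<not> E v q'"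
  using one_nbr by (auto simp: N_def)

lemma N_disjoint: "q \<in> Q \<Longrightarrow> r \<in> Q \<Longrightarrow> q \<noteq> r \<Longrightarrow> N q \<inter> N r = {}" "q \<in> Q \<Longrightarrow> Z \<inter> N q = {}"
  using one_nbr by (auto simp: N_def Z_def)

lemma third: obtains s where "s \<in> Q" "s \<noteq> q" "s \<noteq> r"
proof -
  have "card {q, r} < card Q" using Q3 by (simp add: card_insert_if)
  then show thesis using ex_notin[of "{q, r}" Q] that by blast
qed

text \<open>An induced path in this set would have at most the neighbour \<open>q\<close> in
  \<open>Q\<close>, while \<open>P3_hits\<close> asks for two.\<close>

lemma P3_N:
  assumes "u \<in> Z \<union> N q" "v \<in> Z \<union> N q" "w \<in> Z \<union> N q" "q \<in> Q" "E u v" "E v w" "u \<noteq> w"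
  shows "E u w"
proof (rule ccontr)
  assume no: "\<not> E u w"
  have "{x \<in> Q. E u x \<or> E v x \<or> E w x} \<subseteq> {q}"
    using assms Z_V(2) N_other[of _ q] by blast
  then have "card {x \<in> Q. E u x \<or> E v x \<or> E w x} \<le> 1"
    using card_mono[of "{q}" "{x \<in> Q. E u x \<or> E v x \<or> E w x}"] by simp
  moreover have "u \<in> V - Q" "v \<in> V - Q" "w \<in> V - Q" using assms N_V(1) Z_V(1) by blast+
  ultimately show False using P3_hits[of u v w] assms no Q3 by simp
qed

text \<open>Otherwise the edge \<open>st\<close> has no adjacency to the path \<open>j q u\<close>,
  where \<open>j\<close> is the third vertex of the triangle.\<close>

lemma hit_edge:
  assumes u: "u \<in> N q" "q \<in> Q" and st: "s \<in> Z \<union> N r" "t \<in> Z \<union> N r" "E s t" "r \<in> Q" "q \<noteq> r"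
  shows "E u s \<or> E u t"
proof (rule ccontr)
  assume no: "\<not> (E u s \<or> E u t)"
  obtain j where j: "j \<in> Q" "j \<noteq> q" "j \<noteq> r" by (rule third)
  have v: "u \<in> V - Q" "s \<in> V - Q" "t \<in> V - Q" using u st N_V(1) Z_V(1) by blast+
  have "\<not> E s q" "\<not> E s j" "\<not> E t q" "\<not> E t j"
    using st u j Z_V(2) N_other[of _ r] by blast+
  moreover have "\<not> E j u" using N_other[OF u(1,2) j(1)] j comm by blast
  moreover have "E j q" "E q u" using Q j u N_V(2) sym by blast+
  moreover have "\<not> E s u" "\<not> E t u" using no comm by blast+
  moreover have "j \<noteq> u" using v j by blast
  ultimately show False using p23[of s t j q u] st(3) v j(1) u(2) QV by blast
qed

text \<open>Otherwise the edge \<open>st\<close> has no adjacency to the path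
  \<open>u q u'\<close>.\<close>

lemma hit_pair:
  assumes u: "u \<in> N q" "u' \<in> N q" "u \<noteq> u'" "\<not> E u u'" "q \<in> Q"
    and st: "s \<in> V - Q" "t \<in> V - Q" "\<not> E s q" "\<not> E t q" "E s t"
  shows "E s u \<or> E t u \<or> E s u' \<or> E t u'"
proof (rule ccontr)
  assume no: "\<not> ?thesis"
  have "E u q" "E q u'" "u \<in> V - Q" "u' \<in> V - Q" using u N_V sym by blast+
  then show False using p23[of s t u q u'] u st no QV by blast
qed

lemma missed_cherry:
  assumes u: "u \<in> N q" "q \<in> Q"
    and abc: "a \<in> V - Q" "b \<in> V - Q" "c \<in> V - Q" "E a b" "E b c" "a \<noteq> c" "\<not> E a q" "\<not> E b q" "\<not> E c q"
      "\<not> E a u" "\<not> E b u" "\<not> E c u"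
  shows "E a c"
proof (rule ccontr)
  assume no: "\<not> E a c"
  have "E u q" "u \<in> V - Q" using u N_V by blast+
  moreover have "\<not> E u a" "\<not> E u b" "\<not> E u c" "\<not> E q a" "\<not> E q b" "\<not> E q c" using abc comm by blast+
  ultimately show False using p23[of u q a b c] u abc no QV by blast
qed

text \<open>One end is seen by \<open>hit_edge\<close>. Seeing both would make \<open>u\<close> and
  \<open>r\<close> common neighbours of \<open>ab\<close> and hence adjacent.\<close>

lemma hit_edge_once:
  assumes u: "u \<in> N q" "q \<in> Q" and ab: "a \<in> N r" "b \<in> N r" "E a b" "r \<in> Q" "q \<noteq> r"
  shows "E u a \<longleftrightarrow> \<not> E u b"
proof -
  have "\<not> (E u a \<and> E u b)"
  proof
    assume "E u a \<and> E u b"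
    moreover have "E r a" "E r b" "{u, r, a, b} \<subseteq> V" "u \<noteq> r"
      using ab u N_V sym QV by blast+
    ultimately have "E u r" using diamond_free[of u r a b] ab by blast
    then show False using N_other u ab by blast
  qed
  then show ?thesis using hit_edge[OF u, of a r b] ab by blast
qed

text \<open>By \<open>P3_N\<close> the vertex \<open>w\<close> would see both ends of
  \<open>ab\<close>, and the excluded diamond would make it adjacent to \<open>r\<close>.\<close>

lemma Z_not_edge:
  assumes w: "w \<in> Z" and ab: "a \<in> N r" "b \<in> N r" "E a b" "r \<in> Q"
  shows "\<not> E w a"
proof
  assume wa: "E w a"
  have "w \<noteq> b" using w ab Z_V N_V by blast
  then have "E w b" using P3_N[of w r a b] w ab wa by blast
  moreover have "E r a" "E r b" using ab N_V(2) sym by blast+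
  moreover have "{w, r, a, b} \<subseteq> V" "w \<noteq> r"
    using N_V(1)[OF ab(1)] N_V(1)[OF ab(2)] Z_V(1)[OF w] ab QV by auto
  ultimately have "E w r" using diamond_free[of w r a b] ab wa by blast
  then show False using Z_V(2) w ab by blast
qed

text \<open>\<open>Z\<close> is a union of cliques. With two components that contain edges, a
  private neighbour would see both by \<open>hit_edge\<close>, and \<open>P3_N\<close> would join
  them; so there are no private neighbours. With one such component, it is a clique of at most three
  vertices and can be deleted.\<close>

lemma ex_Z_del:
  obtains "(V, E) \<in> del 3 P3_free" | D where "D \<subseteq> Z" "card D \<le> 3" "edgeless E (Z - D)"
proof (cases "edgeless E Z")
  case True
  then show thesis by (intro that(2)[of "{}"]) auto
next
  case False
  then obtain s t where st: "s \<in> Z" "t \<in> Z" "E s t" by (auto simp: edgeless_def)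
  define D where "D = {v \<in> Z. v = s \<or> E s v}"
  obtain q0 where q0: "q0 \<in> Q" using Q3 by fastforce
  have P3Z: "E u w" if "u \<in> Z" "v \<in> Z" "w \<in> Z" "E u v" "E v w" "u \<noteq> w" for u v w
    using P3_N[of u q0 v w] that q0 by blast
  show thesis
  proof (cases "edgeless E (Z - D)")
    case True
    have "card D \<le> card Q"
    proof (rule Qmax)
      show "D \<subseteq> V" unfolding D_def Z_def by blast
      fix u v assume "u \<in> D" "v \<in> D" "u \<noteq> v"
      then show "E u v" using P3Z[of u s v] st(1) comm[of u s] unfolding D_def by (cases "u = s"; cases "v = s") auto
    qed
    then show thesis using True Q3 by (intro that(2)[of D]) (auto simp: D_def)
  next
    case False
    then obtain s' t' where st': "s' \<in> Z - D" "t' \<in> Z - D" "E s' t'" by (auto simp: edgeless_def)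
    have "N q = {}" if q: "q \<in> Q" for q
    proof (rule ccontr)
      assume "N q \<noteq> {}"
      then obtain u where u: "u \<in> N q" by blast
      obtain r where r: "r \<in> Q" "r \<noteq> q" by (rule third)
      have "E u s \<or> E u t" "E u s' \<or> E u t'"
        using hit_edge[OF u q, of s r t] hit_edge[OF u q, of s' r t'] st st' r by blast+
      then obtain a a' where a: "a \<in> {s, t}" "a' \<in> {s', t'}" "E u a" "E u a'" by blast
      have "a \<in> D" "a' \<in> Z - D" using a st st' by (auto simp: D_def)
      then have "a \<noteq> a'" by blast
      then have "E a a'" using P3_N[of a q u a'] a u q sym \<open>a \<in> D\<close> \<open>a' \<in> Z - D\<close> unfolding D_def by blast
      then have "a' \<in> D" using \<open>a \<in> D\<close> \<open>a' \<in> Z - D\<close> P3Z[of s a a'] st unfolding D_def by blast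
      with \<open>a' \<in> Z - D\<close> show False by blast
    qed
    then have VZ: "V - Q = Z" by (auto simp: Z_def N_def)
    have "(V - Q, E) \<in> P3_free"
      by (rule P3_freeI) (use sgraph_subset[OF sgraph, of "V - Q"] P3Z VZ in blast)+
    then show thesis using sgraph QV Q3 by (intro that(1) delI[of _ _ Q]) auto
  qed
qed

end

section \<open>Edgeless parts around the triangle\<close>

locale dpgraph_triangle_edgeless = dpgraph_triangle +
  fixes U
  assumes UV: "U \<subseteq> V - Q" and UZ: "edgeless E (U \<inter> Z)" and UN: "\<And>q. q \<in> Q \<Longrightarrow> edgeless E (U \<inter> N q)"
begin

lemma sgU: "sgraph W E" if "W \<subseteq> U" using that UV sgraph by (blast intro: sgraph_subset)

lemma p23U: "p23free W E" if "W \<subseteq> U" using that UV p23free by (blast intro: p23free_subset)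

lemma U_cases: "u \<in> U \<Longrightarrow> (u \<in> Z \<Longrightarrow> P) \<Longrightarrow> (\<And>q. q \<in> Q \<Longrightarrow> u \<in> N q \<Longrightarrow> P) \<Longrightarrow> P"
  using UV unfolding Z_def N_def by blast

text \<open>The excluded configurations are, in this order, the edge \<open>xy\<close> with the path
  \<open>z s z'\<close>, a diamond on \<open>x\<close>, \<open>y\<close>, \<open>z\<close>,
  \<open>z'\<close>, and the edge \<open>zs\<close> with the path \<open>x y x'\<close>.\<close>

lemma tri_ax_N:
  assumes q: "q \<in> Q" "r \<in> Q" "s \<in> Q" "q \<noteq> r" "q \<noteq> s" "r \<noteq> s"
  shows "tri_ax E (U \<inter> N q) (U \<inter> N r) (U \<inter> N s)"
  unfolding tri_ax_def
proof (intro conjI ballI impI)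
  fix x y z z' assume x: "x \<in> U \<inter> N q" and y: "y \<in> U \<inter> N r" and z: "z \<in> U \<inter> N s" "z' \<in> U \<inter> N s"
    and xy: "E x y" "z \<noteq> z'"
  have no: "\<not> E z z'" using UN[OF q(3)] z by (rule edgelessD)
  show "E x z \<or> E y z \<or> E x z' \<or> E y z'"
    by (rule hit_pair[of z s z' x y]) (use x y z xy no q N_V N_other in blast)+
  show "\<not> (E x z \<and> E y z \<and> E x z' \<and> E y z')"
  proof
    assume "E x z \<and> E y z \<and> E x z' \<and> E y z'"
    then have "E z z'" using diamond_free[of z z' x y] x y z xy UV sym by blast
    with no show False by blast
  qed
next
  fix x x' y z assume x: "x \<in> U \<inter> N q" "x' \<in> U \<inter> N q" and y: "y \<in> U \<inter> N r" and z: "z \<in> U \<inter> N s"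
    and xy: "x \<noteq> x'" "E x y" "E x' y" "\<not> E y z"
  show "E x z \<or> E x' z"
  proof (rule ccontr)
    assume no: "\<not> (E x z \<or> E x' z)"
    have "x \<in> V - Q" "x' \<in> V - Q" "y \<in> V - Q" using x y N_V(1) by blast+
    moreover have "\<not> E x s" "\<not> E x' s" "\<not> E y s" using x y q N_other by blast+
    ultimately have "E x x'"
      by (intro missed_cherry[of z s x y x']) (use z xy no q comm in auto)
    then show False using edgelessD[OF UN[OF q(1)] x] by blast
  qed
qed

lemma finU: "finite (U \<inter> X)" using UV fin by (meson Diff_subset finite_Int finite_subset)

lemma tri_N:
  assumes q: "q \<in> Q" "r \<in> Q" "s \<in> Q" "q \<noteq> r" "q \<noteq> s" "r \<noteq> s"
  shows "tri E (U \<inter> N q) (U \<inter> N r) (U \<inter> N s)"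
  unfolding tri_def using finU UN tri_ax_N q sgraph by (auto simp: sgraph_def)

text \<open>Together with \<open>N_nbr_unique\<close> this makes the edges between \<open>Z\<close>
  and each part a matching.\<close>

lemma Z_nbr_unique:
  assumes "w \<in> U \<inter> Z" "u \<in> U \<inter> N q" "u' \<in> U \<inter> N q" "q \<in> Q" "E w u" "E w u'"
  shows "u = u'"
proof (rule ccontr)
  assume "u \<noteq> u'"
  then have "E u u'" using P3_N[of u q w u'] assms sym by blast
  then show False using edgelessD[OF UN[OF assms(4)] assms(2,3)] by blast
qed

lemma N_nbr_unique:
  assumes "w \<in> U \<inter> Z" "w' \<in> U \<inter> Z" "u \<in> U \<inter> N q" "q \<in> Q" "E w u" "E w' u"
  shows "w = w'"
proof (rule ccontr)
  assume "w \<noteq> w'"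
  then have "E w w'" using P3_N[of w q u w'] assms sym by blast
  then show False using edgelessD[OF UZ assms(1,2)] by blast
qed

lemma hit_Z_edge:
  assumes "w \<in> U \<inter> Z" "u \<in> U \<inter> N q" "E w u" "v \<in> U \<inter> N r" "q \<in> Q" "r \<in> Q" "q \<noteq> r"
  shows "E v w \<or> E v u"
  using hit_edge[of v r w q u] assms by blast

text \<open>A vertex of \<open>Z\<close> and its partners form a column of at most three vertices;
  column 0, kept free by \<open>Suc\<close>, collects the unmatched vertices of both parts and is
  bipartite. If \<open>u\<close> and \<open>v\<close> from different parts are not adjacent,
  \<open>hit_Z_edge\<close> makes them see the same vertices of \<open>Z\<close>, so they lie in the
  same column.\<close>

lemma two_parts_Columns:
  assumes q: "q \<in> Q" "r \<in> Q" "q \<noteq> r"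
  shows "(U \<inter> Z \<union> U \<inter> N q \<union> U \<inter> N r, E) \<in> Columns"
proof -
  let ?U = "U \<inter> Z \<union> U \<inter> N q \<union> U \<inter> N r"
  obtain e :: "'a \<Rightarrow> nat" where e: "inj_on e V" using ex_enum[OF fin] by metis
  define p where "p v = (if v \<in> Z then Suc (e v) else if \<exists>w \<in> U \<inter> Z. E w v
    then Suc (e (THE w. w \<in> U \<inter> Z \<and> E w v)) else 0)" for v
  have ZN: "v \<notin> Z" if "v \<in> N q \<union> N r" for v using that q N_V Z_V(2) by blast
  have pu: "p v = Suc (e w)" if "w \<in> U \<inter> Z" "v \<in> U \<inter> (N q \<union> N r)" "E w v" for v w
  proof -
    have "(THE w. w \<in> U \<inter> Z \<and> E w v) = w"
      by (rule the_equality) (use that N_nbr_unique q in blast)+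
    then show ?thesis using that ZN[of v] by (auto simp: p_def)
  qed
  have pw: "p w = Suc (e w)" if "w \<in> Z" for w using that by (simp add: p_def)
  show ?thesis
  proof (rule ColumnsI[where p = p and Z = "U \<inter> Z" and A = "U \<inter> N q" and B = "U \<inter> N r"])
    show "sgraph ?U E" by (rule sgU) blast
    show "edgeless E (U \<inter> Z)" "edgeless E (U \<inter> N q)" "edgeless E (U \<inter> N r)" using UZ UN q by auto
  next
    fix u v assume uv: "u \<in> U \<inter> N q" "v \<in> U \<inter> N r" "p u \<noteq> p v"
    show "E u v"
    proof (rule ccontr)
      assume no: "\<not> E u v"
      have "p u = p v" if w: "w \<in> U \<inter> Z" "E w u \<or> E w v" for w
      proof -
        have "E w u \<and> E w v" using hit_Z_edge[of w u q v r] hit_Z_edge[of w v r u q] w uv q no sym by blast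
        then show ?thesis using pu[of w u] pu[of w v] w uv by simp
      qed
      then have "\<not> (\<exists>w \<in> U \<inter> Z. E w u)" "\<not> (\<exists>w \<in> U \<inter> Z. E w v)" using uv by blast+
      then have "p u = p v" using ZN[of u] ZN[of v] uv by (simp add: p_def)
      with uv show False by blast
    qed
  next
    fix z u assume "z \<in> U \<inter> Z" "u \<in> U \<inter> N q \<union> U \<inter> N r" "p z \<noteq> p u"
    then show "\<not> E z u" using pu[of z u] pw[of z] by auto
  next
    fix x assume x: "x \<in> ?U"
    let ?P = "{v \<in> ?U. p v = p x}"
    have g: "sgraph ?P E" by (rule sgU) blast
    show "(?P, E) \<in> Bip \<union> del 3 Edgeless"
    proof (cases "p x = 0")
      case True
      have "?P \<subseteq> U \<inter> N q \<union> U \<inter> N r" using pw True by force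
      moreover have "p23free ?P E" by (rule p23U) blast
      ultimately have "(?P, E) \<in> Bip" using g UN q by (intro BipI)
      then show ?thesis by blast
    next
      case False
      obtain w where w: "w \<in> U \<inter> Z" "p x = Suc (e w)"
      proof (cases "x \<in> Z")
        case True
        then show thesis using that[of x] x pw ZN by blast
      next
        case xZ: False
        then obtain w where "w \<in> U \<inter> Z" "E w x" using False by (auto simp: p_def split: if_splits)
        then show thesis using that[of w] pu[of w x] x xZ by blast
      qed
      have V: "w' = w" if "w' \<in> U \<inter> Z" "e w' = e w" for w'
        using that w e UV by (auto dest!: inj_onD)
      have ad: "E w v" if v: "v \<in> ?P" "v \<in> N q \<union> N r" for v
      proof -
        have "p v = Suc (e w)" using v w by simp
        then obtain w' where w': "w' \<in> U \<inter> Z" "E w' v" using ZN[OF v(2)] by (auto simp: p_def split: if_splits)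
        then have "p v = Suc (e w')" using pu[of w' v] v by blast
        with \<open>p v = Suc (e w)\<close> have "w' = w" using V w' by simp
        with w' show ?thesis by simp
      qed
      have "?P \<inter> Z \<subseteq> {w}" using V pw w by auto
      moreover have "card (?P \<inter> N q) \<le> 1"
        by (rule card_le1I, rule Z_nbr_unique[OF w(1) _ _ q(1)]) (use ad in auto)
      moreover have "card (?P \<inter> N r) \<le> 1"
        by (rule card_le1I, rule Z_nbr_unique[OF w(1) _ _ q(2)]) (use ad in auto)
      moreover have "?P = ?P \<inter> Z \<union> ?P \<inter> N q \<union> ?P \<inter> N r" by blast
      then have "card ?P = card (?P \<inter> Z \<union> ?P \<inter> N q \<union> ?P \<inter> N r)" by (rule arg_cong)
      moreover have "card (?P \<inter> Z) \<le> card {w}" by (rule card_mono) (use \<open>?P \<inter> Z \<subseteq> {w}\<close> in auto)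
      ultimately have "card ?P \<le> 3"
        using card_Un3_le[of "?P \<inter> Z" "?P \<inter> N q" "?P \<inter> N r"] by simp
      then show ?thesis using small_del_Edgeless[OF g] by blast
    qed
  qed blast
qed

definition M where "M q = {u \<in> U \<inter> N q. \<exists>w \<in> U \<inter> Z. E w u}"

text \<open>A matched \<open>u\<close> cannot miss two matched vertices of the other part, as its
  partner would see both. So some edge \<open>uy\<close> joins matched vertices with partners
  \<open>w\<close> and \<open>w'\<close>. By \<open>hit_Z_edge\<close> every vertex of the third
  part sees \<open>w\<close>, or \<open>w'\<close>, or both \<open>u\<close> and \<open>y\<close>,
  and each of these happens at most once.\<close>

lemma matched_two_parts:
  assumes q: "q \<in> Q" "r \<in> Q" "s \<in> Q" "q \<noteq> r" "q \<noteq> s" "r \<noteq> s"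
    and M: "3 \<le> card (M q)" "3 \<le> card (M r)"
  shows "card (U \<inter> N s) \<le> 3"
proof -
  have "2 \<le> card (M q)" "2 \<le> card (M r)" using M by auto
  then obtain u v v' where uv: "u \<in> M q" "v \<in> M r" "v' \<in> M r" "v \<noteq> v'" by (metis card_two)
  obtain w where w: "w \<in> U \<inter> Z" "E w u" "u \<in> U \<inter> N q" using uv by (auto simp: M_def)
  have vN: "v \<in> U \<inter> N r" "v' \<in> U \<inter> N r" using uv by (auto simp: M_def)
  have "E u v \<or> E u v'"
  proof (rule ccontr)
    assume "\<not> (E u v \<or> E u v')"
    then have "E w v" "E w v'" using hit_Z_edge[of w u q _ r] w vN q sym by blast+
    then show False using Z_nbr_unique[OF w(1) vN q(2)] uv by blast
  qed
  then obtain y where y: "y \<in> M r" "E u y" using uv by blast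
  then obtain w' where w': "w' \<in> U \<inter> Z" "E w' y" "y \<in> U \<inter> N r" by (auto simp: M_def)
  let ?X = "{z \<in> U \<inter> N s. E w z}" and ?Y = "{z \<in> U \<inter> N s. E w' z}" and ?T = "{z \<in> U \<inter> N s. E u z \<and> E y z}"
  have "card ?X \<le> 1" by (rule card_le1I, rule Z_nbr_unique[OF w(1) _ _ q(3)]) auto
  moreover have "card ?Y \<le> 1" by (rule card_le1I, rule Z_nbr_unique[OF w'(1) _ _ q(3)]) auto
  moreover have "card ?T \<le> 1"
    by (rule card_le1I, rule tri_both[OF tri_N[OF q] w(3) w'(3) y(2)]) auto
  moreover have "U \<inter> N s \<subseteq> ?X \<union> ?Y \<union> ?T"
    using hit_Z_edge[of w u q _ s] hit_Z_edge[of w' y r _ s] w w' q comm by blast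
  then have "card (U \<inter> N s) \<le> card (?X \<union> ?Y \<union> ?T)"
    by (rule card_mono[rotated]) (blast intro: finite_subset[OF _ finU[of "N s"]])
  ultimately show ?thesis using card_Un3_le[of ?X ?Y ?T] by linarith
qed

text \<open>The cases count the parts with at least three vertices matched into \<open>Z\<close>.
  With two, the third part is small. With one, the other two parts and \<open>Z\<close> form one
  side after a bounded deletion. With none, deleting the at most six matched vertices cuts
  \<open>Z\<close> off and \<open>tri_del_bip\<close> applies, at a cost of 34 + 6.\<close>

lemma edgeless_parts: "(U, E) \<in> del 50 (Bip \<union> Columns)"
proof -
  obtain q where q: "q \<in> Q" using Q3 by fastforce
  obtain r where r: "r \<in> Q" "r \<noteq> q" by (rule third)
  obtain s where s: "s \<in> Q" "s \<noteq> q" "s \<noteq> r" by (rule third)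
  have "card {q, r, s} = card Q" using r s Q3 by (simp add: card_insert_if)
  then have Qeq: "Q = {q, r, s}" using card_subset_eq[of Q "{q, r, s}"] finQ q r s by simp
  have g: "sgraph U E" by (rule sgU) blast
  have MN: "M a \<subseteq> U \<inter> N a" for a by (auto simp: M_def)
  have cov: "U = U \<inter> Z \<union> U \<inter> N a \<union> U \<inter> N b \<union> U \<inter> N c" if "Q = {a, b, c}" for a b c
    using that U_cases by blast
  consider (two) a b c where "Q = {a, b, c}" "a \<noteq> b" "a \<noteq> c" "b \<noteq> c" "3 \<le> card (M a)" "3 \<le> card (M b)"
    | (one) a b c where "Q = {a, b, c}" "a \<noteq> b" "a \<noteq> c" "b \<noteq> c" "3 \<le> card (M a)" "card (M b) \<le> 2" "card (M c) \<le> 2"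
    | (none) "card (M q) \<le> 2" "card (M r) \<le> 2" "card (M s) \<le> 2"
  proof -
    have perm: "Q = {r, q, s}" "Q = {s, q, r}" "Q = {q, s, r}" "Q = {r, s, q}" using Qeq by blast+
    have le: "card (M a) \<le> 2 \<or> 3 \<le> card (M a)" for a by linarith
    show thesis
      using le[of q] le[of r] le[of s] two[of q r s] two[of q s r] two[of r s q]
        one[of q r s] one[of r q s] one[of s q r] none Qeq perm r s by metis
  qed
  then show ?thesis
  proof cases
    case two
    then have abc: "a \<in> Q" "b \<in> Q" "c \<in> Q" by auto
    have "card (U \<inter> N c) \<le> 3" using matched_two_parts abc two by blast
    moreover have "(U - U \<inter> N c, E) \<in> Columns"
    proof -
      have "c \<noteq> a" "c \<noteq> b" using two by auto
      then have "N a \<inter> N c = {}" "N b \<inter> N c = {}" "Z \<inter> N c = {}"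
        using abc N_disjoint by auto
      then have "U - U \<inter> N c = U \<inter> Z \<union> U \<inter> N a \<union> U \<inter> N b"
        using cov[OF two(1)] by blast
      then show ?thesis using two_parts_Columns[OF abc(1,2) two(2)] by simp
    qed
    ultimately show ?thesis using g by (intro delI[of _ _ "U \<inter> N c"]) auto
  next
    case one
    then have abc: "a \<in> Q" "b \<in> Q" "c \<in> Q" by auto
    have "2 \<le> card (M a)" using one by simp
    then obtain u u' where u: "u \<in> M a" "u' \<in> M a" "u \<noteq> u'" by (rule card_two)
    obtain w w' where w: "w \<in> U \<inter> Z" "E w u" "w' \<in> U \<inter> Z" "E w' u'" "u \<in> U \<inter> N a" "u' \<in> U \<inter> N a"
      using u by (auto simp: M_def)
    have c1: "card {v \<in> U \<inter> N x. E w v} \<le> 1" if "x \<in> Q" for x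
      by (rule card_le1I, rule Z_nbr_unique[OF w(1) _ _ that]) auto
    have c2: "card {v \<in> U \<inter> N x. E w' v} \<le> 1" if "x \<in> Q" for x
      by (rule card_le1I, rule Z_nbr_unique[OF w(3) _ _ that]) auto
    let ?S = "({v \<in> U \<inter> N b. E w v} \<union> {v \<in> U \<inter> N c. E w v}) \<union> ({v \<in> U \<inter> N b. E w' v} \<union> {v \<in> U \<inter> N c. E w' v}) \<union> (M b \<union> M c)"
    have "card ?S \<le> (card {v \<in> U \<inter> N b. E w v} + card {v \<in> U \<inter> N c. E w v})
        + (card {v \<in> U \<inter> N b. E w' v} + card {v \<in> U \<inter> N c. E w' v}) + (card (M b) + card (M c))"
      by (rule order_trans[OF card_Un3_le]) (intro add_mono card_Un_le)
    then have cS: "card ?S \<le> 50" using c1[OF abc(2)] c1[OF abc(3)] c2[OF abc(2)] c2[OF abc(3)] one by linarith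
    \<comment> \<open>By \<open>hit_Z_edge\<close> the remaining vertices, which miss
      \<open>w\<close> and \<open>w'\<close>, see both \<open>u\<close> and \<open>u'\<close>; an
      edge between them would have two common neighbours in one part, against
      \<open>tri_both\<close>.\<close>
    have bc: "\<not> E x y" if x: "x \<in> U \<inter> N b - ?S" and y: "y \<in> U \<inter> N c - ?S" for x y
    proof
      assume xy: "E x y"
      have "\<not> E x w" "\<not> E y w" "\<not> E x w'" "\<not> E y w'" using x y comm by blast+
      then have "E x u" "E y u" "E x u'" "E y u'"
        using hit_Z_edge[of w u a _ b] hit_Z_edge[of w u a _ c] hit_Z_edge[of w' u' a _ b] hit_Z_edge[of w' u' a _ c]
          w x y abc one by blast+
      then have "u = u'"
        using tri_both[OF tri_N[of b c a] _ _ xy w(5,6)] x y abc one by blast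
      with u show False by blast
    qed
    have "edgeless E ((U \<inter> Z \<union> U \<inter> N b \<union> U \<inter> N c) - ?S)"
      unfolding edgeless_def
    proof (intro ballI notI)
      fix x y assume x: "x \<in> (U \<inter> Z \<union> U \<inter> N b \<union> U \<inter> N c) - ?S" and y: "y \<in> (U \<inter> Z \<union> U \<inter> N b \<union> U \<inter> N c) - ?S"
        and xy: "E x y"
      have zn: "\<not> E z v" if "z \<in> U \<inter> Z" "v \<in> (U \<inter> N b \<union> U \<inter> N c) - ?S" for z v
        using that unfolding M_def by blast
      have "x \<notin> U \<inter> Z" using zn[of x y] xy edgelessD[OF UZ, of x y] y by blast
      moreover have "y \<notin> U \<inter> Z" using zn[of y x] xy edgelessD[OF UZ, of x y] x sym by blast
      ultimately show False
        using x y xy bc[of x y] bc[of y x] sym edgelessD[OF UN[OF abc(2)], of x y] edgelessD[OF UN[OF abc(3)], of x y]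
        by blast
    qed
    moreover have "?S \<subseteq> U" using MN by blast
    moreover have "U - ?S \<subseteq> U \<inter> N a \<union> ((U \<inter> Z \<union> U \<inter> N b \<union> U \<inter> N c) - ?S)"
      using cov[OF one(1)] by blast
    ultimately have "del_bip E U 50" using cS UN[OF abc(1)] by (intro del_bipI[of ?S])
    then show ?thesis by (intro del_mono[OF del_bip_Bip[OF g p23U[OF order_refl]]]) auto
  next
    case none
    let ?T = "U \<inter> N q \<union> U \<inter> N r \<union> U \<inter> N s"
    have "tri E (U \<inter> N q) (U \<inter> N r) (U \<inter> N s)" using tri_N q r s by blast
    then obtain S P where S: "S \<subseteq> ?T" "card S \<le> 34" "P \<subseteq> ?T - S" "edgeless E P" "edgeless E (?T - S - P)"
      using tri_del_bip unfolding del_bip_def by metis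
    let ?S = "S \<union> (M q \<union> M r \<union> M s)"
    have "card ?S \<le> card S + card (M q \<union> M r \<union> M s)" by (rule card_Un_le)
    then have cS: "card ?S \<le> 50" using S(2) none card_Un3_le[of "M q" "M r" "M s"] by linarith
    have zn: "\<not> E z v" if "z \<in> U \<inter> Z" "v \<in> ?T - ?S" for z v using that unfolding M_def by blast
    have "edgeless E ((P \<union> U \<inter> Z) - ?S)"
      unfolding edgeless_def
    proof (intro ballI notI)
      fix x y assume x: "x \<in> (P \<union> U \<inter> Z) - ?S" and y: "y \<in> (P \<union> U \<inter> Z) - ?S" and xy: "E x y"
      have 1: "\<not> (x \<in> P \<and> y \<in> P)" using xy edgelessD[OF S(4)] by blast
      have 2: "\<not> (x \<in> U \<inter> Z \<and> y \<in> U \<inter> Z)" using xy edgelessD[OF UZ] by blast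
      have 3: "v \<in> ?T - ?S" if "v \<in> P" "v \<notin> ?S" for v using that S(3) by blast
      show False using 1 2 3[of x] 3[of y] x y xy zn[of x y] zn[of y x] sym by blast
    qed
    moreover have "?S \<subseteq> U" using MN S(1) by blast
    moreover have "U - ?S \<subseteq> ((P \<union> U \<inter> Z) - ?S) \<union> (?T - S - P)" using cov[OF Qeq] by blast
    ultimately have "del_bip E U 50" using cS S(5) by (intro del_bipI[of ?S])
    then show ?thesis by (intro del_mono[OF del_bip_Bip[OF g p23U[OF order_refl]]]) auto
  qed
qed

end

text \<open>By \<open>hit_edge_once\<close>, the two ends of an edge inside a part have complementary neighbourhoods in
  the other two parts, so one end can be folded onto the other. A colour is the number of the part
  (0 for the vertices without neighbours in the triangle) and whether the vertex is a representative.\<close>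

definition Folded :: "'v graph set" where
  "Folded = folded (\<lambda>(i, s) (j, t) b. if i = j \<or> i = 0 \<or> j = 0 then b \<and> s \<and> t else b \<noteq> (s \<noteq> t))
    ({..<4 :: nat} \<times> UNIV) (del 50 (Bip \<union> Columns)) (del 2 Edgeless)"

lemma foldedI:
  assumes "sgraph V E" "\<And>v. v \<in> V \<Longrightarrow> col v \<in> C" "(\<rho> ` V, E) \<in> Y"
    "\<And>r. r \<in> \<rho> ` V \<Longrightarrow> ({v \<in> V. \<rho> v = r}, E) \<in> Z"
    "\<And>u v. u \<in> V \<Longrightarrow> v \<in> V \<Longrightarrow> \<rho> u \<noteq> \<rho> v \<Longrightarrow> E u v \<longleftrightarrow> K (col u) (col v) (E (\<rho> u) (\<rho> v))"
  shows "(V, E) \<in> folded K C Y Z"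
  unfolding folded_def mem_Collect_eq case_prod_conv
  by (intro conjI exI[of _ \<rho>] exI[of _ col] ballI impI) (use assms in auto)

section \<open>Folding the edges inside the parts\<close>

context dpgraph_triangle
begin

text \<open>The classes \<open>cl\<close> inside a part are cliques of at most two vertices, since
  adding the triangle vertex of the part gives a clique of at most three. The bound 6 is the
  triangle and the at most three vertices \<open>D\<close> whose deletion makes \<open>Z\<close>
  edgeless.\<close>

lemma clique_3: "(V, E) \<in> del 3 P3_free \<union> del 6 Folded"
proof (rule ex_Z_del)
  assume "(V, E) \<in> del 3 P3_free"
  then show ?thesis by blast
next
  fix D assume D: "D \<subseteq> Z" "card D \<le> 3" "edgeless E (Z - D)"
  define U where "U = V - (Q \<union> D)"
  have g: "sgraph U E" using sgraph by (rule sgraph_subset) (auto simp: U_def)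
  have UV: "U \<subseteq> V - Q" by (auto simp: U_def)
  obtain x1 where x1: "x1 \<in> Q" using Q3 by fastforce
  obtain x2 where x2: "x2 \<in> Q" "x2 \<noteq> x1" by (rule third)
  obtain x3 where x3: "x3 \<in> Q" "x3 \<noteq> x1" "x3 \<noteq> x2" by (rule third)
  have "card {x1, x2, x3} = card Q" using x2 x3 Q3 by (simp add: card_insert_if)
  then have Qeq: "Q = {x1, x2, x3}" using card_subset_eq[of Q "{x1, x2, x3}"] finQ x1 x2 x3 by simp
  have U_cases: "u \<in> Z \<or> (\<exists>q \<in> Q. u \<in> N q)" if "u \<in> U" for u
    using that unfolding U_def Z_def N_def by blast
  obtain e :: "'a \<Rightarrow> nat" where e: "inj_on e V" using ex_enum[OF fin] by metis
  define cl where "cl v = {w \<in> U. w = v \<or> E v w \<and> (\<exists>q \<in> Q. v \<in> N q \<and> w \<in> N q)}" for v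
  define \<rho> where "\<rho> v = arg_min e (\<lambda>w. w \<in> cl v)" for v
  have self: "v \<in> cl v" if "v \<in> U" for v using that by (simp add: cl_def)
  have \<rho>cl: "\<rho> v \<in> cl v" if "v \<in> U" for v
    unfolding \<rho>_def using arg_min_nat_lemma[of "\<lambda>w. w \<in> cl v" v e, OF self[OF that]] by blast
  have clU: "cl v \<subseteq> U" for v by (auto simp: cl_def)
  have cl_sym: "v \<in> cl w" if "v \<in> U" "w \<in> cl v" for v w using that comm[of v w] by (auto simp: cl_def)
  have cl_sub: "cl v \<subseteq> cl w" if vw: "v \<in> U" "w \<in> cl v" for v w
  proof
    fix x assume x: "x \<in> cl v"
    consider "w = v" | "x = v" | "x = w" | q r where "E v w" "q \<in> Q" "v \<in> N q" "w \<in> N q" "E v x" "r \<in> Q" "v \<in> N r" "x \<in> N r" "x \<noteq> w"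
      using vw x unfolding cl_def by blast
    then show "x \<in> cl w"
    proof cases
      case 1 then show ?thesis using x by simp
    next
      case 2 then show ?thesis using cl_sym vw by simp
    next
      case 3 then show ?thesis using self clU vw by blast
    next
      case 4
      then have "r = q" using N_disjoint(1)[of r q] by blast
      then have "E w x" using P3_N[of w q v x] 4 comm by blast
      then show ?thesis using 4 \<open>r = q\<close> x clU unfolding cl_def by blast
    qed
  qed
  have cl_eq: "cl w = cl v" if "v \<in> U" "w \<in> cl v" for v w
    using cl_sub[OF that] cl_sub[of w v] cl_sym[OF that] clU that by blast
  have \<rho>_eq: "\<rho> w = \<rho> v" if "v \<in> U" "w \<in> cl v" for v w
    unfolding \<rho>_def cl_eq[OF that] ..
  have \<rho>U: "\<rho> v \<in> U" if "v \<in> U" for v using \<rho>cl[OF that] clU by blast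
  have idem: "\<rho> (\<rho> v) = \<rho> v" if "v \<in> U" for v using \<rho>_eq \<rho>cl that by blast
  have inv: "v \<in> cl u" if "u \<in> U" "v \<in> U" "\<rho> u = \<rho> v" for u v
  proof -
    have "cl u = cl v"
      using cl_eq[OF that(1) \<rho>cl[OF that(1)]] cl_eq[OF that(2) \<rho>cl[OF that(2)]] that(3) by simp
    with self[OF that(2)] show ?thesis by blast
  qed
  have Z\<rho>: "\<rho> u = u" if "u \<in> U" "u \<in> Z" for u
    using \<rho>cl[OF that(1)] that N_disjoint(2) unfolding cl_def by blast
  have N\<rho>: "\<rho> u \<in> N q" if "u \<in> U" "u \<in> N q" "q \<in> Q" for u q
  proof -
    have "\<rho> u = u \<or> (\<exists>r \<in> Q. u \<in> N r \<and> \<rho> u \<in> N r)" using \<rho>cl[OF that(1)] unfolding cl_def by blast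
    then show ?thesis
    proof
      assume "\<rho> u = u"
      with that show ?thesis by simp
    next
      assume "\<exists>r \<in> Q. u \<in> N r \<and> \<rho> u \<in> N r"
      then obtain r where "r \<in> Q" "u \<in> N r" "\<rho> u \<in> N r" by blast
      moreover from this have "r = q" using N_disjoint(1)[of r q] that by blast
      ultimately show ?thesis by simp
    qed
  qed
  have E\<rho>: "E u (\<rho> u)" if "u \<in> U" "\<rho> u \<noteq> u" for u using \<rho>cl[OF that(1)] that unfolding cl_def by blast
  have same: "\<not> E u v" if "u \<in> U" "v \<in> U" "\<rho> u \<noteq> \<rho> v" "u \<in> N q" "v \<in> N q" "q \<in> Q" for u v q
    using \<rho>_eq[OF that(1), of v] that unfolding cl_def by auto
  have ZZ: "\<not> E u v" if "u \<in> U" "v \<in> U" "u \<in> Z" "v \<in> Z" for u v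
    using edgelessD[OF D(3), of u v] that unfolding U_def by blast
  have ZN: "E u v \<longleftrightarrow> E (\<rho> u) (\<rho> v) \<and> \<rho> u = u \<and> \<rho> v = v" if "u \<in> U" "v \<in> U" "u \<in> Z" "v \<in> N q" "q \<in> Q" for u v q
  proof (cases "\<rho> v = v")
    case True
    then show ?thesis using Z\<rho> that by simp
  next
    case False
    then have "\<not> E u v" using Z_not_edge[OF that(3,4) N\<rho>[OF that(2,4,5)] E\<rho>[OF that(2) False] that(5)] by blast
    with False show ?thesis by blast
  qed
  \<comment> \<open>If they differ, \<open>v\<close> and its representative are the ends of an edge
    inside \<open>N r\<close>, and \<open>u\<close> sees exactly one of them.\<close>
  have flip: "E u v \<longleftrightarrow> (E u (\<rho> v) \<noteq> (\<rho> v \<noteq> v))" if "v \<in> U" "u \<in> N q" "v \<in> N r" "q \<in> Q" "r \<in> Q" "q \<noteq> r" for u v q r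
  proof (cases "\<rho> v = v")
    case False
    then show ?thesis using hit_edge_once[OF that(2,4,3) N\<rho>[OF that(1,3,5)] E\<rho>[OF that(1) False] that(5,6)] by blast
  qed simp
  have NN: "E u v \<longleftrightarrow> (E (\<rho> u) (\<rho> v) \<noteq> ((\<rho> u = u) \<noteq> (\<rho> v = v)))"
    if a: "u \<in> U" "v \<in> U" "u \<in> N q" "v \<in> N r" "q \<in> Q" "r \<in> Q" "q \<noteq> r" for u v q r
  proof -
    have "E u v \<longleftrightarrow> (E u (\<rho> v) \<noteq> (\<rho> v \<noteq> v))" by (rule flip[OF a(2-7)])
    moreover have "E (\<rho> v) u \<longleftrightarrow> (E (\<rho> v) (\<rho> u) \<noteq> (\<rho> u \<noteq> u))"
      by (rule flip[OF a(1) N\<rho>[OF a(2,4,6)] a(3,6,5)]) (use a in auto)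
    ultimately show ?thesis using comm[of u "\<rho> v"] comm[of "\<rho> u" "\<rho> v"] by blast
  qed
  define part :: "'a \<Rightarrow> nat" where "part v = (if v \<in> Z then 0 else if v \<in> N x1 then 1 else if v \<in> N x2 then 2 else 3)" for v
  have part: "(part v = 0 \<and> v \<in> Z) \<or> (part v = 1 \<and> v \<in> N x1) \<or> (part v = 2 \<and> v \<in> N x2) \<or> (part v = 3 \<and> v \<in> N x3)"
    if "v \<in> U" for v using U_cases[OF that] Qeq by (auto simp: part_def)
  have "(U, E) \<in> Folded"
    unfolding Folded_def
  proof (rule foldedI[where \<rho> = \<rho> and col = "\<lambda>v. (part v, \<rho> v = v)", OF g])
    fix v assume "v \<in> U"
    show "(part v, \<rho> v = v) \<in> {..<4} \<times> UNIV" by (simp add: part_def)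
  next
    interpret R: dpgraph_triangle_edgeless V E Q "\<rho> ` U"
    proof
      show "\<rho> ` U \<subseteq> V - Q" using \<rho>U UV by blast
      show "edgeless E (\<rho> ` U \<inter> Z)" using D(3) by (rule edgeless_subset) (use \<rho>U in \<open>auto simp: U_def\<close>)
      fix q assume q: "q \<in> Q"
      show "edgeless E (\<rho> ` U \<inter> N q)"
        unfolding edgeless_def
      proof (intro ballI notI)
        fix u v assume u: "u \<in> \<rho> ` U \<inter> N q" and v: "v \<in> \<rho> ` U \<inter> N q" and "E u v"
        then have "u \<in> U" "v \<in> U" "\<rho> u = u" "\<rho> v = v" using \<rho>U idem by auto
        moreover have "u \<noteq> v" using \<open>E u v\<close> irrefl by blast
        ultimately show False using same[of u v q] u v q \<open>E u v\<close> by auto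
      qed
    qed
    show "(\<rho> ` U, E) \<in> del 50 (Bip \<union> Columns)" by (rule R.edgeless_parts)
  next
    fix r assume "r \<in> \<rho> ` U"
    then have r: "r \<in> U" "\<rho> r = r" using \<rho>U idem by auto
    let ?F = "{v \<in> U. \<rho> v = r}"
    have sub: "?F \<subseteq> cl r" using inv[OF r(1)] r(2) by auto
    have gF: "sgraph ?F E" using g by (rule sgraph_subset) blast
    have fF: "finite (cl r)" using clU UV fin by (meson Diff_subset finite_subset)
    have "card (cl r) \<le> 2"
    proof (cases "r \<in> Z")
      case True
      then have "cl r \<subseteq> {r}" using N_disjoint(2) unfolding cl_def by blast
      then have "card (cl r) \<le> card {r}" by (rule card_mono[rotated]) simp
      then show ?thesis by simp
    next
      case False
      then obtain q where q: "q \<in> Q" "r \<in> N q" using U_cases r by blast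
      have clN: "x \<in> N q" if "x \<in> cl r" for x using that q N_disjoint(1)[of _ q] unfolding cl_def by blast
      have "card (insert q (cl r)) \<le> card Q"
      proof (rule Qmax)
        show "insert q (cl r) \<subseteq> V" using clU UV q QV by blast
        fix x y assume xy: "x \<in> insert q (cl r)" "y \<in> insert q (cl r)" "x \<noteq> y"
        have "E x q" if "x \<in> cl r" for x using clN[OF that] N_V(2) by blast
        moreover have "E x y" if "x \<in> cl r" "y \<in> cl r"
        proof -
          have "y \<in> cl x" using that cl_eq[OF r(1) that(1)] by simp
          then show ?thesis using xy unfolding cl_def by blast
        qed
        ultimately show "E x y" using xy comm by auto
      qed
      moreover have "q \<notin> cl r" using clU UV q by blast
      ultimately show ?thesis using Q3 fF by simp
    qed
    then have "card ?F \<le> 2" using card_mono[OF fF sub] by simp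
    then show "(?F, E) \<in> del 2 Edgeless" by (rule small_del_Edgeless[OF gF])
  next
    fix u v assume uv: "u \<in> U" "v \<in> U" "\<rho> u \<noteq> \<rho> v"
    let ?K = "\<lambda>(i, s) (j, t) b. if i = j \<or> i = 0 \<or> j = (0 :: nat) then b \<and> s \<and> t else b \<noteq> (s \<noteq> t)"
    note comms = comm[of u v] comm[of "\<rho> u" "\<rho> v"]
    consider (eq) "part u = part v" | (l) "part u = 0" "part v \<noteq> 0" | (r) "part u \<noteq> 0" "part v = 0"
      | (ne) "part u \<noteq> 0" "part v \<noteq> 0" "part u \<noteq> part v"
      by metis
    then show "E u v \<longleftrightarrow> ?K (part u, \<rho> u = u) (part v, \<rho> v = v) (E (\<rho> u) (\<rho> v))"
    proof cases
      case eq
      then have "(u \<in> Z \<and> v \<in> Z) \<or> (\<exists>q \<in> Q. u \<in> N q \<and> v \<in> N q)" using part[OF uv(1)] part[OF uv(2)] Qeq by auto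
      then have "\<not> E u v" using ZZ[OF uv(1,2)] same[OF uv] by blast
      with \<open>part u = part v\<close> show ?thesis by auto
    next
      case l
      then obtain q where "u \<in> Z" "q \<in> Q" "v \<in> N q" using part[OF uv(1)] part[OF uv(2)] Qeq by auto
      then show ?thesis using ZN[OF uv(1,2)] l by simp
    next
      case r
      then obtain q where "v \<in> Z" "q \<in> Q" "u \<in> N q" using part[OF uv(1)] part[OF uv(2)] Qeq by auto
      then show ?thesis using ZN[OF uv(2,1)] r comms by auto
    next
      case ne
      then obtain q r where "q \<in> Q" "r \<in> Q" "q \<noteq> r" "u \<in> N q" "v \<in> N r"
        using part[OF uv(1)] part[OF uv(2)] Qeq x2 x3 by auto
      then show ?thesis using NN[OF uv(1,2)] ne by simp
    qed
  qed
  moreover have "card (Q \<union> D) \<le> 6" using card_Un_le[of Q D] D Q3 by simp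
  moreover have "Q \<union> D \<subseteq> V" using QV D Z_V(1) by blast
  ultimately have "(V, E) \<in> del 6 Folded" using sgraph unfolding U_def by (intro delI)
  then show ?thesis by blast
qed

end

section \<open>Triangle-free graphs\<close>

text \<open>Colour 5 is reserved for isolated vertices.\<close>

definition C5_blowup :: "'v graph set" where
  "C5_blowup = layered (\<lambda>c d. c < 5 \<and> d < 5 \<and> (d = (c + 1) mod 5 \<or> c = (d + 1) mod 5)) {..<6 :: nat} Single"

section \<open>Triangle-free graphs without an induced 5-cycle\<close>

locale tfgraph =
  fixes V :: "'v set" and E :: "'v \<Rightarrow> 'v \<Rightarrow> bool"
  assumes sgraph: "sgraph V E" and p23free: "p23free V E"
    and tf: "\<And>u v w. {u, v, w} \<subseteq> V \<Longrightarrow> E u v \<Longrightarrow> E v w \<Longrightarrow> E u w \<Longrightarrow> False"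
begin

lemma fin: "finite V" using sgraph by (simp add: sgraph_def)

lemma sym: "E u v \<Longrightarrow> E v u" using sgraph by (auto simp: sgraph_def dest: sympD)

lemma comm: "E u v = E v u" using sym by blast

lemmas p23 = p23freeD[OF p23free]

lemma edgeless_nbrs: "x \<in> V \<Longrightarrow> edgeless E {v \<in> V. E v x}"
  unfolding edgeless_def using tf comm by blast

text \<open>\<open>A\<close> and \<open>B\<close> are the neighbourhoods of the ends of a fixed edge
  \<open>xy\<close>, which misses everything in \<open>Z\<close>; so the degrees inside
  \<open>Z\<close> are at most one. A vertex in both \<open>ZA\<close> and \<open>ZB\<close>, or an
  edge inside one of them, would close an induced 5-cycle or a triangle. Hence \<open>ZB\<close> can
  join the side of \<open>A\<close> and \<open>ZA\<close> that of \<open>B\<close>, and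
  \<open>Z0\<close> is split along its matching edges.\<close>

lemma no_C5_Bip:
  assumes noC5: "\<And>z a y x b. {z, a, y, x, b} \<subseteq> V \<Longrightarrow> E z a \<Longrightarrow> E a y \<Longrightarrow> E y x \<Longrightarrow> E x b \<Longrightarrow> E b z \<Longrightarrow>
    \<not> E z y \<Longrightarrow> \<not> E z x \<Longrightarrow> \<not> E a x \<Longrightarrow> \<not> E a b \<Longrightarrow> \<not> E y b \<Longrightarrow> False"
  shows "(V, E) \<in> Bip"
proof (cases "edgeless E V")
  case True
  then show ?thesis using BipI[OF sgraph p23free, of V V] by blast
next
  case False
  then obtain x y where xy: "x \<in> V" "y \<in> V" "E x y" by (auto simp: edgeless_def)
  define A where "A = {v \<in> V. E v y}"
  define B where "B = {v \<in> V. E v x}"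
  define Z where "Z = V - (A \<union> B)"
  define ZA where "ZA = {z \<in> Z. \<exists>a \<in> A. E z a}"
  define ZB where "ZB = {z \<in> Z. \<exists>b \<in> B. E z b}"
  define Z0 where "Z0 = Z - (ZA \<union> ZB)"
  have eA: "edgeless E A" and eB: "edgeless E B" unfolding A_def B_def using edgeless_nbrs xy by auto
  have AV: "a \<in> V" "E a y" "E y a" if "a \<in> A" for a using that comm by (auto simp: A_def)
  have BV: "b \<in> V" "E b x" "E x b" if "b \<in> B" for b using that comm by (auto simp: B_def)
  have ZV: "z \<in> V" "\<not> E z x" "\<not> E z y" "\<not> E x z" "\<not> E y z" if "z \<in> Z" for z
    using that comm by (auto simp: Z_def A_def B_def)
  have yx: "E y x" using xy sym by blast
  have disj: False if z: "z \<in> ZA" "z \<in> ZB" for z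
  proof -
    obtain a b where ab: "z \<in> Z" "a \<in> A" "b \<in> B" "E z a" "E z b" using z by (auto simp: ZA_def ZB_def)
    show False
    proof (rule noC5[of z a y x b])
      show "{z, a, y, x, b} \<subseteq> V" using ab AV BV ZV xy by auto
      show "E z a" "E a y" "E y x" "E x b" using ab AV BV yx by auto
      show "E b z" using ab sym by blast
      show "\<not> E z y" "\<not> E z x" using ab ZV by auto
      show "\<not> E a x" using tf[of a x y] ab AV xy by auto
      show "\<not> E y b" using tf[of x y b] ab BV xy by auto
      show "\<not> E a b" using tf[of z a b] ab AV BV ZV by auto
    qed
  qed
  have uniq: "u = v" if "z \<in> Z" "u \<in> Z" "v \<in> Z" "E z u" "E z v" for z u v
  proof (rule ccontr)
    assume "u \<noteq> v"
    have "E u z" "\<not> E u v" using tf[of z u v] that ZV(1) sym by auto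
    then show False using p23[of x y u z v] \<open>u \<noteq> v\<close> that ZV xy by auto
  qed
  have same_side: "\<not> E z z'"
    if a: "z \<in> Z" "z' \<in> Z" "E z a" "E z' a'" "a \<in> V" "a' \<in> V" "E a w" "E a' w" "w \<in> {x, y}" for z z' a a' w
  proof
    assume E: "E z z'"
    have wV: "w \<in> V" using a xy by auto
    show False
    proof (rule noC5[of z a w a' z'])
      show "{z, a, w, a', z'} \<subseteq> V" using a ZV wV by auto
      show "E z a" "E a w" "E w a'" "E a' z'" "E z' z" using a E sym by auto
      show "\<not> E z w" "\<not> E w z'" using a ZV by auto
      show "\<not> E z a'" using tf[of z z' a'] a E ZV by auto
      show "\<not> E a a'" using tf[of a a' w] a wV by auto
      show "\<not> E a z'" using tf[of a z z'] a E ZV sym by auto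
    qed
  qed
  have eZA: "\<not> E z z'" if zz: "z \<in> ZA" "z' \<in> ZA" for z z'
  proof -
    obtain a a' where a: "z \<in> Z" "z' \<in> Z" "a \<in> A" "a' \<in> A" "E z a" "E z' a'" using zz by (auto simp: ZA_def)
    show ?thesis by (rule same_side[of z z' a a' y]) (use a AV in auto)
  qed
  have eZB: "\<not> E z z'" if zz: "z \<in> ZB" "z' \<in> ZB" for z z'
  proof -
    obtain b b' where b: "z \<in> Z" "z' \<in> Z" "b \<in> B" "b' \<in> B" "E z b" "E z' b'" using zz by (auto simp: ZB_def)
    show ?thesis by (rule same_side[of z z' b b' x]) (use b BV in auto)
  qed
  obtain e :: "'v \<Rightarrow> nat" where e: "inj_on e V" using ex_enum[OF fin] by metis
  \<comment> \<open>\<open>Y\<close> contains the vertices of \<open>Z0\<close> matched into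
    \<open>ZA\<close> and the lower-numbered end of each edge inside \<open>Z0\<close>.\<close>
  define Y where "Y = {z \<in> Z0. (\<exists>w \<in> ZA. E z w) \<or> (\<exists>w \<in> Z0. E z w \<and> e z < e w)}"
  have sub: "ZA \<subseteq> Z" "ZB \<subseteq> Z" "Z0 \<subseteq> Z" "Y \<subseteq> Z0" by (auto simp: ZA_def ZB_def Z0_def Y_def)
  have AZ: "\<not> E a z" if "a \<in> A" "z \<in> Z" "z \<notin> ZA" for a z using that comm by (auto simp: ZA_def)
  have BZ: "\<not> E b z" if "b \<in> B" "z \<in> Z" "z \<notin> ZB" for b z using that comm by (auto simp: ZB_def)
  have YB: "\<not> E z w" if "z \<in> Y" "w \<in> ZB" for z w
  proof
    assume E: "E z w"
    from that(1) obtain w' where w': "w' \<in> ZA \<union> Z0" "E z w'" by (auto simp: Y_def)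
    then have "w = w'" using uniq[of z w w'] E that sub by blast
    then show False using w' that disj by (auto simp: Z0_def)
  qed
  have YY: "\<not> E z z'" if "z \<in> Y" "z' \<in> Y" for z z'
  proof
    assume E: "E z z'"
    have lt: "e u < e v" if uv: "u \<in> Y" "v \<in> Y" "E u v" for u v
    proof -
      from uv(1) obtain w where w: "w \<in> ZA \<or> w \<in> Z0 \<and> e u < e w" "E u w" by (auto simp: Y_def)
      then have "v = w" using uniq[of u v w] uv sub by blast
      then show ?thesis using w uv sub by (auto simp: Z0_def)
    qed
    from lt[OF that E] lt[OF that(2,1) sym[OF E]] show False by simp
  qed
  have NY: "\<not> E z z'" if zz: "z \<in> Z0 - Y" "z' \<in> Z0 - Y" for z z'
  proof
    assume E: "E z z'"
    then have "\<not> e z < e z'" "\<not> e z' < e z" using zz sym by (auto simp: Y_def)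
    then have "e z = e z'" by simp
    then have "z = z'" using e zz sub ZV by (auto dest!: inj_onD)
    then show False using E tf[of z z z] zz sub ZV(1) by auto
  qed
  have NYA: "\<not> E z w" if "z \<in> Z0 - Y" "w \<in> ZA" for z w using that by (auto simp: Y_def)
  have "edgeless E (A \<union> ZB \<union> Y)"
    unfolding edgeless_def
  proof (intro ballI)
    fix u v assume uv: "u \<in> A \<union> ZB \<union> Y" "v \<in> A \<union> ZB \<union> Y"
    have 1: "\<not> E a z" if "a \<in> A" "z \<in> ZB \<union> Y" for a z
      using AZ[of a z] that disj sub by (auto simp: Z0_def)
    show "\<not> E u v"
      using uv edgelessD[OF eA, of u v] 1[of u v] 1[of v u] eZB[of u v] YB[of u v] YB[of v u] YY[of u v] comm[of u v] by auto
  qed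
  moreover have "edgeless E (B \<union> ZA \<union> (Z0 - Y))"
    unfolding edgeless_def
  proof (intro ballI)
    fix u v assume uv: "u \<in> B \<union> ZA \<union> (Z0 - Y)" "v \<in> B \<union> ZA \<union> (Z0 - Y)"
    have 1: "\<not> E b z" if "b \<in> B" "z \<in> ZA \<union> (Z0 - Y)" for b z
      using BZ[of b z] that disj sub by (auto simp: Z0_def)
    show "\<not> E u v"
      using uv edgelessD[OF eB, of u v] 1[of u v] 1[of v u] eZA[of u v] NYA[of u v] NYA[of v u] NY[of u v] comm[of u v] by auto
  qed
  moreover have "V \<subseteq> (A \<union> ZB \<union> Y) \<union> (B \<union> ZA \<union> (Z0 - Y))" by (auto simp: Z_def Z0_def)
  ultimately show ?thesis by (rule BipI[OF sgraph p23free])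
qed

end

section \<open>Classes of twins around a 5-cycle\<close>

lemma mod5_cases:
  assumes "i < 5" "j < (5 :: nat)"
  obtains "j = i" "\<not> (j = (i + 1) mod 5 \<or> i = (j + 1) mod 5)" | "j = (i + 1) mod 5"
    | "j = (i + 2) mod 5" "\<not> (j = (i + 1) mod 5 \<or> i = (j + 1) mod 5)"
    | "i = (j + 2) mod 5" "\<not> (j = (i + 1) mod 5 \<or> i = (j + 1) mod 5)" | "i = (j + 1) mod 5"
proof -
  have "i = 0 \<or> i = 1 \<or> i = 2 \<or> i = 3 \<or> i = 4" "j = 0 \<or> j = 1 \<or> j = 2 \<or> j = 3 \<or> j = 4"
    using assms by linarith+
  then show thesis by (elim disjE; simp add: that)
qed

text \<open>\<open>T i\<close> are the twins of the \<open>i\<close>-th vertex of an induced 5-cycle, with indices modulo 5, and \<open>Z\<close>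
  are the vertices without neighbours on the cycle.\<close>

locale c5_blowup_parts = tfgraph V E for V :: "'v set" and E +
  fixes T :: "nat \<Rightarrow> 'v set" and Z :: "'v set"
  assumes period: "T (i + 5) = T i"
    and TV: "T i \<subseteq> V" and ZV: "Z \<subseteq> V"
    and disjoint: "T i \<inter> T (i + 1) = {}" "T i \<inter> Z = {}"
    and T0: "edgeless E (T i)" and Z0: "edgeless E Z"
    and T2: "u \<in> T i \<Longrightarrow> v \<in> T (i + 2) \<Longrightarrow> \<not> E u v"
    and co1: "u \<in> T i \<Longrightarrow> v \<in> T (i + 1) \<Longrightarrow> v' \<in> T (i + 1) \<Longrightarrow> \<not> E u v \<Longrightarrow> \<not> E u v' \<Longrightarrow> v = v'"
    and co2: "u \<in> T i \<Longrightarrow> u' \<in> T i \<Longrightarrow> v \<in> T (i + 1) \<Longrightarrow> \<not> E u v \<Longrightarrow> \<not> E u' v \<Longrightarrow> u = u'"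
    and full1: "T (i + 2) \<noteq> {} \<Longrightarrow> u \<in> T i \<Longrightarrow> v \<in> T (i + 1) \<Longrightarrow> E u v"
    and full2: "T (i + 4) \<noteq> {} \<Longrightarrow> u \<in> T i \<Longrightarrow> v \<in> T (i + 1) \<Longrightarrow> E u v"
    and far: "z \<in> Z \<Longrightarrow> t \<in> T i \<Longrightarrow> E z t \<Longrightarrow> x \<in> T (i + 2) \<union> T (i + 3) \<Longrightarrow> E z x"
    and near: "z \<in> Z \<Longrightarrow> t \<in> T i \<Longrightarrow> E z t \<Longrightarrow> x \<in> T (i + 1) \<union> T (i + 4) \<Longrightarrow> \<not> E t x \<Longrightarrow> E z x"
    and big: "T i \<noteq> {} \<Longrightarrow> 3 \<le> card (T i)"
begin

lemma TV': "t \<in> T i \<Longrightarrow> t \<in> V" using TV by blast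

lemma ZV': "z \<in> Z \<Longrightarrow> z \<in> V" using ZV by blast

lemma consecutive_edge:
  assumes "t \<in> T i" "T (i + 1) \<noteq> {}" obtains x where "x \<in> T (i + 1)" "E t x"
proof -
  have "2 \<le> card (T (i + 1))" using big[OF assms(2)] by simp
  then obtain x y where "x \<in> T (i + 1)" "y \<in> T (i + 1)" "x \<noteq> y" by (rule card_two)
  then show thesis using co1[OF assms(1), of x y] that by blast
qed

lemma not_both:
  assumes z: "z \<in> Z" and full: "\<And>x. x \<in> T i \<union> T (i + 1) \<Longrightarrow> E z x" and ne: "T i \<noteq> {}"
  shows "T (i + 1) = {}"
proof (rule ccontr)
  assume ne': "T (i + 1) \<noteq> {}"
  obtain t where t: "t \<in> T i" using ne by blast
  then obtain x where "x \<in> T (i + 1)" "E t x" using consecutive_edge ne' by metis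
  then show False using tf[of z t x] t full z TV' ZV' by blast
qed

text \<open>By \<open>co1\<close> and \<open>co2\<close> the missing edges between the two classes
  form a matching. A column consists of a vertex \<open>t\<close> of \<open>T i\<close> with a
  missing edge, its mate in \<open>T (i + 1)\<close>, and the neighbours of \<open>t\<close> in
  \<open>Z\<close>, which by \<open>near\<close> also see the mate. Column 0 is the rest, where the
  two classes are completely joined.\<close>

lemma pair_Columns: "(T i \<union> T (i + 1) \<union> Z, E) \<in> Columns"
proof -
  let ?A = "T i" and ?B = "T (i + 1)"
  let ?U = "?A \<union> ?B \<union> Z"
  have disj: "?A \<inter> ?B = {}" "?A \<inter> Z = {}" "?B \<inter> Z = {}" using disjoint by auto
  have UV: "?U \<subseteq> V" using TV ZV by blast
  obtain e :: "'v \<Rightarrow> nat" where e: "inj_on e V" using ex_enum[OF fin] by metis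
  define A' where "A' = {t \<in> ?A. \<exists>x \<in> ?B. \<not> E t x}"
  define R where "R t v \<longleftrightarrow> v \<in> ?A \<and> v = t \<or> v \<in> ?B \<and> \<not> E t v \<or> v \<in> Z \<and> E t v" for t v
  define p where "p v = (if \<exists>t \<in> A'. R t v then Suc (e (THE t. t \<in> A' \<and> R t v)) else 0)" for v
  have A'A: "t \<in> ?A" if "t \<in> A'" for t using that by (simp add: A'_def)
  have Zboth: "E z x" if "z \<in> Z" "t \<in> ?A" "x \<in> ?B" "\<not> E t x" "E z t" for z t x
    by (rule near[OF that(1,2,5) _ that(4)]) (use that in blast)
  have Zboth': "E z t" if "z \<in> Z" "t \<in> ?A" "x \<in> ?B" "\<not> E t x" "E z x" for z t x
    by (rule near[OF that(1,3,5)]) (use that period[of i] comm in \<open>auto simp: eval_nat_numeral\<close>)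
  have Ztri: "\<not> (E z u \<and> E z x)" if "z \<in> Z" "u \<in> ?A" "x \<in> ?B" "E u x" for z u x
    using tf[of z u x] that UV by blast
  \<comment> \<open>A vertex of \<open>Z\<close> that sees \<open>t\<close> and \<open>t'\<close>
    also sees the mate \<open>x\<close> of \<open>t\<close>. Without triangles \<open>t'\<close>
    misses \<open>x\<close>, and \<open>co2\<close> gives \<open>t = t'\<close>.\<close>
  have uniq: "t = t'" if t: "t \<in> A'" "t' \<in> A'" "R t v" "R t' v" for t t' v
  proof -
    consider "v \<in> ?A" | "v \<in> ?B" | "v \<in> Z" using t(3) by (auto simp: R_def)
    then show ?thesis
    proof cases
      case 1
      then show ?thesis using t disj by (auto simp: R_def)
    next
      case 2
      then have "\<not> E t v" "\<not> E t' v" using t disj by (auto simp: R_def)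
      then show ?thesis using co2 A'A t 2 by blast
    next
      case 3
      then have z: "E v t" "E v t'" using t disj comm by (auto simp: R_def)
      obtain x where x: "x \<in> ?B" "\<not> E t x" using t by (auto simp: A'_def)
      then have "E v x" using Zboth[OF 3 A'A[OF t(1)] x z(1)] by blast
      then have "\<not> E t' x" using Ztri[OF 3 A'A[OF t(2)] x(1)] z by blast
      then show ?thesis using co2[OF A'A[OF t(1)] A'A[OF t(2)] x(1,2)] by blast
    qed
  qed
  have pR: "p v = Suc (e t)" if "t \<in> A'" "R t v" for t v
  proof -
    have "(THE t. t \<in> A' \<and> R t v) = t" by (rule the_equality) (use that uniq in blast)+
    then show ?thesis using that by (auto simp: p_def)
  qed
  have p0: "p v = 0 \<longleftrightarrow> \<not> (\<exists>t \<in> A'. R t v)" for v by (simp add: p_def)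
  have AB: "E u v" if "u \<in> ?A" "v \<in> ?B" "p u \<noteq> p v" for u v
  proof (rule ccontr)
    assume no: "\<not> E u v"
    then have "u \<in> A'" "R u u" "R u v" using that by (auto simp: A'_def R_def)
    then show False using pR that by metis
  qed
  show ?thesis
  proof (rule ColumnsI[where p = p and Z = Z and A = ?A and B = ?B])
    show "sgraph ?U E" using sgraph UV by (rule sgraph_subset)
    show "edgeless E Z" "edgeless E ?A" "edgeless E ?B" by (rule Z0 T0)+
    show "?U \<subseteq> Z \<union> ?A \<union> ?B" by blast
  next
    fix z u assume zu: "z \<in> Z" "u \<in> ?A \<union> ?B" "p z \<noteq> p u"
    show "\<not> E z u"
    proof
      assume Ezu: "E z u"
      have partner: "\<exists>t \<in> A'. R t z" if ex: "\<exists>t \<in> A'. R t u"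
      proof -
        obtain t where t: "t \<in> A'" "R t u" using ex by blast
        show ?thesis
        proof (cases "u \<in> ?A")
          case True
          then have "t = u" using t disj by (auto simp: R_def)
          then have "R t z" using zu Ezu comm by (auto simp: R_def)
          with t show ?thesis by blast
        next
          case False
          then have u: "u \<in> ?B" "\<not> E t u" using t zu disj by (auto simp: R_def)
          then have "E z t" using Zboth'[OF zu(1) A'A[OF t(1)]] Ezu by blast
          then have "R t z" using zu comm by (auto simp: R_def)
          with t show ?thesis by blast
        qed
      qed
      have "\<exists>t \<in> A'. R t z"
      proof (rule ccontr)
        assume no: "\<not> (\<exists>t \<in> A'. R t z)"
        then have "p z = 0" "p u = 0" using partner p0 by blast+
        with zu show False by simp
      qed
      then obtain t where t: "t \<in> A'" "R t z" by blast
      have tz: "E z t" using t zu disj comm by (auto simp: R_def)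
      obtain x where x: "x \<in> ?B" "\<not> E t x" using t by (auto simp: A'_def)
      have zx: "E z x" by (rule Zboth[OF zu(1) A'A[OF t(1)] x tz])
      have "R t u"
      proof (cases "u \<in> ?A")
        case True
        then have "\<not> E u x" using Ztri[OF zu(1) True x(1)] zx Ezu by blast
        then have "u = t" using co2[OF True A'A[OF t(1)] x(1) _ x(2)] by blast
        with True show ?thesis by (simp add: R_def)
      next
        case False
        then have u: "u \<in> ?B" using zu by blast
        then have "\<not> E t u" using Ztri[OF zu(1) A'A[OF t(1)] u] tz Ezu by blast
        with u show ?thesis by (simp add: R_def)
      qed
      then show False using pR[OF t(1)] t(2) zu by metis
    qed
  next
    fix w assume w: "w \<in> ?U"
    let ?P = "{v \<in> ?U. p v = p w}"
    have PV: "?P \<subseteq> V" using UV by blast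
    have g: "sgraph ?P E" using sgraph PV by (rule sgraph_subset)
    have pf: "p23free ?P E" using p23free PV by (rule p23free_subset)
    show "(?P, E) \<in> Bip \<union> del 3 Edgeless"
    proof (cases "p w = 0")
      case True
      have PA: "E u v" if "u \<in> ?P" "v \<in> ?P" "u \<in> ?A" "v \<in> ?B" for u v
      proof (rule ccontr)
        assume "\<not> E u v"
        then have "u \<in> A'" "R u u" using that by (auto simp: A'_def R_def)
        then have "p u = Suc (e u)" by (rule pR)
        with that True show False by simp
      qed
      \<comment> \<open>In column 0 no vertex of \<open>Z\<close> sees both classes, so those that
        see \<open>?B\<close> can join the side of \<open>?A\<close>.\<close>
      define Y where "Y = {z \<in> Z. \<exists>x \<in> ?B \<inter> ?P. E z x}"
      have "edgeless E (?A \<inter> ?P \<union> Y)"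
        unfolding edgeless_def
      proof (intro ballI)
        fix u v assume uv: "u \<in> ?A \<inter> ?P \<union> Y" "v \<in> ?A \<inter> ?P \<union> Y"
        have 1: "\<not> E z t" if zt: "z \<in> Y" "t \<in> ?A \<inter> ?P" for z t
        proof -
          obtain x where "z \<in> Z" "x \<in> ?B" "x \<in> ?P" "E z x" using zt by (auto simp: Y_def)
          then show ?thesis using Ztri[of z t x] PA[of t x] zt by blast
        qed
        have "Y \<subseteq> Z" by (auto simp: Y_def)
        then show "\<not> E u v" using uv 1[of u v] 1[of v u] comm[of u v] edgelessD[OF T0[of i], of u v] edgelessD[OF Z0, of u v] by blast
      qed
      moreover have "edgeless E (?B \<inter> ?P \<union> (?P \<inter> Z - Y))"
        unfolding edgeless_def
      proof (intro ballI)
        fix u v assume uv: "u \<in> ?B \<inter> ?P \<union> (?P \<inter> Z - Y)" "v \<in> ?B \<inter> ?P \<union> (?P \<inter> Z - Y)"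
        have 1: "\<not> E z t" if "z \<in> ?P \<inter> Z - Y" "t \<in> ?B \<inter> ?P" for z t using that by (auto simp: Y_def)
        show "\<not> E u v" using uv 1[of u v] 1[of v u] comm[of u v] edgelessD[OF T0[of "i + 1"], of u v] edgelessD[OF Z0, of u v] by blast
      qed
      moreover have "?P \<subseteq> (?A \<inter> ?P \<union> Y) \<union> (?B \<inter> ?P \<union> (?P \<inter> Z - Y))" by blast
      ultimately have "(?P, E) \<in> Bip" by (rule BipI[OF g pf])
      then show ?thesis by blast
    next
      case False
      then have "\<exists>t \<in> A'. R t w" using p0[of w] by simp
      then obtain t where t: "t \<in> A'" "R t w" by blast
      then have pw: "p w = Suc (e t)" by (rule pR[of t w])
      have RP: "R t v" if "v \<in> ?P" for v
      proof -
        have "p v = Suc (e t)" using that pw by simp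
        then obtain t' where t': "t' \<in> A'" "R t' v" using p0[of v] by auto
        then have "e t' = e t" using pR[OF t'] \<open>p v = Suc (e t)\<close> by simp
        then have "t' = t" using e A'A[OF t(1)] A'A[OF t'(1)] UV by (auto dest!: inj_onD)
        with t' show ?thesis by simp
      qed
      have "x = t" if "x \<in> ?A \<inter> ?P" for x using RP[of x] that disj by (auto simp: R_def)
      then have "card (?A \<inter> ?P) \<le> 1" by (intro card_le1I) blast
      moreover have "card (?B \<inter> ?P) \<le> 1"
      proof (rule card_le1I)
        fix x y assume xy: "x \<in> ?B \<inter> ?P" "y \<in> ?B \<inter> ?P"
        then have "\<not> E t x" "\<not> E t y" using RP[of x] RP[of y] disj by (auto simp: R_def)
        then show "x = y" using co1[OF A'A[OF t(1)]] xy by blast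
      qed
      ultimately have c: "card (?A \<inter> ?P \<union> ?B \<inter> ?P) \<le> 3" using card_Un_le[of "?A \<inter> ?P" "?B \<inter> ?P"] by linarith
      have "edgeless E (?P - (?A \<inter> ?P \<union> ?B \<inter> ?P))" using Z0 by (rule edgeless_subset) blast
      moreover have "sgraph (?P - (?A \<inter> ?P \<union> ?B \<inter> ?P)) E" using g by (rule sgraph_subset) blast
      ultimately have "(?P - (?A \<inter> ?P \<union> ?B \<inter> ?P), E) \<in> Edgeless" by (simp add: Edgeless_def)
      then have "(?P, E) \<in> del 3 Edgeless" by (intro delI[OF g _ c]) blast+
      then show ?thesis by blast
    qed
  qed (use AB in blast)
qed

lemma T_mod: "T (i + 5 * k) = T i"
proof (induction k)
  case (Suc k)
  then show ?case using period[of "i + 5 * k"] by (simp add: algebra_simps)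
qed simp

lemma T_cong: "i mod 5 = j mod 5 \<Longrightarrow> T i = T j"
proof -
  have "T k = T (k mod 5)" for k using T_mod[of "k mod 5" "k div 5"] by simp
  then show "i mod 5 = j mod 5 \<Longrightarrow> T i = T j" by metis
qed

lemma T_shift: "\<exists>d < 5. T i = T (a + d)"
proof (intro exI conjI)
  \<comment> \<open>Modulo 5, \<open>4 * a\<close> is the negative of \<open>a\<close>.\<close>
  show "T i = T (a + (i + 4 * a) mod 5)" by (rule T_cong) presburger
qed simp

text \<open>If both outer classes are nonempty, \<open>full1\<close> and \<open>full2\<close> join
  them completely to the middle one, so no vertex of \<open>Z\<close> sees both the middle and an
  outer class and the graph is bipartite. Otherwise at most two consecutive classes remain.\<close>

lemma triple:
  assumes e: "T (a + 3) = {}" "T (a + 4) = {}"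
  shows "((\<Union>i. T i) \<union> Z, E) \<in> Bip \<union> Columns"
proof -
  have U: "(\<Union>i. T i) = T a \<union> T (a + 1) \<union> T (a + 2)"
  proof -
    have "T i \<subseteq> T a \<union> T (a + 1) \<union> T (a + 2)" for i
    proof -
      obtain d where d: "d < 5" "T i = T (a + d)" using T_shift by blast
      then have "d = 0 \<or> d = 1 \<or> d = 2 \<or> d = 3 \<or> d = 4" by auto
      then show ?thesis using d e by auto
    qed
    then show ?thesis by blast
  qed
  consider "T a = {}" | "T (a + 2) = {}" | "T a \<noteq> {}" "T (a + 2) \<noteq> {}" by blast
  then show ?thesis
  proof cases
    case 1
    then show ?thesis using pair_Columns[of "a + 1"] U by (simp add: eval_nat_numeral)
  next
    case 2
    then show ?thesis using pair_Columns[of a] U by simp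
  next
    case 3
    have f1: "E u v" if "u \<in> T a" "v \<in> T (a + 1)" for u v by (rule full1[OF 3(2) that])
    have f2: "E u v" if "u \<in> T (a + 1)" "v \<in> T (a + 2)" for u v
    proof (rule full2[of "a + 1"])
      show "T (a + 1 + 4) \<noteq> {}" using 3(1) period[of a] by (simp add: eval_nat_numeral)
    qed (use that in \<open>auto simp: eval_nat_numeral\<close>)
    define Y where "Y = {z \<in> Z. \<exists>x \<in> T (a + 1). E z x}"
    have UV: "(\<Union>i. T i) \<union> Z \<subseteq> V" using TV ZV by blast
    have "edgeless E (T a \<union> T (a + 2) \<union> Y)"
      unfolding edgeless_def
    proof (intro ballI)
      fix u v assume uv: "u \<in> T a \<union> T (a + 2) \<union> Y" "v \<in> T a \<union> T (a + 2) \<union> Y"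
      have 1: "\<not> E z t" if zt: "z \<in> Y" "t \<in> T a \<union> T (a + 2)" for z t
      proof
        assume "E z t"
        obtain x where x: "z \<in> Z" "x \<in> T (a + 1)" "E z x" using zt by (auto simp: Y_def)
        have "E t x" using f1[of t x] f2[of x t] x zt sym by blast
        then show False using tf[of z t x] x zt TV' ZV' \<open>E z t\<close> by blast
      qed
      have "Y \<subseteq> Z" by (auto simp: Y_def)
      then show "\<not> E u v"
        using uv 1[of u v] 1[of v u] comm[of u v] edgelessD[OF T0[of a], of u v] edgelessD[OF T0[of "a + 2"], of u v]
          edgelessD[OF Z0, of u v] T2[of u a v] T2[of v a u] by blast
    qed
    moreover have "edgeless E (T (a + 1) \<union> (Z - Y))"
      unfolding edgeless_def
    proof (intro ballI)
      fix u v assume uv: "u \<in> T (a + 1) \<union> (Z - Y)" "v \<in> T (a + 1) \<union> (Z - Y)"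
      have 1: "\<not> E z t" if "z \<in> Z - Y" "t \<in> T (a + 1)" for z t using that by (auto simp: Y_def)
      show "\<not> E u v" using uv 1[of u v] 1[of v u] comm[of u v] edgelessD[OF T0[of "a + 1"], of u v] edgelessD[OF Z0, of u v] by blast
    qed
    moreover have "(\<Union>i. T i) \<union> Z \<subseteq> (T a \<union> T (a + 2) \<union> Y) \<union> (T (a + 1) \<union> (Z - Y))" using U by blast
    ultimately have "((\<Union>i. T i) \<union> Z, E) \<in> Bip"
      by (rule BipI[OF sgraph_subset[OF sgraph UV] p23free_subset[OF p23free UV]])
    then show ?thesis by blast
  qed
qed

text \<open>A vertex of \<open>Z\<close> that sees \<open>T a\<close> is complete to the two
  opposite classes by \<open>far\<close>, but by \<open>not_both\<close> never to two consecutive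
  nonempty classes; applying this repeatedly empties two consecutive classes. If \<open>Z\<close>
  sees no class, one empty class leaves a row of four classes, which is bipartite, and no empty
  class makes all joins complete.\<close>

lemma c5_blowup_parts_cases: "((\<Union>i. T i) \<union> Z, E) \<in> C5_blowup \<union> Bip \<union> Columns"
proof (cases "\<exists>z \<in> Z. \<exists>a. \<exists>t \<in> T a. E z t")
  case True
  then obtain z a t where zt: "z \<in> Z" "t \<in> T a" "E z t" by blast
  have "\<exists>b. T (b + 3) = {} \<and> T (b + 4) = {}"
  proof (cases "T (a + 3) = {}")
    case e3: True
    show ?thesis
    proof (cases "T (a + 2) = {}")
      case True
      moreover have "T (a + 4 + 3) = T (a + 2)" "T (a + 4 + 4) = T (a + 3)" by (rule T_cong, presburger)+
      ultimately show ?thesis using e3 by metis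
    next
      case False
      then obtain x where x: "x \<in> T (a + 2)" by blast
      then have zx: "E z x" using far[OF zt] by blast
      have "E z y" if "y \<in> T (a + 4) \<union> T (a + 4 + 1)" for y
        by (rule far[OF zt(1) x zx]) (use that in \<open>auto simp: eval_nat_numeral\<close>)
      then have "T (a + 4) = {} \<or> T (a + 4 + 1) = {}" using not_both[OF zt(1), of "a + 4"] by blast
      moreover have "T (a + 4 + 1) = T a" by (rule T_cong) presburger
      ultimately show ?thesis using e3 zt by blast
    qed
  next
    case ne3: False
    have "T (a + 2) = {}"
    proof (rule ccontr)
      assume "T (a + 2) \<noteq> {}"
      moreover have "E z x" if "x \<in> T (a + 2) \<union> T (a + 2 + 1)" for x
        by (rule far[OF zt]) (use that in \<open>auto simp: eval_nat_numeral\<close>)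
      ultimately have "T (a + 2 + 1) = {}" using not_both[OF zt(1), of "a + 2"] by blast
      then show False using ne3 by (simp add: eval_nat_numeral)
    qed
    moreover obtain x where x: "x \<in> T (a + 3)" using ne3 by blast
    then have zx: "E z x" using far[OF zt] by blast
    have "E z y" if "y \<in> T a \<union> T (a + 1)" for y
    proof (rule far[OF zt(1) x zx])
      have "T (a + 3 + 2) = T a" "T (a + 3 + 3) = T (a + 1)" by (rule T_cong, presburger)+
      with that show "y \<in> T (a + 3 + 2) \<union> T (a + 3 + 3)" by blast
    qed
    then have "T (a + 1) = {}" using not_both[OF zt(1), of a] zt by blast
    moreover have "T (a + 3 + 3) = T (a + 1)" "T (a + 3 + 4) = T (a + 2)" by (rule T_cong, presburger)+
    ultimately show ?thesis by (intro exI[of _ "a + 3"]) simp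
  qed
  then show ?thesis using triple by blast
next
  case noZ: False
  have UV: "(\<Union>i. T i) \<union> Z \<subseteq> V" using TV ZV by blast
  have g: "sgraph ((\<Union>i. T i) \<union> Z) E" using sgraph UV by (rule sgraph_subset)
  have ZT: "\<not> E z t" "\<not> E t z" if "z \<in> Z" "t \<in> T i" for z t i using that noZ comm by blast+
  show ?thesis
  proof (cases "\<exists>a. T a = {}")
    case True
    then obtain a where a: "T a = {}" by blast
    have "edgeless E (T (a + 1) \<union> T (a + 3) \<union> Z)"
      unfolding edgeless_def
    proof (intro ballI)
      fix u v assume uv: "u \<in> T (a + 1) \<union> T (a + 3) \<union> Z" "v \<in> T (a + 1) \<union> T (a + 3) \<union> Z"
      have "T (a + 1 + 2) = T (a + 3)" by (rule T_cong) presburger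
      then show "\<not> E u v"
        using uv ZT[of u v] ZT[of v u] comm[of u v] edgelessD[OF T0[of "a + 1"], of u v] edgelessD[OF T0[of "a + 3"], of u v]
          edgelessD[OF Z0, of u v] T2[of u "a + 1" v] T2[of v "a + 1" u] by blast
    qed
    moreover have "edgeless E (T (a + 2) \<union> T (a + 4))"
      unfolding edgeless_def
    proof (intro ballI)
      fix u v assume uv: "u \<in> T (a + 2) \<union> T (a + 4)" "v \<in> T (a + 2) \<union> T (a + 4)"
      have "T (a + 2 + 2) = T (a + 4)" by (rule T_cong) presburger
      then show "\<not> E u v"
        using uv comm[of u v] edgelessD[OF T0[of "a + 2"], of u v] edgelessD[OF T0[of "a + 4"], of u v]
          T2[of u "a + 2" v] T2[of v "a + 2" u] by blast
    qed
    moreover have "(\<Union>i. T i) \<union> Z \<subseteq> (T (a + 1) \<union> T (a + 3) \<union> Z) \<union> (T (a + 2) \<union> T (a + 4))"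
    proof -
      have "T i \<subseteq> T (a + 1) \<union> T (a + 3) \<union> (T (a + 2) \<union> T (a + 4))" for i
      proof -
        obtain d where d: "d < 5" "T i = T (a + d)" using T_shift by blast
        then have "d = 0 \<or> d = 1 \<or> d = 2 \<or> d = 3 \<or> d = 4" by auto
        then show ?thesis using d a by auto
      qed
      then show ?thesis by blast
    qed
    ultimately have "((\<Union>i. T i) \<union> Z, E) \<in> Bip" by (rule BipI[OF g p23free_subset[OF p23free UV]])
    then show ?thesis by blast
  next
    case ne: False
    obtain e :: "'v \<Rightarrow> nat" where e: "inj_on e V" using ex_enum[OF fin] by metis
    define col :: "'v \<Rightarrow> nat" where "col v = (if v \<in> Z then 5 else SOME i. i < 5 \<and> v \<in> T i)" for v
    have col: "col v < 5 \<and> v \<in> T (col v)" if v: "v \<in> (\<Union>i. T i)" for v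
    proof -
      obtain i where i: "v \<in> T i" using v by blast
      then have "v \<in> T (i mod 5)" using T_cong[of "i mod 5" i] by simp
      then have "\<exists>i. i < 5 \<and> v \<in> T i" by (intro exI[of _ "i mod 5"]) simp
      from someI_ex[OF this] show ?thesis using i disjoint(2)[of i] by (auto simp: col_def)
    qed
    have adj: "E u v \<longleftrightarrow> j = (i + 1) mod 5 \<or> i = (j + 1) mod 5"
      if ij: "i < 5" "j < 5" "u \<in> T i" "v \<in> T j" for u v i j
      using ij(1,2)
    proof (cases rule: mod5_cases)
      case 1
      then have "\<not> E u v" using ij edgelessD[OF T0[of i], of u v] by simp
      with 1 show ?thesis by blast
    next
      case 2
      then have "T j = T (i + 1)" by (intro T_cong) simp
      then have "E u v" using full1[of i u v] ij ne by blast
      with 2 show ?thesis by blast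
    next
      case 3
      then have "T j = T (i + 2)" by (intro T_cong) simp
      then have "\<not> E u v" using T2[of u i v] ij by blast
      with 3 show ?thesis by blast
    next
      case 4
      then have "T i = T (j + 2)" by (intro T_cong) simp
      then have "\<not> E u v" using T2[of v j u] ij comm by blast
      with 4 show ?thesis by blast
    next
      case 5
      then have "T i = T (j + 1)" by (intro T_cong) simp
      then have "E v u" using full1[of j v u] ij ne by blast
      with 5 sym show ?thesis by blast
    qed
    have colZ: "col z = 5" if "z \<in> Z" for z using that by (simp add: col_def)
    have "((\<Union>i. T i) \<union> Z, E) \<in> C5_blowup"
      unfolding C5_blowup_def
    proof (rule layeredI[where p = e and col = col, OF g])
      fix v assume "v \<in> (\<Union>i. T i) \<union> Z"
      then have "col v < 5 \<or> col v = 5" using col colZ by blast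
      then show "col v \<in> {..<6}" by auto
    next
      fix w assume w: "w \<in> (\<Union>i. T i) \<union> Z"
      then have "{v \<in> (\<Union>i. T i) \<union> Z. e v = e w} = {w}" using e UV by (auto dest: inj_onD)
      then show "({v \<in> (\<Union>i. T i) \<union> Z. e v = e w}, E) \<in> Single" using g by (auto simp: Single_def sgraph_def)
    next
      fix u v assume uv: "u \<in> (\<Union>i. T i) \<union> Z" "v \<in> (\<Union>i. T i) \<union> Z"
      show "E u v \<longleftrightarrow> col u < 5 \<and> col v < 5 \<and> (col v = (col u + 1) mod 5 \<or> col u = (col v + 1) mod 5)"
      proof (cases "u \<in> Z \<or> v \<in> Z")
        case True
        then have "\<not> E u v" using uv ZT[of u v] ZT[of v u] edgelessD[OF Z0, of u v] by blast
        moreover have "\<not> (col u < 5 \<and> col v < 5)" using True colZ by auto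
        ultimately show ?thesis by blast
      next
        case False
        then have c: "col u < 5 \<and> u \<in> T (col u)" "col v < 5 \<and> v \<in> T (col v)" using uv col by blast+
        then show ?thesis using adj[of "col u" "col v" u v] by blast
      qed
    qed
    then show ?thesis by blast
  qed
qed

end

section \<open>Vertices around an induced 5-cycle\<close>

lemma periodic_mod:
  fixes F :: "nat \<Rightarrow> 'b"
  assumes "\<And>i. F (i + 5) = F i" shows "F (i mod 5) = F i"
proof -
  have "F (i + 5 * k) = F i" for i k
  proof (induction k)
    case (Suc k)
    then show ?case using assms[of "i + 5 * k"] by (simp add: algebra_simps)
  qed simp
  from this[of "i mod 5" "i div 5"] show ?thesis by simp
qed

locale c5graph = tfgraph +
  fixes c :: "nat \<Rightarrow> 'a"
  assumes period: "c (i + 5) = c i" and cV: "c i \<in> V"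
    and c1: "E (c i) (c (i + 1))" and c2: "\<not> E (c i) (c (i + 2))"
begin

lemma cS: "c (Suc (Suc (Suc (Suc (Suc i))))) = c i"
  using period[of i] by (simp add: eval_nat_numeral)

lemmas nums = eval_nat_numeral cS

lemma c3: "\<not> E (c i) (c (i + 3))"
  using c2[of "i + 3"] comm by (simp add: nums)

lemma c4: "E (c i) (c (i + 4))"
  using c1[of "i + 4"] comm by (simp add: nums)

lemma c_ne: "c i \<noteq> c (i + 2)"
  using c3[of i] c1[of "i + 2"] by (auto simp: nums)

text \<open>The vertices of the cycle have to be excluded: \<open>Z_edge\<close> fails for \<open>x = c (i + 2)\<close>.\<close>

definition T where "T i = {v \<in> V - range c. E v (c (i + 1)) \<and> E v (c (i + 4))}"

definition S where "S i = {v \<in> V. E v (c i) \<and> \<not> E v (c (i + 1)) \<and> \<not> E v (c (i + 2)) \<and> \<not> E v (c (i + 3)) \<and> \<not> E v (c (i + 4))}"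

definition Z where "Z = {v \<in> V. \<forall>k. \<not> E v (c k)}"

lemma T_V: "t \<in> T i \<Longrightarrow> t \<in> V" by (simp add: T_def)

lemma Z_V: "z \<in> Z \<Longrightarrow> z \<in> V" by (simp add: Z_def)

lemma Z_c: "z \<in> Z \<Longrightarrow> \<not> E z (c k)" "z \<in> Z \<Longrightarrow> \<not> E (c k) z" using comm by (auto simp: Z_def)

lemma T_c: assumes t: "t \<in> T i"
  shows "\<not> E t (c i)" "E t (c (i + 1))" "\<not> E t (c (i + 2))" "\<not> E t (c (i + 3))" "E t (c (i + 4))"
proof -
  show 1: "E t (c (i + 1))" and 4: "E t (c (i + 4))" using t by (auto simp: T_def)
  show "\<not> E t (c i)" using tf[of t "c i" "c (i + 1)"] 1 c1[of i] T_V[OF t] cV by auto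
  show "\<not> E t (c (i + 2))" using tf[of t "c (i + 1)" "c (i + 2)"] 1 c1[of "i + 1"] T_V[OF t] cV by (auto simp: nums)
  show "\<not> E t (c (i + 3))" using tf[of t "c (i + 3)" "c (i + 4)"] 4 c1[of "i + 3"] T_V[OF t] cV by (auto simp: nums)
qed

lemma T_c1: assumes t: "t \<in> T (i + 1)"
  shows "E t (c i)" "\<not> E t (c (i + 1))" "E t (c (i + 2))" "\<not> E t (c (i + 3))" "\<not> E t (c (i + 4))"
  using T_c[OF t] by (simp_all add: nums)

lemma T_c2: assumes t: "t \<in> T (i + 2)"
  shows "\<not> E t (c i)" "E t (c (i + 1))" "\<not> E t (c (i + 2))" "E t (c (i + 3))" "\<not> E t (c (i + 4))"
  using T_c[OF t] by (simp_all add: nums)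

lemma T_c3: assumes t: "t \<in> T (i + 3)"
  shows "\<not> E t (c i)" "\<not> E t (c (i + 1))" "E t (c (i + 2))" "\<not> E t (c (i + 3))" "E t (c (i + 4))"
  using T_c[OF t] by (simp_all add: nums)

lemma T_c4: assumes t: "t \<in> T (i + 4)"
  shows "E t (c i)" "\<not> E t (c (i + 1))" "\<not> E t (c (i + 2))" "E t (c (i + 3))" "\<not> E t (c (i + 4))"
  using T_c[OF t] by (simp_all add: nums)

lemma c24: "\<not> E (c (i + 2)) (c (i + 4))" "\<not> E (c (i + 4)) (c (i + 2))"
  using c2[of "i + 2"] comm by (auto simp: nums)

lemma c23: "E (c (i + 2)) (c (i + 3))" "E (c (i + 3)) (c (i + 2))"
  using c1[of "i + 2"] comm by (auto simp: nums)

lemma T_period: "T (i + 5) = T i" unfolding T_def by (simp add: nums)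

lemma S_period: "S (i + 5) = S i" unfolding S_def by (simp add: nums)

lemma edgeless_T: "edgeless E (T i)"
  using edgeless_nbrs[OF cV[of "i + 1"]] by (rule edgeless_subset) (auto simp: T_def)

lemma edgeless_Z: "edgeless E Z"
  unfolding edgeless_def
proof (intro ballI notI)
  fix z z' assume z: "z \<in> Z" "z' \<in> Z" "E z z'"
  show False
    by (rule p23[of z z' "c 0" "c (0 + 1)" "c (0 + 1 + 1)"])
      (use z Z_V Z_c cV c1[of 0] c1[of "0 + 1"] c2[of 0] c_ne[of 0] in \<open>auto simp: eval_nat_numeral\<close>)
qed

lemma T_T2: assumes "u \<in> T i" "v \<in> T (i + 2)" shows "\<not> E u v"
  using tf[of u v "c (i + 1)"] T_c(2)[OF assms(1)] T_c2(2)[OF assms(2)] T_V[OF assms(1)] T_V[OF assms(2)] cV by auto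

text \<open>Two missed vertices would form a path with centre \<open>c (i + 2)\<close>, and the edge
  from \<open>u\<close> to \<open>c (i + 4)\<close> would have no adjacency to it.
  \<open>T_co2\<close> is the mirror image.\<close>

lemma T_co1:
  assumes "u \<in> T i" "v \<in> T (i + 1)" "v' \<in> T (i + 1)" "\<not> E u v" "\<not> E u v'" shows "v = v'"
proof (rule ccontr)
  assume "v \<noteq> v'"
  show False
  proof (rule p23[of u "c (i + 4)" v "c (i + 2)" v'])
    show "{u, c (i + 4), v, c (i + 2), v'} \<subseteq> V" using assms T_V cV by blast
    show "E u (c (i + 4))" "\<not> E u (c (i + 2))" using T_c[OF assms(1)] by auto
    show "E v (c (i + 2))" using T_c1[OF assms(2)] by auto
    show "E (c (i + 2)) v'" using T_c1[OF assms(3)] sym by blast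
    show "\<not> E (c (i + 4)) v" "\<not> E (c (i + 4)) v'" using T_c1(5)[OF assms(2)] T_c1(5)[OF assms(3)] sym by blast+
    show "\<not> E v v'" using edgelessD[OF edgeless_T assms(2,3)] .
  qed (use assms \<open>v \<noteq> v'\<close> c24 in auto)
qed

lemma T_co2:
  assumes "u \<in> T i" "u' \<in> T i" "v \<in> T (i + 1)" "\<not> E u v" "\<not> E u' v" shows "u = u'"
proof (rule ccontr)
  assume "u \<noteq> u'"
  show False
  proof (rule p23[of v "c (i + 2)" u "c (i + 4)" u'])
    show "{v, c (i + 2), u, c (i + 4), u'} \<subseteq> V" using assms T_V cV by blast
    show "E v (c (i + 2))" "\<not> E v (c (i + 4))" using T_c1[OF assms(3)] by auto
    show "E u (c (i + 4))" using T_c[OF assms(1)] by auto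
    show "E (c (i + 4)) u'" using T_c(5)[OF assms(2)] sym by blast
    show "\<not> E (c (i + 2)) u" "\<not> E (c (i + 2)) u'" using T_c(3)[OF assms(1)] T_c(3)[OF assms(2)] sym by blast+
    show "\<not> E u u'" using edgelessD[OF edgeless_T assms(1,2)] .
    show "\<not> E v u" "\<not> E v u'" using assms sym by blast+
  qed (use \<open>u \<noteq> u'\<close> c24 in auto)
qed

lemma two_of_three:
  assumes "3 \<le> card X" "\<And>x y. x \<in> X \<Longrightarrow> y \<in> X \<Longrightarrow> \<not> P x \<Longrightarrow> \<not> P y \<Longrightarrow> x = y"
  obtains x y where "x \<in> X" "y \<in> X" "x \<noteq> y" "P x" "P y"
proof -
  have fin: "finite X" using assms(1) by (intro card_ge_0_finite) simp
  have "card {x \<in> X. \<not> P x} \<le> 1" by (rule card_le1I) (use assms(2) in auto)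
  moreover have "card (X - {x \<in> X. \<not> P x}) = card X - card {x \<in> X. \<not> P x}"
    by (rule card_Diff_subset) (use fin in auto)
  ultimately have "2 \<le> card (X - {x \<in> X. \<not> P x})" using assms(1) by linarith
  then obtain x y where "x \<in> X - {x \<in> X. \<not> P x}" "y \<in> X - {x \<in> X. \<not> P x}" "x \<noteq> y" by (rule card_two)
  then show thesis using that by blast
qed

text \<open>By \<open>T_co1\<close> the vertex \<open>v\<close> misses at most one of at least three
  vertices of \<open>T (i + 2)\<close>. Two others form with \<open>v\<close> a path without
  adjacency to the edge from \<open>u\<close> to \<open>c (i + 4)\<close>.\<close>

lemma T_full1:
  assumes n: "3 \<le> card (T (i + 2))" and u: "u \<in> T i" and v: "v \<in> T (i + 1)" shows "E u v"
proof (rule ccontr)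
  assume no: "\<not> E u v"
  have eq: "T (i + 1 + 1) = T (i + 2)" by (simp add: eval_nat_numeral)
  obtain t t' where t: "t \<in> T (i + 2)" "t' \<in> T (i + 2)" "t \<noteq> t'" "E v t" "E v t'"
    by (rule two_of_three[OF n, of "E v"]) (use T_co1[OF v] eq in auto)
  show False
  proof (rule p23[of u "c (i + 4)" t v t'])
    show "{u, c (i + 4), t, v, t'} \<subseteq> V" using u v t T_V cV by blast
    show "E u (c (i + 4))" using T_c[OF u] by auto
    show "E t v" "E v t'" using t sym by blast+
    show "\<not> E t t'" using edgelessD[OF edgeless_T t(1,2)] .
    show "\<not> E u t" "\<not> E u t'" using T_T2[OF u] t by auto
    show "\<not> E (c (i + 4)) t" "\<not> E (c (i + 4)) t'" using T_c2(5)[OF t(1)] T_c2(5)[OF t(2)] sym by blast+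
    show "\<not> E (c (i + 4)) v" using T_c1(5)[OF v] sym by blast
  qed (use t no in auto)
qed

lemma T_full2:
  assumes n: "3 \<le> card (T (i + 4))" and u: "u \<in> T i" and v: "v \<in> T (i + 1)" shows "E u v"
proof (rule ccontr)
  assume no: "\<not> E u v"
  have eq: "T (i + 4 + 1) = T i" "T (i + 4 + 2) = T (i + 1)"
    using T_period[of i] T_period[of "i + 1"] by (simp_all add: eval_nat_numeral)
  obtain t t' where t: "t \<in> T (i + 4)" "t' \<in> T (i + 4)" "t \<noteq> t'" "E u t" "E u t'"
    by (rule two_of_three[OF n, of "E u"]) (use T_co2[of _ "i + 4" _ u] u eq comm in auto)
  show False
  proof (rule p23[of v "c (i + 2)" t u t'])
    show "{v, c (i + 2), t, u, t'} \<subseteq> V" using u v t T_V cV by blast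
    show "E v (c (i + 2))" using T_c1[OF v] by auto
    show "E t u" "E u t'" using t sym by blast+
    show "\<not> E t t'" using edgelessD[OF edgeless_T t(1,2)] .
    show "\<not> E v t" "\<not> E v t'" using T_T2[OF t(1), of v] T_T2[OF t(2), of v] v eq sym by auto
    show "\<not> E (c (i + 2)) t" "\<not> E (c (i + 2)) t'" using T_c4(3)[OF t(1)] T_c4(3)[OF t(2)] sym by blast+
    show "\<not> E (c (i + 2)) u" using T_c(3)[OF u] sym by blast
    show "\<not> E v u" using no sym by blast
  qed (use t in auto)
qed

text \<open>The vertex \<open>x\<close> and the cycle edge from \<open>c (i + 2)\<close> to
  \<open>c (i + 3)\<close> form an induced path, to which the edge \<open>zt\<close> could only be
  adjacent through \<open>zx\<close>.\<close>

lemma Z_edge: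
  assumes z: "z \<in> Z" "t \<in> T i" "E z t" and x: "x \<in> V" "x \<notin> range c" "\<not> E t x"
    and x23: "E x (c (i + 2)) \<longleftrightarrow> \<not> E x (c (i + 3))"
  shows "E z x"
proof (rule ccontr)
  assume no: "\<not> E z x"
  have a: "\<not> E t (c (i + 2))" "\<not> E t (c (i + 3))" using T_c[OF z(2)] by auto
  have V: "z \<in> V" "t \<in> V" using z T_V Z_V by auto
  show False
  proof (cases "E x (c (i + 2))")
    case True
    then show False using p23[of z t x "c (i + 2)" "c (i + 3)"] z x x23 no a V cV c23 Z_c by auto
  next
    case False
    then show False using p23[of z t x "c (i + 3)" "c (i + 2)"] z x x23 no a V cV c23 Z_c by auto
  qed
qed

lemma Z_far:
  assumes z: "z \<in> Z" "t \<in> T i" "E z t" and x: "x \<in> T (i + 2) \<union> T (i + 3)" shows "E z x"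
proof (rule Z_edge[OF z])
  show "x \<in> V" "x \<notin> range c" using x by (auto simp: T_def)
  have "T (i + 3 + 2) = T i" using T_period[of i] by (simp add: eval_nat_numeral)
  then show "\<not> E t x" using x T_T2[OF z(2), of x] T_T2[of x "i + 3" t] z comm by auto
  show "E x (c (i + 2)) \<longleftrightarrow> \<not> E x (c (i + 3))" using x T_c2[of x i] T_c3[of x i] by auto
qed

lemma Z_near:
  assumes z: "z \<in> Z" "t \<in> T i" "E z t" and x: "x \<in> T (i + 1) \<union> T (i + 4)" "\<not> E t x" shows "E z x"
proof (rule Z_edge[OF z])
  show "x \<in> V" "x \<notin> range c" using x by (auto simp: T_def)
  show "E x (c (i + 2)) \<longleftrightarrow> \<not> E x (c (i + 3))" using x T_c1[of x i] T_c4[of x i] by auto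
qed (rule x)

text \<open>Two members would form with \<open>c i\<close> a path without adjacency to the edge from
  \<open>c (i + 2)\<close> to \<open>c (i + 3)\<close>.\<close>

lemma card_S: "card (S i) \<le> 1"
proof (rule card_le1I, rule ccontr)
  fix s s' assume s: "s \<in> S i" "s' \<in> S i" "s \<noteq> s'"
  have V: "s \<in> V" "s' \<in> V" "c i \<in> V" "c (i + 2) \<in> V" "c (i + 3) \<in> V" using s cV by (auto simp: S_def)
  have "E s (c i)" "E (c i) s'" using s sym by (auto simp: S_def)
  moreover have "\<not> E s s'" using tf[of s s' "c i"] s V by (auto simp: S_def)
  moreover have "\<not> E (c (i + 2)) s" "\<not> E (c (i + 2)) s'" "\<not> E (c (i + 3)) s" "\<not> E (c (i + 3)) s'"
    using s comm by (auto simp: S_def)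
  moreover have "\<not> E (c (i + 2)) (c i)" "\<not> E (c (i + 3)) (c i)" using c2 c3 comm by blast+
  ultimately show False using p23[of "c (i + 2)" "c (i + 3)" s "c i" s'] V s(3) c23(1) by auto
qed

text \<open>Without triangles no two consecutive vertices of the cycle are seen, so \<open>v\<close>
  sees none, one, or two at distance two.\<close>

lemma cover: "v \<in> V \<Longrightarrow> v \<in> range c \<or> v \<in> Z \<or> (\<exists>i. v \<in> S i) \<or> (\<exists>i. v \<in> T i)"
proof (cases "v \<in> range c \<or> v \<in> Z")
  case False
  assume v: "v \<in> V"
  then obtain k where k: "E v (c k)" using False by (auto simp: Z_def)
  have "v \<in> T (k + 1)" if "E v (c (k + 2))" using that k v False by (auto simp: T_def nums)
  moreover have "v \<in> T (k + 4)" if "E v (c (k + 3))" using that k v False by (auto simp: T_def nums)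
  moreover have "\<not> E v (c (k + 1))" using tf[of v "c k" "c (k + 1)"] k v cV c1 by auto
  moreover have "\<not> E v (c (k + 4))" using tf[of v "c k" "c (k + 4)"] k v cV c4 by auto
  ultimately show ?thesis using k v unfolding S_def by blast
qed blast

text \<open>Three vertices are what \<open>T_full1\<close> and \<open>T_full2\<close> ask of a
  nonempty class; smaller classes are emptied here and their vertices deleted.\<close>

definition T' where "T' i = (if 3 \<le> card (T i) then T i else {})"

lemma T'_sub: "T' i \<subseteq> T i" by (simp add: T'_def)

lemma T'_ne: "T' i \<noteq> {} \<Longrightarrow> 3 \<le> card (T i)" by (auto simp: T'_def split: if_splits)

text \<open>The deleted vertices are the five of the cycle, at most one in each \<open>S i\<close>,
  and at most two in each class that is too small: 5 + 5 + 10.\<close>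

lemma c5_cases: "(V, E) \<in> del 20 (C5_blowup \<union> Bip \<union> Columns)"
proof -
  interpret R: c5_blowup_parts V E T' Z
  proof
    note sub = subsetD[OF T'_sub]
    show "T' (i + 5) = T' i" for i by (simp only: T'_def T_period)
    show "T' i \<subseteq> V" for i using sub T_V by blast
    show "Z \<subseteq> V" using Z_V by blast
    show "T' i \<inter> T' (i + 1) = {}" for i using sub T_c(3) T_c1(3) by blast
    show "T' i \<inter> Z = {}" for i using sub T_c(2) Z_c by blast
    show "edgeless E (T' i)" for i using edgeless_T T'_sub by (rule edgeless_subset)
    show "edgeless E Z" by (rule edgeless_Z)
    show "\<not> E u v" if "u \<in> T' i" "v \<in> T' (i + 2)" for u v i using T_T2 sub that by blast
    show "v = v'" if "u \<in> T' i" "v \<in> T' (i + 1)" "v' \<in> T' (i + 1)" "\<not> E u v" "\<not> E u v'" for u v v' i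
      by (rule T_co1[OF sub sub sub that(4,5)]) (rule that)+
    show "u = u'" if "u \<in> T' i" "u' \<in> T' i" "v \<in> T' (i + 1)" "\<not> E u v" "\<not> E u' v" for u u' v i
      by (rule T_co2[OF sub sub sub that(4,5)]) (rule that)+
    show "E u v" if "T' (i + 2) \<noteq> {}" "u \<in> T' i" "v \<in> T' (i + 1)" for u v i
      by (rule T_full1[OF T'_ne sub sub]) (rule that)+
    show "E u v" if "T' (i + 4) \<noteq> {}" "u \<in> T' i" "v \<in> T' (i + 1)" for u v i
      by (rule T_full2[OF T'_ne sub sub]) (rule that)+
    show "E z x" if "z \<in> Z" "t \<in> T' i" "E z t" "x \<in> T' (i + 2) \<union> T' (i + 3)" for z t i x
      by (rule Z_far[OF that(1) sub[OF that(2)] that(3)]) (use that(4) sub in blast)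
    show "E z x" if "z \<in> Z" "t \<in> T' i" "E z t" "x \<in> T' (i + 1) \<union> T' (i + 4)" "\<not> E t x" for z t i x
      by (rule Z_near[OF that(1) sub[OF that(2)] that(3) _ that(5)]) (use that(4) sub in blast)
    show "3 \<le> card (T' i)" if "T' i \<noteq> {}" for i using that by (auto simp: T'_def split: if_splits)
  qed
  let ?W = "(\<Union>i. T' i) \<union> Z"
  let ?D = "V - ?W"
  have "?D \<subseteq> c ` {..<5} \<union> (\<Union>i<5. S i) \<union> (\<Union>i<5. T i - T' i)"
  proof
    fix v assume v: "v \<in> ?D"
    have cm: "c (i mod 5) = c i" and Sm: "S (i mod 5) = S i" and Tm: "T (i mod 5) = T i" and T'm: "T' (i mod 5) = T' i" for i
      by (rule periodic_mod, rule period S_period T_period R.period)+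
    consider (c) i where "v = c i" | (S) i where "v \<in> S i" | (T) i where "v \<in> T i - T' i"
      using v cover[of v] by blast
    then show "v \<in> c ` {..<5} \<union> (\<Union>i<5. S i) \<union> (\<Union>i<5. T i - T' i)"
    proof cases
      case c
      then have "v = c (i mod 5)" by (simp add: cm)
      then show ?thesis by auto
    next
      case S
      then have "v \<in> S (i mod 5)" by (simp add: Sm)
      then show ?thesis by auto
    next
      case T
      then have "v \<in> T (i mod 5) - T' (i mod 5)" by (simp add: Tm T'm)
      then show ?thesis by (intro UnI2 UN_I[of "i mod 5"]) auto
    qed
  qed
  moreover have finS: "finite (S i)" "finite (T i)" for i
    using fin by (auto simp: S_def T_def)
  ultimately have "card ?D \<le> card (c ` {..<5} \<union> (\<Union>i<5. S i) \<union> (\<Union>i<5. T i - T' i))"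
    by (intro card_mono) auto
  also have "\<dots> \<le> card (c ` {..<5}) + card (\<Union>i<5. S i) + card (\<Union>i<5. T i - T' i)" by (rule card_Un3_le)
  also have "card (c ` {..<5}) \<le> 5" using card_image_le[of "{..<5 :: nat}" c] by simp
  also have "card (\<Union>i<5. S i) \<le> (\<Sum>i<5. card (S i))" by (rule card_UN_le) simp
  also have "(\<Sum>i<5. card (S i)) \<le> (\<Sum>i<5 :: nat. 1)" by (rule sum_mono) (rule card_S)
  also have "card (\<Union>i<5. T i - T' i) \<le> (\<Sum>i<5. card (T i - T' i))" by (rule card_UN_le) simp
  also have "(\<Sum>i<5. card (T i - T' i)) \<le> (\<Sum>i<5 :: nat. 2)"
    by (rule sum_mono) (auto simp: T'_def)
  finally have "card ?D \<le> 20" by simp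
  moreover have "V - ?D = ?W" using R.TV R.ZV by blast
  ultimately show ?thesis using R.c5_blowup_parts_cases sgraph by (intro delI[of _ _ ?D]) auto
qed

end

section \<open>The main theorem\<close>

definition Cover :: "'v graph set" where
  "Cover = del 2 Clique_columns \<union> del 1 P3_free \<union> del 70 P3_free \<union> (del 3 P3_free \<union> del 6 Folded) \<union> (Bip \<union> del 20 (C5_blowup \<union> Bip \<union> Columns))"

lemma (in tfgraph) tf_cases: "(V, E) \<in> Bip \<union> del 20 (C5_blowup \<union> Bip \<union> Columns)"
proof (cases "\<exists>z a y x b. {z, a, y, x, b} \<subseteq> V \<and> E z a \<and> E a y \<and> E y x \<and> E x b \<and> E b z \<and>
    \<not> E z y \<and> \<not> E z x \<and> \<not> E a x \<and> \<not> E a b \<and> \<not> E y b")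
  case False
  have "(V, E) \<in> Bip" by (rule no_C5_Bip) (use False in blast)
  then show ?thesis by blast
next
  case True
  then obtain z a y x b where C: "{z, a, y, x, b} \<subseteq> V" "E z a" "E a y" "E y x" "E x b" "E b z"
    "\<not> E z y" "\<not> E z x" "\<not> E a x" "\<not> E a b" "\<not> E y b" by (elim exE conjE)
  define c where "c i = [z, a, y, x, b] ! (i mod 5)" for i :: nat
  have five: "i mod 5 = 0 \<or> i mod 5 = 1 \<or> i mod 5 = 2 \<or> i mod 5 = 3 \<or> i mod 5 = 4" for i :: nat
    by presburger
  have mod: "(i + 1) mod 5 = (i mod 5 + 1) mod 5" "(i + 2) mod 5 = (i mod 5 + 2) mod 5" for i :: nat
    by (simp_all add: mod_simps)
  have nth: "i mod 5 = 0 \<Longrightarrow> c i = z \<and> c (i + 1) = a \<and> c (i + 2) = y"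
    "i mod 5 = 1 \<Longrightarrow> c i = a \<and> c (i + 1) = y \<and> c (i + 2) = x"
    "i mod 5 = 2 \<Longrightarrow> c i = y \<and> c (i + 1) = x \<and> c (i + 2) = b"
    "i mod 5 = 3 \<Longrightarrow> c i = x \<and> c (i + 1) = b \<and> c (i + 2) = z"
    "i mod 5 = 4 \<Longrightarrow> c i = b \<and> c (i + 1) = z \<and> c (i + 2) = a" for i
    by (simp_all only: c_def mod[of i]) simp_all
  have no: "\<not> E x z" "\<not> E b a" using C sym by blast+
  interpret c5graph V E c
  proof
    show "c (i + 5) = c i" for i by (simp add: c_def)
    fix i :: nat
    from five[of i] show "c i \<in> V" by (elim disjE) (use nth[of i] C(1) in simp_all)
    from five[of i] show "E (c i) (c (i + 1))" by (elim disjE) (use nth[of i] C(2-6) in simp_all)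
    from five[of i] show "\<not> E (c i) (c (i + 2))" by (elim disjE) (use nth[of i] C(7-) no in simp_all)
  qed
  from c5_cases show ?thesis by (rule UnI2)
qed

lemma (in dpgraph) in_Cover: "(V, E) \<in> Cover"
proof -
  let ?cl = "\<lambda>R. R \<subseteq> V \<and> (\<forall>u \<in> R. \<forall>v \<in> R. u \<noteq> v \<longrightarrow> E u v)"
  have "\<exists>Q. ?cl Q \<and> (\<forall>R. ?cl R \<longrightarrow> card R \<le> card Q)"
  proof (rule ex_has_greatest_nat[of ?cl "{}" card "Suc (card V)"])
    show "?cl {}" by simp
    show "\<forall>R. ?cl R \<longrightarrow> card R < Suc (card V)" using fin by (simp add: less_Suc_eq_le card_mono)
  qed
  then obtain Q where Q: "?cl Q" "\<forall>R. ?cl R \<longrightarrow> card R \<le> card Q" by blast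
  interpret dpgraph_clique V E Q
    by unfold_locales (use Q in auto)
  consider "5 \<le> card Q" | "card Q = 4" | "card Q = 3" | "card Q \<le> 2" by linarith
  then show ?thesis
  proof cases
    case 1
    then show ?thesis using clique_ge5 unfolding Cover_def by blast
  next
    case 2
    then show ?thesis using clique_4 unfolding Cover_def by blast
  next
    case 3
    interpret dpgraph_triangle V E Q by unfold_locales (rule 3)
    show ?thesis using clique_3 unfolding Cover_def by blast
  next
    case 4
    interpret tfgraph V E
    proof
      fix u v w assume uvw: "{u, v, w} \<subseteq> V" "E u v" "E v w" "E u w"
      have ne: "u \<noteq> v" "v \<noteq> w" "u \<noteq> w" using uvw irrefl by blast+
      have "card {u, v, w} \<le> card Q"
        by (rule Qmax) (use uvw comm in auto)
      with ne 4 show False by simp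
    qed (rule sgraph p23free)+
    show ?thesis using tf_cases unfolding Cover_def by blast
  qed
qed

section \<open>Well-quasi-ordering of the cover\<close>

lemma lwqo_Clique_columns: "lwqo TYPE('l) (Clique_columns :: 'v graph set)"
  unfolding Clique_columns_def by (intro lwqo_layered lwqo_del lwqo_P3_free finite_lessThan)

lemma lwqo_Columns: "lwqo TYPE('l) (Columns :: 'v graph set)"
  unfolding Columns_def by (intro lwqo_layered lwqo_Un lwqo_Bip lwqo_del lwqo_Edgeless finite_lessThan)

lemma lwqo_C5_blowup: "lwqo TYPE('l) (C5_blowup :: 'v graph set)"
  unfolding C5_blowup_def by (intro lwqo_layered lwqo_Single finite_lessThan)

lemma lwqo_Folded: "lwqo TYPE('l) (Folded :: 'v graph set)"
  unfolding Folded_def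
  by (intro lwqo_folded lwqo_Un lwqo_Bip lwqo_Columns lwqo_del lwqo_Edgeless finite_SigmaI finite_lessThan finite)

lemma lwqo_Cover: "lwqo TYPE('l) (Cover :: 'v graph set)"
  unfolding Cover_def
  by (intro lwqo_Un lwqo_del lwqo_Folded lwqo_Columns lwqo_C5_blowup lwqo_Bip lwqo_P3_free lwqo_Clique_columns)

section \<open>From forbidden induced subgraphs to adjacency conditions\<close>

abbreviation diamond :: "(nat \<times> nat + nat) pair_pre_digraph" where
  "diamond \<equiv> complement (disjoint_union (copies 2 (path_graph 1)) (path_graph 2))"

abbreviation P2P3 :: "(nat + nat) pair_pre_digraph" where
  "P2P3 \<equiv> disjoint_union (path_graph 2) (path_graph 3)"

lemma path_graph_arcs:
  "parcs (path_graph (Suc 0)) = {}" "parcs (path_graph 2) = {(0, 1), (1, 0)}"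
  "parcs (path_graph 3) = {(0, 1), (1, 0), (1, 2), (2, 1)}"
  by (auto simp: path_graph_def numeral_eq_Suc less_Suc_eq)

lemma path_graph_verts:
  "pverts (path_graph (Suc 0)) = {0}" "pverts (path_graph 2) = {0, 1}" "pverts (path_graph 3) = {0, 1, 2}"
  by (auto simp: path_graph_def)

lemma dpgraph_of_free:
  assumes G: "pair_graph G" "free_of diamond G" "free_of P2P3 G"
  shows "dpgraph (pverts G) (\<lambda>u v. (u, v) \<in> parcs G)"
proof
  let ?E = "\<lambda>u v. (u, v) \<in> parcs G"
  have sg: "finite (pverts G)" "sym (parcs G)" "irrefl (parcs G)" using G(1) by (auto simp: pair_graph_iff)
  then show "sgraph (pverts G) ?E"
    unfolding sgraph_def by (auto simp: sym_def irrefl_def intro!: sympI irreflpI)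
  have sym: "?E u v \<longleftrightarrow> ?E v u" for u v using sg(2) by (meson symD)
  have irr: "\<not> ?E u u" for u using sg(3) by (simp add: irrefl_def)
  have v1: "{..<2 :: nat} = {0, 1}" by auto
  show "p23free (pverts G) ?E"
    unfolding p23free_def
  proof (intro ballI impI, rule ccontr)
    fix a b c d e
    assume V: "a \<in> pverts G" "b \<in> pverts G" "c \<in> pverts G" "d \<in> pverts G" "e \<in> pverts G"
      and E: "?E a b" "?E c d" "?E d e" "c \<noteq> e"
      and no: "\<not> (?E c e \<or> ?E a c \<or> ?E a d \<or> ?E a e \<or> ?E b c \<or> ?E b d \<or> ?E b e)"
    define g :: "nat + nat \<Rightarrow> _" where
      "g = case_sum (\<lambda>i. if i = 0 then a else b) (\<lambda>i. if i = 0 then c else if i = 1 then d else e)"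
    have pv: "pverts P2P3 = {Inl 0, Inl 1, Inr 0, Inr 1, Inr 2}"
      by (auto simp: disjoint_union_def path_graph_verts)
    have pa: "parcs P2P3 = {(Inr 0, Inr 1), (Inr 1, Inr 0), (Inr 1, Inr 2), (Inr 2, Inr 1), (Inl 0, Inl 1), (Inl 1, Inl 0)}"
      by (simp add: disjoint_union_def path_graph_arcs)
    have gv: "g (Inl 0) = a" "g (Inl (Suc 0)) = b" "g (Inr 0) = c" "g (Inr (Suc 0)) = d" "g (Inr 2) = e"
      by (simp_all add: g_def)
    have ne: "a \<noteq> b" "c \<noteq> d" "d \<noteq> e" "a \<noteq> c" "a \<noteq> d" "a \<noteq> e" "b \<noteq> c" "b \<noteq> d" "b \<noteq> e"
      using E no irr sym by blast+
    have "inj_on g (pverts P2P3)" unfolding pv inj_on_def using ne E(4) by (auto simp: gv)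
    moreover have "g ` pverts P2P3 \<subseteq> pverts G" unfolding pv using V by (auto simp: gv)
    moreover have "\<forall>u \<in> pverts P2P3. \<forall>v \<in> pverts P2P3. (u, v) \<in> parcs P2P3 \<longleftrightarrow> (g u, g v) \<in> parcs G"
      unfolding pv pa using E no irr sym by (auto simp: gv)
    moreover have "pair_graph P2P3" by (intro pair_graph_disjoint_union pair_graph_path_graph)
    ultimately show False using free_of_iff[OF _ G(1), of P2P3] G(3) by blast
  qed
  fix a b c d
  assume V: "{a, b, c, d} \<subseteq> pverts G" and E: "?E c d" "?E a c" "?E a d" "?E b c" "?E b d" "a \<noteq> b"
  show "?E a b"
  proof (rule ccontr)
    assume no: "\<not> ?E a b"
    \<comment> \<open>The only nonadjacent pair of the diamond comes from the edge of the
      complemented P2, so the ends of that edge are sent to \<open>a\<close> and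
      \<open>b\<close>.\<close>
    define g :: "nat \<times> nat + nat \<Rightarrow> _" where
      "g = case_sum (\<lambda>(i, _). if i = 0 then c else d) (\<lambda>i. if i = 0 then a else b)"
    have pv: "pverts diamond = {Inl (0, 0), Inl (1, 0), Inr 0, Inr 1}"
      by (auto simp: complement_def disjoint_union_def copies_def path_graph_verts v1)
    have pa: "(u, v) \<in> parcs diamond \<longleftrightarrow> u \<in> pverts diamond \<and> v \<in> pverts diamond \<and> u \<noteq> v \<and>
        (u, v) \<noteq> (Inr 0, Inr 1) \<and> (u, v) \<noteq> (Inr 1, Inr 0)" for u v
      by (auto simp: complement_def disjoint_union_def copies_def path_graph_arcs path_graph_verts)
    have gv: "g (Inl (0, 0)) = c" "g (Inl (Suc 0, 0)) = d" "g (Inr 0) = a" "g (Inr (Suc 0)) = b"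
      by (simp_all add: g_def)
    have ne: "c \<noteq> d" "a \<noteq> c" "a \<noteq> d" "b \<noteq> c" "b \<noteq> d" using E irr by blast+
    have "inj_on g (pverts diamond)" unfolding pv inj_on_def using ne E(6) by (auto simp: gv)
    moreover have "g ` pverts diamond \<subseteq> pverts G" unfolding pv using V by (auto simp: gv)
    moreover have "\<forall>u \<in> pverts diamond. \<forall>v \<in> pverts diamond. (u, v) \<in> parcs diamond \<longleftrightarrow> (g u, g v) \<in> parcs G"
      unfolding pa unfolding pv using E no irr sym by (auto simp: gv)
    moreover have "pair_graph diamond"
      by (intro pair_graph_complement pair_graph_disjoint_union pair_graph_copies pair_graph_path_graph)
    ultimately show False using free_of_iff[OF _ G(1), of diamond] G(2) by blast
  qed
qed

theorem theorem2:
  shows "wqo_by_labelled_induced_subgraph TYPE('l)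
    {G :: 'v pair_pre_digraph. pair_graph G \<and>
      free_of (complement (disjoint_union (copies 2 (path_graph 1)) (path_graph 2))) G \<and>
      free_of (disjoint_union (path_graph 2) (path_graph 3)) G}"
  unfolding wqo_by_labelled_induced_subgraph_def
proof (intro allI impI notI)
  fix le :: "'l \<Rightarrow> 'l \<Rightarrow> bool" and W
  let ?X = "{G :: 'v pair_pre_digraph. pair_graph G \<and> free_of diamond G \<and> free_of P2P3 G}"
  assume "wqo_on le W"
  then have "af_on le W" unfolding wqo_on_def af_on_def image_subset_iff by simp
  then have af: "af_on (emb le) (lab (Cover :: 'v graph set) W)"
    using lwqo_Cover[where 'l = 'l and 'v = 'v] unfolding lwqo_def by blast
  assume "\<exists>A. A \<subseteq> labelled_graphs ?X W \<and> infinite A \<and> antichain (labelled_induced_subgraph le) A"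
  then obtain A where A: "A \<subseteq> labelled_graphs ?X W" "infinite A" "antichain (labelled_induced_subgraph le) A"
    by blast
  from A(2) obtain x :: "nat \<Rightarrow> _" where x: "inj x" "range x \<subseteq> A" using infinite_countable_subset by blast
  have xA: "x i \<in> A" for i using x(2) by blast
  have xX: "fst (x i) \<in> ?X" "\<forall>v \<in> pverts (fst (x i)). snd (x i) v \<in> W" for i
    using subsetD[OF A(1) xA[of i]] by (auto simp: labelled_graphs_def)
  define F where "F i = (pverts (fst (x i)), (\<lambda>u v. (u, v) \<in> parcs (fst (x i))), snd (x i))" for i
  have "F i \<in> lab Cover W" for i
  proof -
    have "pair_graph (fst (x i))" "free_of diamond (fst (x i))" "free_of P2P3 (fst (x i))"
      using xX(1)[of i] by auto
    from dpgraph.in_Cover[OF dpgraph_of_free[OF this]] show ?thesis using xX(2)[of i] by (simp add: F_def lab_def)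
  qed
  with af obtain i j where ij: "i < j" "emb le (F i) (F j)" by (rule af_onD)
  have "labelled_induced_subgraph le (fst (x i), snd (x i)) (fst (x j), snd (x j))"
    using ij(2) xX(1)[of i] xX(1)[of j] by (subst labelled_induced_subgraph_iff) (auto simp: emb_def F_def)
  moreover have "x i \<noteq> x j" using x(1) ij(1) by (auto dest: injD)
  ultimately show False using A(3) xA unfolding antichain_def by (metis prod.collapse)
qed

end
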